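(* Consider the symmetric Gaussian interfering multiple access channel (IMAC) with parameters $(P_1,P_2,h_1,h_2)$, and let $\mathcal{C}$ be its capacity region. Suppose the channel has individually very strong interference, i.e. $$h_1^2\ge 1+P_1+P_2\quad\text{and}\quad h_2^2\ge 1+P_1+P_2 .$$ Then $$\mathcal{C}=\left\{(R_1,R_2,R_3,R_4)\in\mathbb{R}_+^4:\ (R_1,R_2)\in\mathcal{C}^M(\{1,2\},1),\ (R_3,R_4)\in\mathcal{C}^M(\{3,4\},2)\right\}.$$
   Context: Channel model. Let $P_1,P_2\ge 0$ and $h_1,h_2\in\mathbb{R}$; put $P_3=P_1$, $P_4=P_2$. The IMAC with parameters $(P_1,P_2,h_1,h_2)$ is the memoryless channel with four real inputs $X_1,\dots,X_4$ and two real outputs $$Y_1=X_1+X_2+h_1X_3+h_2X_4+Z_1,\qquad Y_2=h_1X_1+h_2X_2+X_3+X_4+Z_2,$$ where $Z_1,Z_2\sim\mathcal{N}(0,1)$ are independent of each other, i.i.d. over time, and independent of the inputs. Transmitters 1 and 2 have messages for receiver 1 (observing $Y_1$); transmitters 3 and 4 have messages for receiver 2 (observing $Y_2$). Codes and capacity. An $(n,2^{nR_1},2^{nR_2},2^{nR_3},2^{nR_4})$ code consists of message sets $\mathcal{M}_i=\{1,\dots,2^{nR_i}\}$ (with $2^{nR_i}$ rounded up to an integer), encoders $f_i:\mathcal{M}_i\to\mathbb{R}^n$, $i=1,2,3,4$, and decoders $g_i:\mathbb{R}^n\to\mathcal{M}_i$, with $g_1,g_2$ applied to $Y_1^n$ and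 $g_3,g_4$ applied to $Y_2^n$. The messages $M_i$ are independent and uniform on $\mathcal{M}_i$, $X_i^n=f_i(M_i)$, and the average power constraints $\frac1n\sum_{t=1}^n\mathbb{E}[X_{i,t}^2]\le P_i$ must hold for $i=1,2,3,4$. With $\hat M_i$ the decoder outputs, the error probability is $P_e^{(n)}=P(\hat M_i\ne M_i\text{ for some }i)$. A tuple $(R_1,R_2,R_3,R_4)$ of nonnegative reals is achievable if there is a sequence of such codes with $P_e^{(n)}\to0$ as $n\to\infty$. The capacity region $\mathcal{C}$ is the closure of the set of achievable tuples. MAC regions. Let $h_{ij}$ be the coefficient from transmitter $i$ to receiver $j$: $h_{11}=h_{21}=h_{32}=h_{42}=1$, $h_{31}=h_{12}=h_1$, $h_{41}=h_{22}=h_2$. For $\mathcal{S}\subseteq\{1,2,3,4\}$, $j\in\{1,2\}$, $N>0$, $\mathcal{C}^M(\mathcal{S},j,N)\subseteq\mathbb{R}_+^{|\mathcal{S}|}$ is the capacity region of the Gaussian multiple access channel from the transmitters in $\mathcal{S}$ to receiver $j$ with noise variance $N$, i.e. the set of $(R_i)_{i\in\mathcal{S}}$ with $R_i\ge0$ and $$\sum_{i\in\mathcal{T}}R_i\le\tfrac12\log\Big(1+\sum_{i\in\mathcal{T}}h_{ij}^2P_i/N\Big)\quad\text{for all }\mathcal{T}\subseteq\mathcal{S}.$$ Abbreviate $\mathcal{C}^M(\mathcal{S},j)=\mathcal{C}^M(\mathcal{S},j,1)$. Logarithms are to base 2. *)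

theory Defs
  imports "HOL-Probability.Probability"
begin

text \<open>
  Transmitters are indexed by the four-element type \<open>4\<close> and receivers by the two-element type \<open>2\<close>.
  In these numeral types \<open>4 = (0 :: 4)\<close> and \<open>2 = (0 :: 2)\<close>, so \<open>1, 2, 3, 4\<close> and \<open>1, 2\<close> enumerate
  all indices.
\<close>

definition receiver_of :: "4 \<Rightarrow> 2" where
  "receiver_of i = (if i = 1 \<or> i = 2 then 1 else 2)"

definition tx_power :: "real \<Rightarrow> real \<Rightarrow> 4 \<Rightarrow> real" where
  "tx_power P1 P2 i = (if i = 1 \<or> i = 3 then P1 else P2)"

definition gain :: "real \<Rightarrow> real \<Rightarrow> 4 \<Rightarrow> 2 \<Rightarrow> real" where
  "gain h1 h2 i j =
     (if j = receiver_of i then 1 else if i = 1 \<or> i = 3 then h1 else h2)"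

text \<open>
  A received word of length \<open>n\<close> is a function that is \<open>undefined\<close> outside \<open>{..<n}\<close>, so that it is a
  point of \<open>Pi\<^sub>M {..<n} (\<lambda>_. borel)\<close>; of inputs, only the values at times \<open>t < n\<close> matter.
  Below, \<open>x i t\<close> is the input of transmitter \<open>i\<close> and \<open>z j t\<close> the noise at receiver \<open>j\<close>, at time \<open>t\<close>.
\<close>

definition received ::
  "real \<Rightarrow> real \<Rightarrow> nat \<Rightarrow> (4 \<Rightarrow> nat \<Rightarrow> real) \<Rightarrow> (2 \<Rightarrow> nat \<Rightarrow> real) \<Rightarrow> 2 \<Rightarrow> nat \<Rightarrow> real" where
  "received h1 h2 n x z j = (\<lambda>t\<in>{..<n}. (\<Sum>i\<in>UNIV. gain h1 h2 i j * x i t) + z j t)"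

lemma received_1:
  "t < n \<Longrightarrow> received h1 h2 n x z 1 t = x 1 t + x 2 t + h1 * x 3 t + h2 * x 4 t + z 1 t"
  by (simp add: received_def sum_4 gain_def receiver_of_def)

lemma received_2:
  "t < n \<Longrightarrow> received h1 h2 n x z 2 t = h1 * x 1 t + h2 * x 2 t + x 3 t + x 4 t + z 2 t"
  by (simp add: received_def sum_4 gain_def receiver_of_def)

definition messages :: "nat \<Rightarrow> real \<Rightarrow> nat set" where
  "messages n r = {1 .. nat \<lceil>2 powr (real n * r)\<rceil>}"

definition message_pmf :: "nat \<Rightarrow> real \<Rightarrow> nat pmf" where
  "message_pmf n r = pmf_of_set (messages n r)"

text \<open>
  The sample space of a block of length \<open>n\<close>: independent uniform messages, and, independently of
  them, one independent standard normal variable for each receiver and time.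
\<close>

definition noise_measure :: "nat \<Rightarrow> (2 \<Rightarrow> nat \<Rightarrow> real) measure" where
  "noise_measure n =
     Pi\<^sub>M UNIV (\<lambda>_. Pi\<^sub>M {..<n} (\<lambda>_. density lborel (\<lambda>x. ennreal (std_normal_density x))))"

definition block_measure ::
  "nat \<Rightarrow> real ^ 4 \<Rightarrow> ((4 \<Rightarrow> nat) \<times> (2 \<Rightarrow> nat \<Rightarrow> real)) measure" where
  "block_measure n R = Pi\<^sub>M UNIV (\<lambda>i. measure_pmf (message_pmf n (R $ i))) \<Otimes>\<^sub>M noise_measure n"

text \<open>
  \<open>f i m t\<close> is the symbol that encoder \<open>i\<close> sends for message \<open>m\<close> at time \<open>t\<close>, and \<open>g i y\<close> is the
  message that decoder \<open>i\<close> outputs for the received word \<open>y\<close>. Decoders have to be measurable: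
  otherwise the error event need not have a probability, and \<open>measure\<close> would give it the value 0.
\<close>

definition is_code ::
  "real \<Rightarrow> real \<Rightarrow> nat \<Rightarrow> real ^ 4 \<Rightarrow> (4 \<Rightarrow> nat \<Rightarrow> nat \<Rightarrow> real) \<Rightarrow>
     (4 \<Rightarrow> (nat \<Rightarrow> real) \<Rightarrow> nat) \<Rightarrow> bool" where
  "is_code P1 P2 n R f g \<longleftrightarrow>
     (\<forall>i. (1 / real n) *
            (\<Sum>t<n. measure_pmf.expectation (message_pmf n (R $ i)) (\<lambda>m. (f i m t)\<^sup>2))
          \<le> tx_power P1 P2 i) \<and>
     (\<forall>i. g i \<in> measurable (Pi\<^sub>M {..<n} (\<lambda>_. borel)) (count_space (messages n (R $ i))))"

definition error_prob ::
  "real \<Rightarrow> real \<Rightarrow> nat \<Rightarrow> real ^ 4 \<Rightarrow> (4 \<Rightarrow> nat \<Rightarrow> nat \<Rightarrow> real) \<Rightarrow>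
     (4 \<Rightarrow> (nat \<Rightarrow> real) \<Rightarrow> nat) \<Rightarrow> real" where
  "error_prob h1 h2 n R f g =
     measure (block_measure n R)
       {(m, z) \<in> space (block_measure n R).
          \<exists>i. g i (received h1 h2 n (\<lambda>k. f k (m k)) z (receiver_of i)) \<noteq> m i}"

definition achievable :: "real \<Rightarrow> real \<Rightarrow> real \<Rightarrow> real \<Rightarrow> real ^ 4 \<Rightarrow> bool" where
  "achievable P1 P2 h1 h2 R \<longleftrightarrow>
     (\<forall>i. 0 \<le> R $ i) \<and>
     (\<exists>f g. (\<forall>n\<ge>1. is_code P1 P2 n R (f n) (g n)) \<and>
            (\<lambda>n. error_prob h1 h2 n R (f n) (g n)) \<longlonglongrightarrow> 0)"

definition capacity_region :: "real \<Rightarrow> real \<Rightarrow> real \<Rightarrow> real \<Rightarrow> (real ^ 4) set" where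
  "capacity_region P1 P2 h1 h2 = closure {R. achievable P1 P2 h1 h2 R}"

text \<open>
  A rate tuple indexed by \<open>S\<close> is a function that is \<open>undefined\<close> outside \<open>S\<close>.
\<close>

definition mac_region ::
  "real \<Rightarrow> real \<Rightarrow> real \<Rightarrow> real \<Rightarrow> 4 set \<Rightarrow> 2 \<Rightarrow> real \<Rightarrow> (4 \<Rightarrow> real) set" where
  "mac_region P1 P2 h1 h2 S j N =
     {R \<in> S \<rightarrow>\<^sub>E {0..}. \<forall>T\<subseteq>S.
        (\<Sum>i\<in>T. R i) \<le> 1 / 2 * log 2 (1 + (\<Sum>i\<in>T. (gain h1 h2 i j)\<^sup>2 * tx_power P1 P2 i / N))}"

end

theory Submission
  imports Defs
begin

text \<open>
  Converse: if receiver \<open>j\<close> decodes a subset \<open>T\<close> of its own users, fix the other messages and compare the output law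
  with a Gaussian law \<open>Q\<close> of variance \<open>1 + P\<^sub>T\<close> centred at the mean of the codewords. The Donsker--Varadhan
  inequality for the test function \<open>ln M\<close> times the indicator of correct decoding gives
  \<open>(1 - \<epsilon>) ln M \<le> n/2 ln (1 + P\<^sub>T) + ln 2\<close>, because the average divergence from \<open>Q\<close> is at most \<open>n/2 ln (1 + P\<^sub>T)\<close>
  and the decoding sets are disjoint.

  Achievability: with independent Gaussian codebooks every receiver jointly decodes all four messages by thresholding
  the information densities of all sets \<open>T\<close> of users. This works if the rates of \<open>T\<close> sum to less than the capacity of
  the four-user multiple access channel to that receiver. If \<open>A\<close> and \<open>B\<close> are the wanted and the interfering users of
  \<open>T\<close>, very strong interference gives \<open>(1 + P\<^sub>A) (1 + P\<^sub>B) \<le> 1 + P\<^sub>A + \<Sum>i\<in>B. h\<^sub>i\<^sup>2 P\<^sub>i\<close>, so that the two interference-free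
  constraints for \<open>A\<close> and \<open>B\<close> already imply the one for \<open>T\<close>.
\<close>

section \<open>Sums of independent Gaussian variables\<close>

text \<open>One deterministic code must serve both receivers and meet four power constraints. All
  bad events are therefore put into one sum: decoding failures averaged over the messages, and a
  power violation of each user with weight 1. A violation depends on the codebook alone, so once the
  codebook is fixed its probability is 0 or 1, and a total below 1 excludes it. The letters have
  variance P/(1 + d), which leaves room for fluctuations of the empirical power.

  Strict inequality cannot be asked of every set of users: a user of power 0 has rate 0, and 0 < 0
  fails. Only sets of users with positive rates are tested, which loses nothing because a user of
  rate 0 has a single message. Shrinking a point of the region towards 0 makes these inequalities
  strict, and the closure restores the point.

  In the converse the fixed messages of the other users merely translate the output, so the cross
  gains cancel. Centring the codewords at their mean makes the powers of several users add;
  uncentred codewords could add up coherently.\<close>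

lemma (in prob_space) uncorrelated_sum_square:
  fixes Y :: "'i \<Rightarrow> 'a \<Rightarrow> real"
  assumes fin: "finite I"
    and int: "\<And>i j. i \<in> I \<Longrightarrow> j \<in> I \<Longrightarrow> integrable M (\<lambda>x. Y i x * Y j x)"
    and uncor: "\<And>i j. i \<in> I \<Longrightarrow> j \<in> I \<Longrightarrow> i \<noteq> j \<Longrightarrow> expectation (\<lambda>x. Y i x * Y j x) = 0"
  shows "integrable M (\<lambda>x. (\<Sum>i\<in>I. Y i x)\<^sup>2)"
    and "expectation (\<lambda>x. (\<Sum>i\<in>I. Y i x)\<^sup>2) = (\<Sum>i\<in>I. expectation (\<lambda>x. (Y i x)\<^sup>2))"
proof -
  have eq: "(\<Sum>i\<in>I. Y i x)\<^sup>2 = (\<Sum>i\<in>I. \<Sum>j\<in>I. Y i x * Y j x)" for x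
    by (simp add: power2_eq_square sum_product)
  show "integrable M (\<lambda>x. (\<Sum>i\<in>I. Y i x)\<^sup>2)"
    unfolding eq using int by auto
  have "expectation (\<lambda>x. (\<Sum>i\<in>I. Y i x)\<^sup>2) = (\<Sum>i\<in>I. \<Sum>j\<in>I. expectation (\<lambda>x. Y i x * Y j x))"
    unfolding eq using int by (subst Bochner_Integration.integral_sum; auto intro!: sum.cong)
  also have "\<dots> = (\<Sum>i\<in>I. \<Sum>j\<in>I. if j = i then expectation (\<lambda>x. Y i x * Y j x) else 0)"
    using uncor by (intro sum.cong) auto
  also have "\<dots> = (\<Sum>i\<in>I. expectation (\<lambda>x. (Y i x)\<^sup>2))"
    using fin by (simp add: power2_eq_square)
  finally show "expectation (\<lambda>x. (\<Sum>i\<in>I. Y i x)\<^sup>2) = (\<Sum>i\<in>I. expectation (\<lambda>x. (Y i x)\<^sup>2))" .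
qed

lemma (in prob_space) std_normal_moments:
  fixes X :: "'a \<Rightarrow> real"
  assumes D: "distributed M lborel X std_normal_density"
  shows "integrable M (\<lambda>x. (X x)^k)" "expectation (\<lambda>x. (X x)\<^sup>2) = 1" "expectation (\<lambda>x. (X x)^4) = 3"
proof -
  have "integrable lborel (\<lambda>x. std_normal_density x *\<^sub>R x ^ k)"
    using integrable_std_normal_moment[of k] by simp
  then show "integrable M (\<lambda>x. (X x)^k)"
    using distributed_integrable[OF D, of "\<lambda>x. x^k"] by simp
  show "expectation (\<lambda>x. (X x)\<^sup>2) = 1"
    using distributed_integral[OF D, of "\<lambda>x. x^2"] integral_std_normal_moment_even[of 1]
    by simp
  show "expectation (\<lambda>x. (X x)^4) = 3"
    using distributed_integral[OF D, of "\<lambda>x. x^4"] integral_std_normal_moment_even[of 2]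
    by (simp add: fact_numeral)
qed

text \<open>Chebyshev for the centred squares X^2 - 1, whose variance is 3 - 2 + 1 = 2. A polynomial
  rate is enough: only a bounded number of such events enters the union bounds, while the many wrong
  codewords are treated by an exponential bound.\<close>

lemma (in prob_space) chi_square_concentration:
  fixes X :: "'i \<Rightarrow> 'a \<Rightarrow> real" and d :: real
  assumes fin: "finite I" and ne: "I \<noteq> {}"
    and ind: "indep_vars (\<lambda>_. borel) X I"
    and D: "\<And>i. i \<in> I \<Longrightarrow> distributed M lborel (X i) std_normal_density"
    and d: "0 < d"
  shows "prob {x \<in> space M. d * card I \<le> \<bar>(\<Sum>i\<in>I. (X i x)\<^sup>2) - card I\<bar>} \<le> 2 / (d\<^sup>2 * card I)"
proof -
  define Y where "Y i x = (X i x)\<^sup>2 - 1" for i x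
  have rv[measurable]: "X i \<in> borel_measurable M" if "i \<in> I" for i
    using ind that by (auto simp: indep_vars_def)
  have indY: "indep_vars (\<lambda>_. borel) Y I"
    unfolding Y_def
    by (rule indep_vars_compose2[where Y="\<lambda>_ x. x\<^sup>2 - 1" and N="\<lambda>_. borel", OF ind]) simp
  have sq: "(Y i x)\<^sup>2 = (X i x)^4 - 2 * (X i x)\<^sup>2 + 1" for i x
    by (simp add: Y_def power2_diff power_mult[symmetric])
  have intY: "integrable M (Y i)" and Y0: "expectation (Y i) = 0"
    and intY2: "integrable M (\<lambda>x. (Y i x)\<^sup>2)" and Y2: "expectation (\<lambda>x. (Y i x)\<^sup>2) = 2"
    if "i \<in> I" for i
  proof -
    note m = std_normal_moments[OF D[OF that]]
    show "integrable M (Y i)" unfolding Y_def using m(1)[of 2] by auto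
    show "expectation (Y i) = 0"
      unfolding Y_def using m by (simp add: prob_space)
    show "integrable M (\<lambda>x. (Y i x)\<^sup>2)" unfolding sq using m(1)[of 2] m(1)[of 4] by auto
    show "expectation (\<lambda>x. (Y i x)\<^sup>2) = 2"
      unfolding sq using m by (simp add: prob_space)
  qed
  have iv: "indep_var borel (Y i) borel (Y j)" if "i \<in> I" "j \<in> I" "i \<noteq> j" for i j
    using indep_var_compose[OF indep_var_restrict[OF indY, of "{i}" "{j}"],
        of "\<lambda>f. f i" borel "\<lambda>f. f j" borel] that
    by (simp add: comp_def)
  have int: "integrable M (\<lambda>x. Y i x * Y j x)" if "i \<in> I" "j \<in> I" for i j
    using intY2[OF that(1)] indep_var_integrable[OF iv[of i j] intY intY] that
    by (cases "i = j") (auto simp: power2_eq_square)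
  have uncor: "expectation (\<lambda>x. Y i x * Y j x) = 0" if "i \<in> I" "j \<in> I" "i \<noteq> j" for i j
    using indep_var_lebesgue_integral[OF iv[of i j] intY intY] that by (simp add: Y0)
  note U = uncorrelated_sum_square[OF fin int uncor]
  have S: "(\<Sum>i\<in>I. (X i x)\<^sup>2) - card I = (\<Sum>i\<in>I. Y i x)" for x
    by (simp add: Y_def sum_subtractf)
  have [measurable]: "(\<lambda>x. \<Sum>i\<in>I. Y i x) \<in> borel_measurable M"
    unfolding Y_def by measurable
  have E: "expectation (\<lambda>x. \<Sum>i\<in>I. Y i x) = 0"
    using intY by (subst Bochner_Integration.integral_sum) (auto simp: Y0)
  have c: "card I > 0" using fin ne by (simp add: card_gt_0_iff)
  have "prob {x \<in> space M. d * card I \<le> \<bar>(\<Sum>i\<in>I. Y i x) - expectation (\<lambda>x. \<Sum>i\<in>I. Y i x)\<bar>}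
      \<le> variance (\<lambda>x. \<Sum>i\<in>I. Y i x) / (d * card I)\<^sup>2"
    by (rule Chebyshev_inequality) (use U(1) d c in auto)
  then have "prob {x \<in> space M. d * card I \<le> \<bar>\<Sum>i\<in>I. Y i x\<bar>} \<le> (card I * 2) / (d * card I)\<^sup>2"
    using U(2) Y2 E by simp
  then show ?thesis
    unfolding S using c by (simp add: power2_eq_square mult.assoc)
qed

lemma (in prob_space) weighted_sum_std_normal:
  fixes X :: "'i \<Rightarrow> 'a \<Rightarrow> real" and a :: "'i \<Rightarrow> real"
  assumes fin: "finite J" and ind: "indep_vars (\<lambda>_. borel) X J"
    and D: "\<And>i. i \<in> J \<Longrightarrow> distributed M lborel (X i) std_normal_density"
    and pos: "0 < (\<Sum>i\<in>J. (a i)\<^sup>2)"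
  shows "distributed M lborel (\<lambda>x. \<Sum>i\<in>J. a i * X i x) (normal_density 0 (sqrt (\<Sum>i\<in>J. (a i)\<^sup>2)))"
proof -
  \<comment> \<open>A term with coefficient 0 has no normal density, so only the others enter the
    rule for sums of normal variables; \<open>pos\<close> guarantees that some remain.\<close>
  define K where "K = {i\<in>J. a i \<noteq> 0}"
  have K: "finite K" "K \<subseteq> J" using fin by (auto simp: K_def)
  have s: "(\<Sum>i\<in>J. (a i)\<^sup>2) = (\<Sum>i\<in>K. (a i)\<^sup>2)"
    by (rule sum.mono_neutral_right) (use fin in \<open>auto simp: K_def\<close>)
  have s': "(\<Sum>i\<in>J. a i * X i x) = (\<Sum>i\<in>K. a i * X i x)" for x
    by (rule sum.mono_neutral_right) (use fin in \<open>auto simp: K_def\<close>)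
  have ne: "K \<noteq> {}" using pos s by auto
  have "indep_vars (\<lambda>_. borel) (\<lambda>i x. a i * X i x) K"
    by (rule indep_vars_compose2[where Y="\<lambda>i x. a i * x" and N="\<lambda>_. borel", OF indep_vars_subset[OF ind K(2)]]) measurable
  moreover have "distributed M lborel (\<lambda>x. a i * X i x) (normal_density 0 \<bar>a i\<bar>)" if "i \<in> K" for i
    using normal_density_affine[OF D[of i], of "a i" 0] that by (auto simp: K_def)
  ultimately have "distributed M lborel (\<lambda>x. \<Sum>i\<in>K. a i * X i x)
      (normal_density (\<Sum>i\<in>K. 0) (sqrt (\<Sum>i\<in>K. \<bar>a i\<bar>\<^sup>2)))"
    by (intro sum_indep_normal K ne) (auto simp: K_def)
  then show ?thesis by (simp add: s s')
qed

text \<open>The families used later are indexed by a source and a time. With time slices as blocks,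
  anything computed slot by slot becomes independent over time. \<open>H\<close> separates the
  wanted form of the variables from their form as functions of a block.\<close>

lemma (in prob_space) indep_vars_block_functions:
  fixes G :: "'k \<Rightarrow> 'a \<Rightarrow> real" and F :: "'l \<Rightarrow> ('k \<Rightarrow> real) \<Rightarrow> real"
  assumes "indep_vars (\<lambda>_. borel) G I" "\<And>j. j \<in> L \<Longrightarrow> K j \<subseteq> I" "disjoint_family_on K L"
    and "\<And>j. j \<in> L \<Longrightarrow> F j \<in> borel_measurable (Pi\<^sub>M (K j) (\<lambda>_. borel))"
    and "\<And>j x. j \<in> L \<Longrightarrow> F j (\<lambda>k\<in>K j. G k x) = H j x"
  shows "indep_vars (\<lambda>_. borel) H L"
proof -
  have "indep_vars (\<lambda>_. borel) (\<lambda>j x. F j (\<lambda>k\<in>K j. G k x)) L"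
    by (rule indep_vars_compose2[OF indep_vars_restrict[OF assms(1-3)]]) (use assms(4) in auto)
  then show ?thesis
    using assms(5) by (subst (asm) indep_vars_cong[where Y=H]) auto
qed

lemma (in prob_space) std_normal_block_sums:
  fixes G :: "'k \<times> nat \<Rightarrow> 'a \<Rightarrow> real" and a :: "'k \<Rightarrow> real"
  assumes fin: "finite B" and ind: "indep_vars (\<lambda>_. borel) G (B \<times> {..<n})"
    and D: "\<And>k. k \<in> B \<times> {..<n} \<Longrightarrow> distributed M lborel (G k) std_normal_density"
    and pos: "0 < (\<Sum>k\<in>B. (a k)\<^sup>2)"
  defines "s \<equiv> sqrt (\<Sum>k\<in>B. (a k)\<^sup>2)"
  shows "t < n \<Longrightarrow> distributed M lborel (\<lambda>x. \<Sum>k\<in>B. a k * G (k, t) x) (normal_density 0 s)"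
    and "t < n \<Longrightarrow> distributed M lborel (\<lambda>x. (\<Sum>k\<in>B. a k * G (k, t) x) / s) std_normal_density"
    and "indep_vars (\<lambda>_. borel) (\<lambda>t x. (\<Sum>k\<in>B. a k * G (k, t) x) / s) {..<n}"
proof -
  have s: "0 < s" using pos by (simp add: s_def)
  show N: "distributed M lborel (\<lambda>x. \<Sum>k\<in>B. a k * G (k, t) x) (normal_density 0 s)" if "t < n" for t
    unfolding s_def
  proof (rule weighted_sum_std_normal[OF fin _ _ pos])
    show "indep_vars (\<lambda>_. borel) (\<lambda>k. G (k, t)) B"
      by (rule indep_vars_block_functions[OF ind, of _ "\<lambda>k. {(k,t)}" "\<lambda>k f. f (k,t)"])
        (use that in \<open>auto simp: disjoint_family_on_def\<close>)
  qed (use D that in auto)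
  show "distributed M lborel (\<lambda>x. (\<Sum>k\<in>B. a k * G (k, t) x) / s) std_normal_density" if "t < n"
    using N[OF that] normal_standard_normal_convert[OF s, of _ 0] by simp
  show "indep_vars (\<lambda>_. borel) (\<lambda>t x. (\<Sum>k\<in>B. a k * G (k, t) x) / s) {..<n}"
    by (rule indep_vars_block_functions[OF ind, of _ "\<lambda>t. B \<times> {t}" "\<lambda>t f. (\<Sum>k\<in>B. a k * f (k, t)) / s"])
      (auto simp: disjoint_family_on_def)
qed

section \<open>Likelihood ratios of sent and unsent codewords\<close>

text \<open>The integrand is the likelihood ratio of \<open>N(U, 1)\<close> and \<open>N(0, s\<^sup>2)\<close> at \<open>V\<close>.\<close>

lemma (in prob_space) nn_integral_normal_ratio:
  assumes ind: "indep_var borel V borel U" and s: "0 < s"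
    and D: "distributed M lborel V (normal_density 0 s)"
  shows "(\<integral>\<^sup>+x. ennreal (exp (1/2 * ln (s\<^sup>2) + (V x)\<^sup>2 / (2 * s\<^sup>2) - (V x - U x)\<^sup>2 / 2)) \<partial>M) = 1"
proof -
  have [measurable]: "random_variable borel V" "random_variable borel U"
    using ind by (auto simp: indep_var_distribution_eq)
  let ?h = "\<lambda>v u. ennreal (exp (1/2 * ln (s\<^sup>2) + v\<^sup>2 / (2 * s\<^sup>2) - (v - u)\<^sup>2 / 2))"
  interpret PV: prob_space "distr M borel V" by (rule prob_space_distr) simp
  interpret PU: prob_space "distr M borel U" by (rule prob_space_distr) simp
  interpret P: pair_sigma_finite "distr M borel V" "distr M borel U" ..
  have ratio: "normal_density 0 s v * exp (1/2 * ln (s\<^sup>2) + v\<^sup>2 / (2 * s\<^sup>2) - (v - u)\<^sup>2 / 2) = normal_density u 1 v" for u v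
  proof -
    have "exp (1/2 * ln (s\<^sup>2) + v\<^sup>2 / (2 * s\<^sup>2) - (v - u)\<^sup>2 / 2) = s * exp (v\<^sup>2 / (2 * s\<^sup>2)) * exp (- (v - u)\<^sup>2 / 2)"
    proof -
      have "1/2 * ln (s\<^sup>2) = ln s" using s by (simp add: ln_realpow)
      then have "1/2 * ln (s\<^sup>2) + v\<^sup>2 / (2 * s\<^sup>2) - (v - u)\<^sup>2 / 2 = ln s + v\<^sup>2 / (2 * s\<^sup>2) + - (v - u)\<^sup>2 / 2" by simp
      then show ?thesis using s by (simp only: exp_add exp_ln)
    qed
    then show ?thesis
      using s by (simp add: normal_density_def real_sqrt_mult exp_minus field_simps)
  qed
  have dV: "distr M borel V = density lborel (normal_density 0 s)"
    using D by (simp add: distributed_def cong: distr_cong)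
  \<comment> \<open>By independence \<open>u\<close> can be frozen. The density of \<open>V\<close>
    then cancels against the ratio and leaves the normal density centred at \<open>u\<close>, whose
    mass is 1 for every \<open>u\<close>.\<close>
  have inner: "(\<integral>\<^sup>+v. ?h v u \<partial>distr M borel V) = 1" for u
  proof -
    have "(\<integral>\<^sup>+v. ?h v u \<partial>distr M borel V) = (\<integral>\<^sup>+v. ennreal (normal_density 0 s v) * ?h v u \<partial>lborel)"
      unfolding dV by (subst nn_integral_density) auto
    also have "\<dots> = (\<integral>\<^sup>+v. ennreal (normal_density u 1 v) \<partial>lborel)"
      by (simp only: ennreal_mult'[symmetric] normal_density_nonneg ratio)
    also have "\<dots> = 1"
      by (subst nn_integral_eq_integral) auto
    finally show ?thesis .
  qed
  have "(\<integral>\<^sup>+x. ?h (V x) (U x) \<partial>M) = (\<integral>\<^sup>+p. ?h (fst p) (snd p) \<partial>distr M (borel \<Otimes>\<^sub>M borel) (\<lambda>x. (V x, U x)))"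
    by (subst nn_integral_distr) auto
  also have "distr M (borel \<Otimes>\<^sub>M borel) (\<lambda>x. (V x, U x)) = distr M borel V \<Otimes>\<^sub>M distr M borel U"
    using ind by (simp add: indep_var_distribution_eq)
  also have "(\<integral>\<^sup>+p. ?h (fst p) (snd p) \<partial>(distr M borel V \<Otimes>\<^sub>M distr M borel U)) =
      (\<integral>\<^sup>+u. \<integral>\<^sup>+v. ?h v u \<partial>distr M borel V \<partial>distr M borel U)"
    by (subst P.nn_integral_snd[symmetric]) auto
  also have "\<dots> = 1"
    by (simp only: inner) (simp add: PU.emeasure_space_1[simplified])
  finally show ?thesis .
qed

text \<open>\<open>V\<close> is what remains of the output after the correctly assumed codewords are
  removed, \<open>U\<close> the contribution of codewords that were not sent. Disjoint index sets
  make them independent, so the likelihood ratio has mean 1 in each time slot, and so has its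
  product over the independent slots. Markov's inequality then gives a bound that is exponential in
  the threshold, as a union over exponentially many wrong codewords requires.\<close>

lemma (in prob_space) wrong_codeword_bound:
  fixes G :: "'k \<times> nat \<Rightarrow> 'a \<Rightarrow> real" and a b :: "'k \<Rightarrow> real"
  assumes fin: "finite B" "finite B'" and disj: "B \<inter> B' = {}"
    and ind: "indep_vars (\<lambda>_. borel) G ((B \<union> B') \<times> {..<n})"
    and D: "\<And>k. k \<in> B \<times> {..<n} \<Longrightarrow> distributed M lborel (G k) std_normal_density"
    and pos: "0 < (\<Sum>k\<in>B. (a k)\<^sup>2)"
  defines "s2 \<equiv> (\<Sum>k\<in>B. (a k)\<^sup>2)"
    and "V \<equiv> \<lambda>t x. \<Sum>k\<in>B. a k * G (k, t) x" and "U \<equiv> \<lambda>t x. \<Sum>k\<in>B'. b k * G (k, t) x"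
  shows "prob {x \<in> space M. \<gamma> < (\<Sum>t<n. 1/2 * ln s2 + (V t x)\<^sup>2 / (2 * s2) - (V t x - U t x)\<^sup>2 / 2)} \<le> exp (- \<gamma>)"
proof -
  let ?L = "\<lambda>t x. 1/2 * ln s2 + (V t x)\<^sup>2 / (2 * s2) - (V t x - U t x)\<^sup>2 / 2"
  have s2: "0 < s2" using pos by (simp add: s2_def)
  have G[measurable]: "G (k,t) \<in> borel_measurable M" if "k \<in> B \<union> B'" "t < n" for k t
    using ind that by (auto simp: indep_vars_def)
  have [measurable]: "V t \<in> borel_measurable M" "U t \<in> borel_measurable M" if "t < n" for t
    unfolding V_def U_def using that by (auto intro!: borel_measurable_sum borel_measurable_times G)
  have one: "(\<integral>\<^sup>+x. ennreal (exp (?L t x)) \<partial>M) = 1" if t: "t < n" for t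
  proof -
    have "indep_var borel (V t) borel (U t)"
      using indep_var_compose[OF indep_var_restrict[OF ind, of "B \<times> {t}" "B' \<times> {t}"],
        of "\<lambda>f. \<Sum>k\<in>B. a k * f (k, t)" borel "\<lambda>f. \<Sum>k\<in>B'. b k * f (k, t)" borel] t disj
      by (auto simp: comp_def V_def U_def)
    moreover have "distributed M lborel (V t) (normal_density 0 (sqrt s2))"
      unfolding V_def s2_def
      by (rule std_normal_block_sums(1)[OF fin(1) indep_vars_subset[OF ind] D pos t]) auto
    ultimately show ?thesis
      using nn_integral_normal_ratio[of "V t" "U t" "sqrt s2"] s2 by simp
  qed
  have indL: "indep_vars (\<lambda>_. borel) (\<lambda>t x. ennreal (exp (?L t x))) {..<n}"
  proof (rule indep_vars_compose2[where Y="\<lambda>t x. ennreal (exp x)" and M'="\<lambda>_. borel"])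
    show "indep_vars (\<lambda>_. borel) ?L {..<n}"
      by (rule indep_vars_block_functions[OF ind, of _ "\<lambda>t. (B \<union> B') \<times> {t}" "\<lambda>t f. 1/2 * ln s2 + (\<Sum>k\<in>B. a k * f (k, t))\<^sup>2 / (2 * s2) -
          ((\<Sum>k\<in>B. a k * f (k, t)) - (\<Sum>k\<in>B'. b k * f (k, t)))\<^sup>2 / 2"])
        (auto simp: disjoint_family_on_def V_def U_def)
  qed simp
  have E: "(\<integral>\<^sup>+x. ennreal (exp (\<Sum>t<n. ?L t x)) \<partial>M) = 1"
  proof -
    have "(\<integral>\<^sup>+x. ennreal (exp (\<Sum>t<n. ?L t x)) \<partial>M) = (\<integral>\<^sup>+x. (\<Prod>t<n. ennreal (exp (?L t x))) \<partial>M)"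
      by (simp add: exp_sum prod_ennreal)
    also have "\<dots> = (\<Prod>t<n. \<integral>\<^sup>+x. ennreal (exp (?L t x)) \<partial>M)"
      by (rule indep_vars_nn_integral[OF _ indL]) auto
    finally show ?thesis using one by simp
  qed
  have m: "(\<lambda>x. \<Sum>t<n. ?L t x) \<in> borel_measurable M"
    by (intro borel_measurable_sum) (auto intro!: borel_measurable_diff borel_measurable_add borel_measurable_divide borel_measurable_power)
  note [measurable] = m
  have "emeasure M {x \<in> space M. \<gamma> < (\<Sum>t<n. ?L t x)}
      \<le> emeasure M ({x \<in> space M. 1 \<le> ennreal (exp (-\<gamma>)) * ennreal (exp (\<Sum>t<n. ?L t x))})"
    by (rule emeasure_mono) (auto simp: ennreal_mult'[symmetric] exp_add[symmetric])
  also have "\<dots> \<le> ennreal (exp (-\<gamma>)) * (\<integral>\<^sup>+x. ennreal (exp (\<Sum>t<n. ?L t x)) * indicator (space M) x \<partial>M)"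
    by (rule nn_integral_Markov_inequality) auto
  also have "\<dots> = ennreal (exp (-\<gamma>))"
    using E by (simp cong: nn_integral_cong)
  finally show ?thesis
    by (simp add: emeasure_eq_measure)
qed

text \<open>For the codewords that were sent, the last square is the noise \<open>G (k0, t)\<close>
  itself. The sum is therefore n/2 ln s2 plus half the difference of two chi-square sums, and a
  shortfall of n d forces one of these to deviate by n d. The noise is a summand of
  \<open>V\<close>, so the two sums are dependent and a union bound is taken; each contributes 2 /
  (n d^2).\<close>

lemma (in prob_space) right_codeword_bound:
  fixes G :: "'k \<times> nat \<Rightarrow> 'a \<Rightarrow> real" and a :: "'k \<Rightarrow> real" and d :: real
  assumes fin: "finite B" and k0: "k0 \<in> B" "a k0 = 1" and n: "0 < n" and d: "0 < d"
    and ind: "indep_vars (\<lambda>_. borel) G (B \<times> {..<n})"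
    and D: "\<And>k. k \<in> B \<times> {..<n} \<Longrightarrow> distributed M lborel (G k) std_normal_density"
  defines "s2 \<equiv> (\<Sum>k\<in>B. (a k)\<^sup>2)" and "V \<equiv> \<lambda>t x. \<Sum>k\<in>B. a k * G (k, t) x"
  shows "prob {x \<in> space M. (\<Sum>t<n. 1/2 * ln s2 + (V t x)\<^sup>2 / (2 * s2) - (G (k0, t) x)\<^sup>2 / 2)
      \<le> n * (1/2 * ln s2 - d)} \<le> 4 / (n * d\<^sup>2)"
proof -
  have pos: "0 < s2"
    unfolding s2_def using fin k0 by (intro sum_pos2[of _ k0]) auto
  note bs = std_normal_block_sums[OF fin ind D pos[unfolded s2_def], folded s2_def]
  let ?A = "\<lambda>X :: nat \<Rightarrow> 'a \<Rightarrow> real. {x \<in> space M. d * card {..<n} \<le> \<bar>(\<Sum>t<n. (X t x)\<^sup>2) - card {..<n}\<bar>}"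
  let ?W = "\<lambda>t x. (\<Sum>k\<in>B. a k * G (k, t) x) / sqrt s2"
  have G[measurable]: "G (k,t) \<in> borel_measurable M" if "k \<in> B" "t < n" for k t
    using ind that by (auto simp: indep_vars_def)
  have ind0: "indep_vars (\<lambda>_. borel) (\<lambda>t. G (k0, t)) {..<n}"
    by (rule indep_vars_block_functions[OF ind, of _ "\<lambda>t. {(k0,t)}" "\<lambda>t f. f (k0,t)"])
        (use k0 in \<open>auto simp: disjoint_family_on_def\<close>)
  have 1: "prob (?A ?W) \<le> 2 / (d\<^sup>2 * card {..<n})"
    by (rule chi_square_concentration) (use n d bs in auto)
  have 2: "prob (?A (\<lambda>t. G (k0, t))) \<le> 2 / (d\<^sup>2 * card {..<n})"
    by (rule chi_square_concentration) (use n d D k0 ind0 in auto)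
  have W: "(\<lambda>x. \<Sum>t<n. (?W t x)\<^sup>2) \<in> borel_measurable M" "(\<lambda>x. \<Sum>t<n. (G (k0, t) x)\<^sup>2) \<in> borel_measurable M"
    by (intro borel_measurable_sum borel_measurable_power borel_measurable_divide borel_measurable_times
        borel_measurable_const G k0; simp)+
  have A: "?A ?W \<in> events" "?A (\<lambda>t. G (k0, t)) \<in> events"
    by (intro borel_measurable_le borel_measurable_abs borel_measurable_diff borel_measurable_const W)+
  have "prob {x \<in> space M. (\<Sum>t<n. 1/2 * ln s2 + (V t x)\<^sup>2 / (2 * s2) - (G (k0, t) x)\<^sup>2 / 2)
      \<le> n * (1/2 * ln s2 - d)} \<le> prob (?A ?W \<union> ?A (\<lambda>t. G (k0, t)))"
  proof (rule finite_measure_mono)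
    have "x \<in> ?A ?W \<union> ?A (\<lambda>t. G (k0, t))" if "x \<in> space M" and
      le: "(\<Sum>t<n. 1/2 * ln s2 + (V t x)\<^sup>2 / (2 * s2) - (G (k0, t) x)\<^sup>2 / 2) \<le> n * (1/2 * ln s2 - d)" for x
    proof -
      have "(?W t x)\<^sup>2 = (V t x)\<^sup>2 / s2" for t
        using pos by (simp add: V_def power_divide)
      then have "(\<Sum>t<n. 1/2 * ln s2 + (V t x)\<^sup>2 / (2 * s2) - (G (k0, t) x)\<^sup>2 / 2) =
         n * (1/2 * ln s2) + (\<Sum>t<n. (?W t x)\<^sup>2) / 2 - (\<Sum>t<n. (G (k0, t) x)\<^sup>2) / 2"
        by (simp add: sum.distrib sum_subtractf sum_divide_distrib) (simp add: mult.commute)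
      with le have "2 * (d * n) \<le> (\<Sum>t<n. (G (k0, t) x)\<^sup>2) - (\<Sum>t<n. (?W t x)\<^sup>2)"
        by (simp add: algebra_simps)
      then have "d * n \<le> \<bar>(\<Sum>t<n. (G (k0, t) x)\<^sup>2) - n\<bar> \<or> d * n \<le> \<bar>(\<Sum>t<n. (?W t x)\<^sup>2) - n\<bar>"
        by linarith
      with that(1) show ?thesis by auto
    qed
    then show "{x \<in> space M. (\<Sum>t<n. 1/2 * ln s2 + (V t x)\<^sup>2 / (2 * s2) - (G (k0, t) x)\<^sup>2 / 2)
      \<le> n * (1/2 * ln s2 - d)} \<subseteq> ?A ?W \<union> ?A (\<lambda>t. G (k0, t))" by blast
  qed (intro sets.Un A)
  also have "\<dots> \<le> prob (?A ?W) + prob (?A (\<lambda>t. G (k0, t)))"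
    by (rule measure_Un_le) (fact A)+
  also have "\<dots> \<le> 2 / (d\<^sup>2 * card {..<n}) + 2 / (d\<^sup>2 * card {..<n})" by (rule add_mono[OF 1 2])
  also have "\<dots> = 4 / (n * d\<^sup>2)" by (simp add: mult.commute)
  finally show ?thesis .
qed

section \<open>The block measure\<close>

definition std_normal_measure :: "real measure" where
  "std_normal_measure = density lborel (\<lambda>x. ennreal (std_normal_density x))"

definition noise_word_measure :: "nat \<Rightarrow> (nat \<Rightarrow> real) measure" where
  "noise_word_measure n = Pi\<^sub>M {..<n} (\<lambda>_. std_normal_measure)"

definition message_tuples :: "nat \<Rightarrow> real ^ 4 \<Rightarrow> (4 \<Rightarrow> nat) set" where
  "message_tuples n R = (\<Pi>\<^sub>E i\<in>UNIV. messages n (R $ i))"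

lemma noise_measure_eq: "noise_measure n = Pi\<^sub>M UNIV (\<lambda>_. noise_word_measure n)"
  by (simp add: noise_measure_def noise_word_measure_def std_normal_measure_def)

lemma prob_space_std_normal_measure: "prob_space std_normal_measure"
  unfolding std_normal_measure_def by (rule prob_space_normal_density) simp

lemma space_std_normal_measure [simp]: "space std_normal_measure = UNIV"
  and sets_std_normal_measure [simp, measurable_cong]: "sets std_normal_measure = sets borel"
  by (simp_all add: std_normal_measure_def)

lemma prob_space_noise_word_measure: "prob_space (noise_word_measure n)"
  unfolding noise_word_measure_def by (intro prob_space_PiM prob_space_std_normal_measure)

lemma sets_noise_word_measure [simp, measurable_cong]:
  "sets (noise_word_measure n) = sets (Pi\<^sub>M {..<n} (\<lambda>_. borel))"
  unfolding noise_word_measure_def by (intro sets_PiM_cong) auto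

lemma prob_space_noise_measure: "prob_space (noise_measure n)"
  unfolding noise_measure_eq by (intro prob_space_PiM prob_space_noise_word_measure)

lemma sets_noise_measure [simp, measurable_cong]:
  "sets (noise_measure n) = sets (Pi\<^sub>M UNIV (\<lambda>_. Pi\<^sub>M {..<n} (\<lambda>_. borel)))"
  unfolding noise_measure_eq by (intro sets_PiM_cong) auto

lemma distr_noise_component: "distr (noise_measure n) (noise_word_measure n) (\<lambda>z. z j) = noise_word_measure n"
  unfolding noise_measure_eq
  by (rule distr_PiM_component) (auto simp: prob_space_noise_word_measure)

lemma measurable_noise_entry:
  "t < n \<Longrightarrow> (\<lambda>z. z j t) \<in> borel_measurable (noise_measure n)"
  using measurable_compose[OF measurable_component_singleton[of j UNIV "\<lambda>_. Pi\<^sub>M {..<n} (\<lambda>_. borel)"]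
    measurable_component_singleton[of t "{..<n}" "\<lambda>_. borel"]] 
  by (simp cong: measurable_cong_sets)

lemma measurable_received [measurable]:
  "(\<lambda>z. received h1 h2 n x z j) \<in> measurable (noise_measure n) (Pi\<^sub>M {..<n} (\<lambda>_. borel))"
  unfolding received_def by (intro measurable_restrict borel_measurable_add measurable_noise_entry) simp_all

section \<open>Message sets and their sizes\<close>

lemma finite_messages [simp]: "finite (messages n r)"
  by (simp add: messages_def)

lemma messages_nonempty [simp]: "messages n r \<noteq> {}"
proof -
  have "0 < \<lceil>2 powr (real n * r)\<rceil>" by simp
  then have "1 \<le> nat \<lceil>2 powr (real n * r)\<rceil>" by linarith
  then show ?thesis by (simp add: messages_def)
qed

lemma card_messages_ge: "2 powr (real n * r) \<le> card (messages n r)"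
  by (simp add: messages_def)

lemma card_messages_pos [simp]: "0 < card (messages n r)"
  by (simp add: card_gt_0_iff)

text \<open>Rounding up adds at most 1, and for a nonnegative rate 1 is at most the power itself;
  hence the factor 2.\<close>

lemma card_messages_le:
  assumes "0 \<le> r" shows "card (messages n r) \<le> 2 * 2 powr (real n * r)"
proof -
  have "1 \<le> 2 powr (real n * r)" using assms by (simp add: ge_one_powr_ge_zero)
  then show ?thesis by (simp add: messages_def) linarith
qed

text \<open>A user of rate zero has nothing to confuse, which is why \<open>active_sets\<close> may
  ignore such users.\<close>

lemma messages_rate_0: "messages n 0 = {1}"
  by (simp add: messages_def)

lemma finite_message_tuples [simp]: "finite (message_tuples n R)"
  unfolding message_tuples_def by (intro finite_PiE) auto

lemma message_tuples_nonempty [simp]: "message_tuples n R \<noteq> {}"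
  by (simp add: message_tuples_def PiE_eq_empty_iff)

lemma card_message_tuples_pos [simp]: "0 < card (message_tuples n R)"
  by (simp add: card_gt_0_iff)

lemma card_message_tuples: "card (message_tuples n R) = (\<Prod>i\<in>UNIV. card (messages n (R $ i)))"
  unfolding message_tuples_def by (rule card_PiE) simp

lemma message_tuples_component: "m \<in> message_tuples n R \<Longrightarrow> m i \<in> messages n (R $ i)"
  by (auto simp: message_tuples_def)

section \<open>The error probability as an average over message tuples\<close>

lemma sets_PiM_measure_pmf: "sets (Pi\<^sub>M (UNIV :: 4 set) (\<lambda>i. measure_pmf (p i :: nat pmf))) = UNIV"
proof -
  have "sets (Pi\<^sub>M (UNIV :: 4 set) (\<lambda>i. measure_pmf (p i))) = sets (Pi\<^sub>M UNIV (\<lambda>_. count_space UNIV))"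
    by (intro sets_PiM_cong) auto
  also have "Pi\<^sub>M (UNIV :: 4 set) (\<lambda>_. count_space (UNIV :: nat set)) = count_space (PiE UNIV (\<lambda>_. UNIV))"
    by (rule count_space_PiM_finite) auto
  finally show ?thesis by (simp add: PiE_UNIV_domain)
qed

text \<open>Independent uniform messages are uniform on the product set. This turns the probability
  over the messages into a finite average, the form that both the converse and the random coding
  argument work with.\<close>

lemma PiM_message_pmf:
  "Pi\<^sub>M UNIV (\<lambda>i. measure_pmf (message_pmf n (R $ i))) = measure_pmf (pmf_of_set (message_tuples n R))"
proof (rule measure_eqI_countable)
  interpret product_prob_space "\<lambda>i. measure_pmf (message_pmf n (R $ i))" UNIV
    by (intro product_prob_spaceI prob_space_measure_pmf)
  fix m :: "4 \<Rightarrow> nat"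
  have "emeasure (Pi\<^sub>M UNIV (\<lambda>i. measure_pmf (message_pmf n (R $ i)))) {m}
      = (\<Prod>i\<in>UNIV. emeasure (measure_pmf (message_pmf n (R $ i))) {m i})"
    using emeasure_PiM[of UNIV "\<lambda>i. {m i}"] by (simp add: PiE_singleton)
  also have "\<dots> = ennreal (\<Prod>i\<in>UNIV. pmf (message_pmf n (R $ i)) (m i))"
    by (simp add: emeasure_pmf_single prod_ennreal)
  also have "(\<Prod>i\<in>UNIV. pmf (message_pmf n (R $ i)) (m i)) = pmf (pmf_of_set (message_tuples n R)) m"
  proof -
    have "(\<Prod>i\<in>UNIV. of_bool (m i \<in> messages n (R $ i))) = (of_bool (m \<in> message_tuples n R) :: real)"
      by (auto simp: message_tuples_def PiE_iff)
    then show ?thesis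
      by (simp add: message_pmf_def prod_dividef card_message_tuples indicator_def)
  qed
  finally show "emeasure (Pi\<^sub>M UNIV (\<lambda>i. measure_pmf (message_pmf n (R $ i)))) {m} =
      emeasure (measure_pmf (pmf_of_set (message_tuples n R))) {m}"
    by (simp add: emeasure_pmf_single)
qed (auto simp: sets_PiM_measure_pmf)

lemma measure_block_measure:
  assumes meas: "\<And>m. {z \<in> space (noise_measure n). P m z} \<in> sets (noise_measure n)"
  shows "measure (block_measure n R) {(m, z) \<in> space (block_measure n R). P m z} =
    (\<Sum>m\<in>message_tuples n R. measure (noise_measure n) {z \<in> space (noise_measure n). P m z})
      / card (message_tuples n R)"
proof -
  let ?A = "measure_pmf (pmf_of_set (message_tuples n R))" and ?N = "noise_measure n"
  let ?S = "{(m, z) \<in> space (block_measure n R). P m z}"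
  interpret N: prob_space ?N by (rule prob_space_noise_measure)
  have b: "block_measure n R = ?A \<Otimes>\<^sub>M ?N"
    by (simp add: block_measure_def PiM_message_pmf)
  \<comment> \<open>There are only countably many message tuples, so measurability of every slice
    makes the event a countable union of measurable rectangles.\<close>
  have S: "?S = (\<Union>m. {m} \<times> {z \<in> space ?N. P m z})"
    by (auto simp: b space_pair_measure)
  have "?S \<in> sets (?A \<Otimes>\<^sub>M ?N)"
    unfolding S using meas by (intro sets.countable_UN') (auto intro!: pair_measureI)
  then have "emeasure (?A \<Otimes>\<^sub>M ?N) ?S = (\<integral>\<^sup>+m. emeasure ?N (Pair m -` ?S) \<partial>?A)"
    by (rule N.emeasure_pair_measure_alt)
  also have "\<dots> = (\<integral>\<^sup>+m. ennreal (N.prob {z \<in> space ?N. P m z}) \<partial>?A)"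
    by (intro nn_integral_cong) (auto simp: b space_pair_measure vimage_def N.emeasure_eq_measure)
  also have "\<dots> = (\<Sum>m\<in>message_tuples n R. ennreal (N.prob {z \<in> space ?N. P m z})) / card (message_tuples n R)"
    by (rule nn_integral_pmf_of_set) auto
  also have "\<dots> = ennreal ((\<Sum>m\<in>message_tuples n R. N.prob {z \<in> space ?N. P m z}) / card (message_tuples n R))"
    by (simp add: sum_ennreal sum_nonneg ennreal_of_nat_eq_real_of_nat divide_ennreal)
  finally show ?thesis
    unfolding b by (intro measure_eq_emeasure_eq_ennreal) (auto intro!: sum_nonneg divide_nonneg_nonneg)
qed

lemma error_event_measurable:
  assumes g: "\<And>i. g i \<in> measurable (Pi\<^sub>M {..<n} (\<lambda>_. borel)) (count_space (messages n (R $ i)))"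
  shows "{z \<in> space (noise_measure n). \<exists>i. g i (received h1 h2 n (\<lambda>k. f k (m k)) z (receiver_of i)) \<noteq> m i}
    \<in> sets (noise_measure n)"
proof -
  have "{z \<in> space (noise_measure n). g i (received h1 h2 n (\<lambda>k. f k (m k)) z (receiver_of i)) \<noteq> m i} \<in> sets (noise_measure n)" for i
  proof -
    have "(\<lambda>z. g i (received h1 h2 n (\<lambda>k. f k (m k)) z (receiver_of i)))
        \<in> measurable (noise_measure n) (count_space (messages n (R $ i)))"
      by (rule measurable_compose[OF measurable_received g])
    from measurable_sets[OF this, of "messages n (R $ i) - {m i}"] measurable_space[OF this]
    show ?thesis
      by (auto simp: vimage_def elim!: rev_iffD1[OF _ arg_cong[where f="\<lambda>S. S \<in> _"]])
  qed
  then show ?thesis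
    by (intro sets.sets_Collect_countable_Ex)
qed

lemma error_prob_eq:
  assumes g: "\<And>i. g i \<in> measurable (Pi\<^sub>M {..<n} (\<lambda>_. borel)) (count_space (messages n (R $ i)))"
  shows "error_prob h1 h2 n R f g =
    (\<Sum>m\<in>message_tuples n R. measure (noise_measure n) {z \<in> space (noise_measure n).
       \<exists>i. g i (received h1 h2 n (\<lambda>k. f k (m k)) z (receiver_of i)) \<noteq> m i}) / card (message_tuples n R)"
  unfolding error_prob_def by (rule measure_block_measure) (rule error_event_measurable[OF g])

lemma prob_space_block_measure: "prob_space (block_measure n R)"
  unfolding block_measure_def
  by (intro prob_space_pair prob_space_PiM prob_space_noise_measure prob_space_measure_pmf)

section \<open>Converse\<close>

text \<open>One letter of the change of measure: the standard normal density cancels against the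
  denominator of the weight, and translation invariance of Lebesgue measure removes the shift
  \<open>c\<close>.\<close>

lemma density_std_normal_shift:
  fixes c \<mu> s :: real
  assumes s: "0 < s" and A: "A \<in> sets borel"
  shows "(\<integral>\<^sup>+z. indicator A (c + z) * ennreal (normal_density \<mu> s (c + z) / std_normal_density z) \<partial>std_normal_measure)
    = emeasure (density lborel (normal_density \<mu> s)) A"
proof -
  have e: "ennreal (std_normal_density z) * (indicator A (c + z) * ennreal (normal_density \<mu> s (c + z) / std_normal_density z))
    = ennreal (normal_density \<mu> s (c + z)) * indicator A (c + z)" for z
  proof -
    have "std_normal_density z > 0" by (rule normal_density_pos) simp
    then have "ennreal (std_normal_density z) * ennreal (normal_density \<mu> s (c + z) / std_normal_density z)
        = ennreal (normal_density \<mu> s (c + z))"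
      by (subst ennreal_mult'[symmetric]) auto
    then show ?thesis
      by (simp add: indicator_def)
  qed
  have "(\<integral>\<^sup>+z. indicator A (c + z) * ennreal (normal_density \<mu> s (c + z) / std_normal_density z) \<partial>std_normal_measure)
    = (\<integral>\<^sup>+z. ennreal (normal_density \<mu> s (c + z)) * indicator A (c + z) \<partial>lborel)"
    unfolding std_normal_measure_def using A by (subst nn_integral_density) (auto simp: e)
  also have "\<dots> = (\<integral>\<^sup>+z. ennreal (normal_density \<mu> s z) * indicator A z \<partial>lborel)"
    using nn_integral_real_affine[of "\<lambda>z. ennreal (normal_density \<mu> s z) * indicator A z" 1 c] A by simp
  also have "\<dots> = emeasure (density lborel (normal_density \<mu> s)) A"
    using A by (subst emeasure_density) auto
  finally show ?thesis .
qed

text \<open>Importance sampling: a shifted standard Gaussian word, weighted by the likelihood ratio.\<close>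

lemma noise_word_change_of_measure:
  fixes c \<mu> :: "nat \<Rightarrow> real" and s :: real
  assumes s: "0 < s" and H[measurable]: "H \<in> borel_measurable (Pi\<^sub>M {..<n} (\<lambda>_. borel))"
  shows "(\<integral>\<^sup>+z. H (\<lambda>t\<in>{..<n}. c t + z t) *
      ennreal (\<Prod>t<n. normal_density (\<mu> t) s (c t + z t) / std_normal_density (z t)) \<partial>noise_word_measure n)
    = (\<integral>\<^sup>+y. H y \<partial>Pi\<^sub>M {..<n} (\<lambda>t. density lborel (normal_density (\<mu> t) s)))"
proof -
  let ?N = "noise_word_measure n"
  let ?r = "\<lambda>z. ennreal (\<Prod>t<n. normal_density (\<mu> t) s (c t + z t) / std_normal_density (z t))"
  let ?sh = "\<lambda>z. \<lambda>t\<in>{..<n}. c t + z t"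
  let ?B = "Pi\<^sub>M {..<n} (\<lambda>_. borel :: real measure)"
  let ?Q = "Pi\<^sub>M {..<n} (\<lambda>t. density lborel (normal_density (\<mu> t) s))"
  interpret P: product_sigma_finite "\<lambda>_. std_normal_measure"
    using prob_space_std_normal_measure
    by (simp add: product_sigma_finite_def prob_space_imp_sigma_finite)
  interpret Q: product_sigma_finite "\<lambda>t. density lborel (normal_density (\<mu> t) s)"
    using prob_space_normal_density[OF s]
    by (simp add: product_sigma_finite_def prob_space_imp_sigma_finite)
  have comp[measurable]: "(\<lambda>z. z t) \<in> borel_measurable ?N" if "t < n" for t
    using that measurable_component_singleton[of t "{..<n}" "\<lambda>_. borel"] by (simp cong: measurable_cong_sets)
  have sh[measurable]: "?sh \<in> measurable ?N ?B"
    by (intro measurable_restrict) simp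
  have r[measurable]: "?r \<in> borel_measurable ?N"
    by measurable
  \<comment> \<open>A finite product measure is determined by its values on boxes, and on a box both
    the indicator and the weight factor over time, which leaves the one-letter identity.\<close>
  have eq: "distr (density ?N ?r) ?B ?sh = ?Q"
  proof (rule Q.PiM_eqI)
    show "sets (distr (density ?N ?r) ?B ?sh) = sets ?Q"
      by (simp cong: sets_PiM_cong)
    fix A :: "nat \<Rightarrow> real set"
    assume "\<And>i. i \<in> {..<n} \<Longrightarrow> A i \<in> sets (density lborel (normal_density (\<mu> i) s))"
    then have A: "A i \<in> sets borel" if "i < n" for i using that by simp
    have box: "Pi\<^sub>E {..<n} A \<in> sets ?B" using A by (intro sets_PiM_I_finite) auto
    have "emeasure (distr (density ?N ?r) ?B ?sh) (Pi\<^sub>E {..<n} A)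
        = (\<integral>\<^sup>+z. ?r z * indicator (?sh -` Pi\<^sub>E {..<n} A \<inter> space ?N) z \<partial>?N)"
    proof -
      have "?sh -` Pi\<^sub>E {..<n} A \<inter> space ?N \<in> sets ?N" by (rule measurable_sets[OF sh box])
      then show ?thesis using box by (subst emeasure_distr) (auto simp: emeasure_density)
    qed
    also have "\<dots> = (\<integral>\<^sup>+z. (\<Prod>t<n. indicator (A t) (c t + z t) *
        ennreal (normal_density (\<mu> t) s (c t + z t) / std_normal_density (z t))) \<partial>?N)"
    proof (intro nn_integral_cong)
      fix z assume z: "z \<in> space ?N"
      have i: "indicator (?sh -` Pi\<^sub>E {..<n} A \<inter> space ?N) z = (\<Prod>t<n. indicator (A t) (c t + z t) :: ennreal)"
      proof (cases "\<forall>t<n. c t + z t \<in> A t")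
        case True
        then have "?sh z \<in> Pi\<^sub>E {..<n} A" by auto
        with True z show ?thesis by simp
      next
        case False
        then obtain t where t: "t < n" "c t + z t \<notin> A t" by auto
        then have "?sh z \<notin> Pi\<^sub>E {..<n} A" by auto
        moreover have "(\<Prod>t<n. indicator (A t) (c t + z t) :: ennreal) = 0"
          using t by (intro prod_zero bexI[of _ t]) auto
        ultimately show ?thesis by simp
      qed
      show "?r z * indicator (?sh -` Pi\<^sub>E {..<n} A \<inter> space ?N) z = (\<Prod>t<n. indicator (A t) (c t + z t) *
        ennreal (normal_density (\<mu> t) s (c t + z t) / std_normal_density (z t)))"
        unfolding i prod.distrib by (subst prod_ennreal) (auto simp: mult.commute)
    qed
    also have "\<dots> = (\<Prod>t<n. \<integral>\<^sup>+x. indicator (A t) (c t + x) *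
        ennreal (normal_density (\<mu> t) s (c t + x) / std_normal_density x) \<partial>std_normal_measure)"
      unfolding noise_word_measure_def
    proof (rule P.product_nn_integral_prod)
      fix t assume "t \<in> {..<n}"
      then have [measurable]: "A t \<in> sets borel" using A by simp
      note [measurable del] = comp
      show "(\<lambda>x. indicator (A t) (c t + x) * ennreal (normal_density (\<mu> t) s (c t + x) / std_normal_density x))
          \<in> borel_measurable std_normal_measure"
        by measurable
    qed simp
    also have "\<dots> = (\<Prod>t<n. emeasure (density lborel (normal_density (\<mu> t) s)) (A t))"
      by (intro prod.cong refl density_std_normal_shift s A) auto
    finally show "emeasure (distr (density ?N ?r) ?B ?sh) (Pi\<^sub>E {..<n} A)
      = (\<Prod>t\<in>{..<n}. emeasure (density lborel (normal_density (\<mu> t) s)) (A t))" .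
  qed simp
  have "(\<integral>\<^sup>+y. H y \<partial>?Q) = (\<integral>\<^sup>+z. H (?sh z) \<partial>density ?N ?r)"
    unfolding eq[symmetric] by (subst nn_integral_distr) auto
  also have "\<dots> = (\<integral>\<^sup>+z. ?r z * H (?sh z) \<partial>?N)"
    by (subst nn_integral_density) auto
  finally show ?thesis by (simp add: mult.commute)
qed

section \<open>A divergence bound for a single codebook\<close>

lemma noise_word_moments:
  assumes t: "t < n"
  shows "integrable (noise_word_measure n) (\<lambda>z. z t)" "integral\<^sup>L (noise_word_measure n) (\<lambda>z. z t) = 0"
    "integrable (noise_word_measure n) (\<lambda>z. (z t)\<^sup>2)" "integral\<^sup>L (noise_word_measure n) (\<lambda>z. (z t)\<^sup>2) = 1"
proof -
  interpret prob_space "noise_word_measure n" by (rule prob_space_noise_word_measure)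
  have [measurable]: "(\<lambda>z. z t) \<in> borel_measurable (noise_word_measure n)"
    using t measurable_component_singleton[of t "{..<n}" "\<lambda>_. borel"] by (simp cong: measurable_cong_sets)
  have "distr (noise_word_measure n) std_normal_measure (\<lambda>z. z t) = std_normal_measure"
    unfolding noise_word_measure_def using t by (intro distr_PiM_component prob_space_std_normal_measure) auto
  then have "distr (noise_word_measure n) lborel (\<lambda>z. z t) = density lborel std_normal_density"
    by (simp add: std_normal_measure_def cong: distr_cong)
  then have D: "distributed (noise_word_measure n) lborel (\<lambda>z. z t) std_normal_density"
    by (simp add: distributed_def)
  show "integrable (noise_word_measure n) (\<lambda>z. z t)" "integral\<^sup>L (noise_word_measure n) (\<lambda>z. z t) = 0"
    "integrable (noise_word_measure n) (\<lambda>z. (z t)\<^sup>2)" "integral\<^sup>L (noise_word_measure n) (\<lambda>z. (z t)\<^sup>2) = 1"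
    using std_normal_moments(1)[OF D, of 1] std_normal_moments(1)[OF D, of 2] std_normal_moments(2)[OF D] standard_normal_distributed_expectation[OF D]
    by simp_all
qed

text \<open>Donsker--Varadhan variational bound for the test function \<open>L\<close> times the indicator of \<open>D\<close>, with the
  reference measure \<open>Q = N(\<mu>, s2)\<^sup>n\<close>.\<close>

lemma test_function_bound:
  fixes c \<mu> :: "nat \<Rightarrow> real" and s2 L :: real
  assumes s2: "0 < s2" and L: "0 \<le> L" and D: "D \<in> sets (Pi\<^sub>M {..<n} (\<lambda>_. borel))"
  defines "Q \<equiv> Pi\<^sub>M {..<n} (\<lambda>t. density lborel (normal_density (\<mu> t) (sqrt s2)))"
  shows "L * measure (noise_word_measure n) {z \<in> space (noise_word_measure n). (\<lambda>t\<in>{..<n}. c t + z t) \<in> D}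
    \<le> (\<Sum>t<n. 1/2 * ln s2 + (1 + (c t - \<mu> t)\<^sup>2) / (2 * s2) - 1/2) + ln 2 + (1 + (exp L - 1) * measure Q D) / 2 - 1"
proof -
  let ?N = "noise_word_measure n"
  let ?sh = "\<lambda>z. \<lambda>t\<in>{..<n}. c t + z t"
  interpret N: prob_space ?N by (rule prob_space_noise_word_measure)
  interpret Q: prob_space Q unfolding Q_def
    using s2 by (intro prob_space_PiM prob_space_normal_density) simp
  have comp[measurable]: "(\<lambda>z. z t) \<in> borel_measurable ?N" if "t < n" for t
    using that measurable_component_singleton[of t "{..<n}" "\<lambda>_. borel"] by (simp cong: measurable_cong_sets)
  have sh[measurable]: "?sh \<in> measurable ?N (Pi\<^sub>M {..<n} (\<lambda>_. borel))"
    by (intro measurable_restrict) simp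
  have setsQ: "sets Q = sets (Pi\<^sub>M {..<n} (\<lambda>_. borel))"
    unfolding Q_def by (intro sets_PiM_cong) auto
  \<comment> \<open>\<open>l\<close> is the log-density of the true output law, standard normal
    noise around \<open>c\<close>, relative to \<open>Q\<close>, evaluated at the output c + z. Its
    mean is the divergence from \<open>Q\<close>.\<close>
  define l where "l z = (\<Sum>t<n. 1/2 * ln s2 + (c t + z t - \<mu> t)\<^sup>2 / (2 * s2) - (z t)\<^sup>2 / 2)" for z
  let ?E = "{z \<in> space ?N. ?sh z \<in> D}"
  have E[measurable]: "?E \<in> sets ?N"
    using measurable_sets[OF sh D] by (simp add: vimage_def Int_def conj_commute)
  have lm[measurable]: "l \<in> borel_measurable ?N"
    unfolding l_def by measurable
  have summand: "1/2 * ln s2 + (c t + z t - \<mu> t)\<^sup>2 / (2 * s2) - (z t)\<^sup>2 / 2 =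
     (1/2 * ln s2 + (c t - \<mu> t)\<^sup>2 / (2 * s2)) + (c t - \<mu> t) / s2 * z t + (1 / (2 * s2) - 1/2) * (z t)\<^sup>2" for t z
    using s2 by (simp add: power2_eq_square field_simps)
  have li: "integrable ?N l"
    unfolding l_def summand by (intro Bochner_Integration.integrable_sum) (auto intro!: Bochner_Integration.integrable_add noise_word_moments)
  have "integral\<^sup>L ?N l = (\<Sum>t<n. (1/2 * ln s2 + (c t - \<mu> t)\<^sup>2 / (2 * s2)) + (1 / (2 * s2) - 1/2))"
    unfolding l_def summand
    by (subst Bochner_Integration.integral_sum) (auto intro!: sum.cong Bochner_Integration.integrable_add noise_word_moments
        simp: noise_word_moments N.prob_space)
  then have El: "integral\<^sup>L ?N l = (\<Sum>t<n. 1/2 * ln s2 + (1 + (c t - \<mu> t)\<^sup>2) / (2 * s2) - 1/2)"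
    by (simp add: add_divide_distrib algebra_simps)
  have ratio: "exp (- l z) = (\<Prod>t<n. normal_density (\<mu> t) (sqrt s2) (c t + z t) / std_normal_density (z t))" for z
  proof -
    have "exp (- (1/2 * ln s2 + x\<^sup>2 / (2 * s2) - y\<^sup>2 / 2)) = (exp (- x\<^sup>2 / (2 * s2)) / sqrt s2) / exp (- y\<^sup>2 / 2)" for x y :: real
    proof -
      have "- (1/2 * ln s2 + x\<^sup>2 / (2 * s2) - y\<^sup>2 / 2) = - x\<^sup>2 / (2 * s2) - ln (sqrt s2) - (- y\<^sup>2 / 2)"
        using s2 by (simp add: ln_sqrt)
      then show ?thesis using s2 by (simp only: exp_diff exp_ln real_sqrt_gt_zero)
    qed
    then show ?thesis
      unfolding l_def sum_negf[symmetric] exp_sum[OF finite_lessThan] using s2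
      by (intro prod.cong) (simp_all add: normal_density_def real_sqrt_mult)
  qed
  \<comment> \<open>The factor exp (- l) converts the mean under the true output law into a mean
    under \<open>Q\<close>, where exp (L 1_D) equals 1 + (exp L - 1) 1_D.\<close>
  have nnI: "(\<integral>\<^sup>+z. ennreal (exp (L * indicator ?E z - l z)) \<partial>?N) = ennreal (1 + (exp L - 1) * measure Q D)"
  proof -
    let ?H = "\<lambda>y. ennreal (1 + (exp L - 1) * indicator D y)"
    have "(\<integral>\<^sup>+z. ennreal (exp (L * indicator ?E z - l z)) \<partial>?N) = (\<integral>\<^sup>+z. ?H (?sh z) *
      ennreal (\<Prod>t<n. normal_density (\<mu> t) (sqrt s2) (c t + z t) / std_normal_density (z t)) \<partial>?N)"
      unfolding ratio[symmetric]
      using L by (intro nn_integral_cong) (auto simp: indicator_def exp_diff exp_minus field_simps ennreal_mult'[symmetric])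
    also have "\<dots> = (\<integral>\<^sup>+y. ?H y \<partial>Q)"
      unfolding Q_def using s2 D by (intro noise_word_change_of_measure) auto
    also have "\<dots> = ennreal (\<integral>y. 1 + (exp L - 1) * indicator D y \<partial>Q)"
      using L D setsQ by (intro nn_integral_eq_integral) (auto simp: Q.emeasure_eq_measure)
    also have "(\<integral>y. 1 + (exp L - 1) * indicator D y \<partial>Q) = 1 + (exp L - 1) * measure Q D"
      using D setsQ by (simp add: Q.prob_space Q.emeasure_eq_measure)
    finally show ?thesis .
  qed
  have nn: "0 \<le> 1 + (exp L - 1) * measure Q D" using L by simp
  have em: "(\<lambda>z. exp (L * indicator ?E z - l z)) \<in> borel_measurable ?N" by measurable
  have ei: "integrable ?N (\<lambda>z. exp (L * indicator ?E z - l z))"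
    using nnI by (intro integrableI_nonneg em) auto
  have eI: "integral\<^sup>L ?N (\<lambda>z. exp (L * indicator ?E z - l z)) = 1 + (exp L - 1) * measure Q D"
    using nnI nn by (subst integral_eq_nn_integral) (use em in auto)
  have Ei: "integrable ?N (\<lambda>z. L * indicator ?E z)"
    by (intro integrable_mult_right integrable_real_indicator E) (simp add: N.emeasure_eq_measure)
  have "integral\<^sup>L ?N (\<lambda>z. L * indicator ?E z) \<le> integral\<^sup>L ?N (\<lambda>z. (l z + ln 2) + (exp (L * indicator ?E z - l z) / 2 - 1))"
  proof (rule integral_mono)
    fix z
    \<comment> \<open>The tangent of the logarithm at 2, that is u \<le> ln 2 + exp u / 2 - 1,
      replaces Jensen's inequality. It keeps the bound linear in the \<open>Q\<close>-mass of
      \<open>D\<close>, so that it can be summed over messages. The point 2 is chosen because 1 + (M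
      - 1) Q(D), averaged over M disjoint sets, stays below 2.\<close>
    have "L * indicator ?E z - l z - ln 2 \<le> exp (L * indicator ?E z - l z - ln 2) - 1"
      using exp_ge_add_one_self[of "L * indicator ?E z - l z - ln 2"] by linarith
    then show "L * indicator ?E z \<le> (l z + ln 2) + (exp (L * indicator ?E z - l z) / 2 - 1)"
      by (simp add: exp_diff[of _ "ln 2"])
  qed (use li ei Ei in auto)
  also have "\<dots> = integral\<^sup>L ?N l + ln 2 + ((1 + (exp L - 1) * measure Q D) / 2 - 1)"
    using li ei by (simp add: eI N.prob_space)
  also have "integral\<^sup>L ?N (\<lambda>z. L * indicator ?E z) = L * measure ?N ?E"
  proof -
    have "?E \<inter> space ?N = ?E" by blast
    then show ?thesis by simp
  qed
  finally show ?thesis unfolding El by linarith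
qed


text \<open>The reference law \<open>Q\<close> is the same for all messages, so disjointness bounds
  the sum of the masses of the decoding sets by 1. With L = ln M the terms linear in these masses,
  together with the constants -1, add up to at most 0. The variance s2 = 1 + P makes the quadratic
  part of the divergence cancel on average, leaving n/2 ln (1 + P). The power is constrained only on
  average over the codebook and about the common centre \<mu>.\<close>

lemma code_size_bound:
  fixes c :: "'b \<Rightarrow> nat \<Rightarrow> real" and \<mu> :: "nat \<Rightarrow> real" and P :: real
  assumes B: "finite B" "B \<noteq> {}" and P: "0 \<le> P"
    and D: "\<And>b. b \<in> B \<Longrightarrow> D b \<in> sets (Pi\<^sub>M {..<n} (\<lambda>_. borel))" and disj: "disjoint_family_on D B"
    and power: "(\<Sum>b\<in>B. \<Sum>t<n. (c b t - \<mu> t)\<^sup>2) \<le> card B * (n * P)"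
  shows "ln (card B) * (\<Sum>b\<in>B. measure (noise_word_measure n)
        {z \<in> space (noise_word_measure n). (\<lambda>t\<in>{..<n}. c b t + z t) \<in> D b})
    \<le> card B * (n / 2 * ln (1 + P) + ln 2)"
proof -
  let ?M = "real (card B)"
  define s2 where "s2 = 1 + P"
  have s2: "0 < s2" using P by (simp add: s2_def)
  have c1: "1 \<le> ?M" using B by (simp add: Suc_le_eq card_gt_0_iff)
  define Q where "Q = Pi\<^sub>M {..<n} (\<lambda>t. density lborel (normal_density (\<mu> t) (sqrt s2)))"
  interpret Q: prob_space Q unfolding Q_def
    using s2 by (intro prob_space_PiM prob_space_normal_density) simp
  have setsQ: "sets Q = sets (Pi\<^sub>M {..<n} (\<lambda>_. borel))"
    unfolding Q_def by (intro sets_PiM_cong) auto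
  have Qsum: "(\<Sum>b\<in>B. measure Q (D b)) \<le> 1"
  proof -
    have "(\<Sum>b\<in>B. measure Q (D b)) = measure Q (\<Union>b\<in>B. D b)"
      by (rule Q.finite_measure_finite_Union[symmetric]) (use B D disj setsQ in auto)
    then show ?thesis by simp
  qed
  let ?K = "\<lambda>b. (\<Sum>t<n. 1/2 * ln s2 + (1 + (c b t - \<mu> t)\<^sup>2) / (2 * s2) - 1/2)"
  have "ln ?M * (\<Sum>b\<in>B. measure (noise_word_measure n)
        {z \<in> space (noise_word_measure n). (\<lambda>t\<in>{..<n}. c b t + z t) \<in> D b})
    \<le> (\<Sum>b\<in>B. ?K b + ln 2 + (1 + (?M - 1) * measure Q (D b)) / 2 - 1)"
    unfolding sum_distrib_left
  proof (rule sum_mono)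
    fix b assume "b \<in> B"
    then show "ln ?M * measure (noise_word_measure n)
        {z \<in> space (noise_word_measure n). (\<lambda>t\<in>{..<n}. c b t + z t) \<in> D b}
        \<le> ?K b + ln 2 + (1 + (?M - 1) * measure Q (D b)) / 2 - 1"
      using test_function_bound[OF s2 _ D[of b], of "ln ?M" "c b" \<mu>] c1 by (simp add: Q_def)
  qed
  also have "\<dots> = (\<Sum>b\<in>B. ?K b) + ?M * ln 2 + (?M + (?M - 1) * (\<Sum>b\<in>B. measure Q (D b))) / 2 - ?M"
    by (simp add: sum.distrib sum_subtractf sum_divide_distrib[symmetric] sum_distrib_left[symmetric])
  also have "(?M + (?M - 1) * (\<Sum>b\<in>B. measure Q (D b))) / 2 \<le> (?M + (?M - 1) * 1) / 2"
    using Qsum c1 by (intro divide_right_mono add_left_mono mult_left_mono) auto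
  also have "(\<Sum>b\<in>B. ?K b) \<le> ?M * (n / 2 * ln (1 + P))"
  proof -
    have "(\<Sum>b\<in>B. ?K b) = ?M * n * (1/2 * ln s2 + 1 / (2 * s2) - 1/2) + (\<Sum>b\<in>B. \<Sum>t<n. (c b t - \<mu> t)\<^sup>2) / (2 * s2)"
      by (simp add: add_divide_distrib sum.distrib sum_subtractf sum_divide_distrib[symmetric]) (simp add: algebra_simps)
    also have "\<dots> \<le> ?M * n * (1/2 * ln s2 + 1 / (2 * s2) - 1/2) + (?M * (n * P)) / (2 * s2)"
      using power s2 by (intro add_left_mono divide_right_mono) auto
    also have "\<dots> = ?M * n * (1/2 * ln s2) + ?M * n * ((1 + P) / (2 * s2) - 1/2)"
      by (simp add: add_divide_distrib algebra_simps)
    also have "(1 + P) / (2 * s2) - 1/2 = 0"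
      using s2 by (simp add: s2_def field_simps)
    finally show ?thesis by (simp add: s2_def)
  qed
  finally show ?thesis
    using c1 by (simp add: distrib_left diff_divide_distrib)
qed

section \<open>Averages over the uniform law on message tuples\<close>

lemma sum_PiE_component:
  fixes F :: "'c \<Rightarrow> real"
  assumes T: "finite T" "i \<in> T" and A: "\<And>k. k \<in> T \<Longrightarrow> finite (A k)"
  shows "(\<Sum>b\<in>Pi\<^sub>E T A. F (b i)) * card (A i) = (\<Sum>x\<in>A i. F x) * card (Pi\<^sub>E T A)"
proof -
  \<comment> \<open>A function of one coordinate is a product over all coordinates with trivial
    factors elsewhere, so the sum over tuples becomes a product of sums.\<close>
  have "(\<Sum>b\<in>Pi\<^sub>E T A. F (b i)) = (\<Sum>b\<in>Pi\<^sub>E T A. \<Prod>k\<in>T. if k = i then F (b k) else 1)"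
    using T by (intro sum.cong) (auto simp: prod.delta)
  also have "\<dots> = (\<Prod>k\<in>T. \<Sum>x\<in>A k. if k = i then F x else 1)"
    by (rule prod_sum_PiE[symmetric]) (use T A in auto)
  also have "\<dots> = (\<Sum>x\<in>A i. F x) * (\<Prod>k\<in>T - {i}. real (card (A k)))"
    using T by (subst prod.remove[of T i]) auto
  finally show ?thesis
    using T by (simp add: card_PiE prod.remove[of T i])
qed

text \<open>Independent centred coordinates are uncorrelated: a mixed term factors over the
  coordinates and contains the vanishing sum of a single \<open>F i\<close>.\<close>

lemma sum_PiE_centred_square:
  fixes F :: "'i \<Rightarrow> 'c \<Rightarrow> real"
  assumes T: "finite T" and A: "\<And>k. k \<in> T \<Longrightarrow> finite (A k)"
    and centred: "\<And>k. k \<in> T \<Longrightarrow> (\<Sum>x\<in>A k. F k x) = 0"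
  shows "(\<Sum>b\<in>Pi\<^sub>E T A. (\<Sum>i\<in>T. F i (b i))\<^sup>2) = (\<Sum>i\<in>T. \<Sum>b\<in>Pi\<^sub>E T A. (F i (b i))\<^sup>2)"
proof -
  have z: "(\<Sum>b\<in>Pi\<^sub>E T A. F i (b i) * F j (b j)) = 0" if ij: "i \<in> T" "j \<in> T" "i \<noteq> j" for i j
  proof -
    have "(\<Sum>b\<in>Pi\<^sub>E T A. F i (b i) * F j (b j)) = (\<Sum>b\<in>Pi\<^sub>E T A. \<Prod>k\<in>T. if k = i \<or> k = j then F k (b k) else 1)"
    proof (rule sum.cong[OF refl])
      fix b
      have "(\<Prod>k\<in>T. if k = i \<or> k = j then F k (b k) else 1) = (\<Prod>k\<in>{i, j}. F k (b k))"
        using T ij by (intro prod.mono_neutral_cong_right) auto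
      then show "F i (b i) * F j (b j) = (\<Prod>k\<in>T. if k = i \<or> k = j then F k (b k) else 1)"
        using ij by simp
    qed
    also have "\<dots> = (\<Prod>k\<in>T. \<Sum>x\<in>A k. if k = i \<or> k = j then F k x else 1)"
      by (rule prod_sum_PiE[symmetric]) (use T A in auto)
    also have "\<dots> = 0"
      using T ij centred by (intro prod_zero bexI[of _ i]) auto
    finally show ?thesis .
  qed
  have "(\<Sum>b\<in>Pi\<^sub>E T A. (\<Sum>i\<in>T. F i (b i))\<^sup>2) = (\<Sum>b\<in>Pi\<^sub>E T A. \<Sum>i\<in>T. \<Sum>j\<in>T. F i (b i) * F j (b j))"
    by (simp add: power2_eq_square sum_product)
  also have "\<dots> = (\<Sum>i\<in>T. \<Sum>j\<in>T. \<Sum>b\<in>Pi\<^sub>E T A. F i (b i) * F j (b j))"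
    by (subst sum.swap, intro sum.cong refl, subst sum.swap) simp
  also have "\<dots> = (\<Sum>i\<in>T. \<Sum>j\<in>T. if j = i then \<Sum>b\<in>Pi\<^sub>E T A. F i (b i) * F j (b j) else 0)"
    using z by (intro sum.cong) auto
  also have "\<dots> = (\<Sum>i\<in>T. \<Sum>b\<in>Pi\<^sub>E T A. (F i (b i))\<^sup>2)"
    using T by (simp add: power2_eq_square)
  finally show ?thesis .
qed

text \<open>Freezes the messages outside \<open>T\<close>. For each frozen choice \<open>a\<close>
  the users in \<open>T\<close> act as one transmitter, to which \<open>code_size_bound\<close>
  applies.\<close>

lemma sum_PiE_split:
  fixes h :: "('i :: finite \<Rightarrow> 'c) \<Rightarrow> real"
  shows "(\<Sum>m\<in>Pi\<^sub>E UNIV A. h m) = (\<Sum>a\<in>Pi\<^sub>E (- T) A. \<Sum>b\<in>Pi\<^sub>E T A. h (\<lambda>i. if i \<in> T then b i else a i))"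
  unfolding sum.cartesian_product
  by (rule sum.reindex_bij_witness[where j="\<lambda>m. (restrict m (- T), restrict m T)"
        and i="\<lambda>(a, b) i. if i \<in> T then b i else a i"])
    (auto simp: PiE_iff extensional_def fun_eq_iff split: if_splits intro!: arg_cong[where f=h])


lemma sum_centred_square_le:
  fixes F :: "'c \<Rightarrow> real"
  assumes "finite A" "A \<noteq> {}"
  shows "(\<Sum>x\<in>A. (F x - (\<Sum>x\<in>A. F x) / card A)\<^sup>2) \<le> (\<Sum>x\<in>A. (F x)\<^sup>2)"
proof -
  define e where "e = (\<Sum>x\<in>A. F x) / card A"
  have c: "(\<Sum>x\<in>A. F x) = e * card A" using assms by (simp add: e_def)
  have "(\<Sum>x\<in>A. (F x - e)\<^sup>2) = (\<Sum>x\<in>A. (F x)\<^sup>2) - 2 * e * (\<Sum>x\<in>A. F x) + card A * e\<^sup>2"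
    by (simp add: power2_diff sum.distrib sum_subtractf sum_distrib_left[symmetric] sum_distrib_right[symmetric] mult_ac)
  also have "\<dots> = (\<Sum>x\<in>A. (F x)\<^sup>2) - card A * e\<^sup>2"
    by (simp add: c power2_eq_square)
  finally show ?thesis by (simp add: e_def)
qed

lemma tx_power_nonneg: "0 \<le> P1 \<Longrightarrow> 0 \<le> P2 \<Longrightarrow> 0 \<le> tx_power P1 P2 i"
  by (simp add: tx_power_def)

lemma is_code_power:
  assumes "is_code P1 P2 n R f g" "1 \<le> n"
  shows "(\<Sum>t<n. (\<Sum>x\<in>messages n (R $ i). (f i x t)\<^sup>2) / card (messages n (R $ i))) \<le> n * tx_power P1 P2 i"
proof -
  have "(1 / real n) * (\<Sum>t<n. measure_pmf.expectation (message_pmf n (R $ i)) (\<lambda>m. (f i m t)\<^sup>2)) \<le> tx_power P1 P2 i"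
    using assms(1) by (simp add: is_code_def)
  then show ?thesis
    using assms(2) by (simp add: message_pmf_def integral_pmf_of_set field_simps)
qed

text \<open>Centring at the codebook means \<open>e\<close> kills the cross terms between users and
  can only lower the energy of each single user. The total is then at most the sum of the individual
  power budgets.\<close>

lemma centred_codeword_power:
  assumes code: "is_code P1 P2 n R f g" and n: "1 \<le> n"
  defines "A \<equiv> \<lambda>i. messages n (R $ i)"
  defines "e \<equiv> \<lambda>i t. (\<Sum>x\<in>A i. f i x t) / card (A i)"
  shows "(\<Sum>b\<in>Pi\<^sub>E T A. \<Sum>t<n. (\<Sum>i\<in>T. f i (b i) t - e i t)\<^sup>2)
    \<le> card (Pi\<^sub>E T A) * (n * (\<Sum>i\<in>T. tx_power P1 P2 i))"
proof -
  let ?B = "Pi\<^sub>E T A"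
  have A: "finite (A i)" "A i \<noteq> {}" "0 < card (A i)" for i by (simp_all add: A_def)
  have "(\<Sum>b\<in>?B. \<Sum>t<n. (\<Sum>i\<in>T. f i (b i) t - e i t)\<^sup>2) = (\<Sum>t<n. \<Sum>b\<in>?B. (\<Sum>i\<in>T. f i (b i) t - e i t)\<^sup>2)"
    by (rule sum.swap)
  also have "\<dots> = (\<Sum>t<n. \<Sum>i\<in>T. \<Sum>b\<in>?B. (f i (b i) t - e i t)\<^sup>2)"
    by (intro sum.cong refl sum_PiE_centred_square) (use A in \<open>auto simp: sum_subtractf e_def\<close>)
  also have "\<dots> \<le> (\<Sum>t<n. \<Sum>i\<in>T. card ?B * ((\<Sum>x\<in>A i. (f i x t)\<^sup>2) / card (A i)))"
  proof (intro sum_mono)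
    fix t i assume i: "i \<in> T"
    have "(\<Sum>b\<in>?B. (f i (b i) t - e i t)\<^sup>2) * card (A i) = (\<Sum>x\<in>A i. (f i x t - e i t)\<^sup>2) * card ?B"
      by (rule sum_PiE_component) (use i A in auto)
    also have "\<dots> \<le> (\<Sum>x\<in>A i. (f i x t)\<^sup>2) * card ?B"
      unfolding e_def by (intro mult_right_mono sum_centred_square_le A) auto
    finally show "(\<Sum>b\<in>?B. (f i (b i) t - e i t)\<^sup>2) \<le> card ?B * ((\<Sum>x\<in>A i. (f i x t)\<^sup>2) / card (A i))"
      using A(3)[of i] by (simp add: field_simps)
  qed
  also have "\<dots> = card ?B * (\<Sum>i\<in>T. \<Sum>t<n. (\<Sum>x\<in>A i. (f i x t)\<^sup>2) / card (A i))"
    by (subst sum.swap) (simp add: sum_distrib_left)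
  also have "\<dots> \<le> card ?B * (\<Sum>i\<in>T. n * tx_power P1 P2 i)"
    unfolding A_def by (intro mult_left_mono sum_mono is_code_power[OF code n]) auto
  finally show ?thesis by (simp add: sum_distrib_left)
qed

section \<open>The rate bound at a fixed block length\<close>

lemma measure_noise_component:
  assumes D: "D \<in> sets (Pi\<^sub>M {..<n} (\<lambda>_. borel))"
  shows "measure (noise_measure n) {z \<in> space (noise_measure n). (\<lambda>t\<in>{..<n}. c t + z j t) \<in> D}
    = measure (noise_word_measure n) {z \<in> space (noise_word_measure n). (\<lambda>t\<in>{..<n}. c t + z t) \<in> D}"
proof -
  let ?N = "noise_measure n" and ?W = "noise_word_measure n"
  have c: "(\<lambda>z. z j) \<in> measurable ?N ?W"
    using measurable_component_singleton[of j UNIV "\<lambda>_. Pi\<^sub>M {..<n} (\<lambda>_. borel)"] by (simp cong: measurable_cong_sets)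
  have comp: "(\<lambda>z. z t) \<in> borel_measurable ?W" if "t < n" for t
    using that measurable_component_singleton[of t "{..<n}" "\<lambda>_. borel"] by (simp cong: measurable_cong_sets)
  have "(\<lambda>z. \<lambda>t\<in>{..<n}. c t + z t) \<in> measurable ?W (Pi\<^sub>M {..<n} (\<lambda>_. borel))"
    by (intro measurable_restrict borel_measurable_add comp) auto
  from measurable_sets[OF this D]
  have E: "{z \<in> space ?W. (\<lambda>t\<in>{..<n}. c t + z t) \<in> D} \<in> sets ?W"
    by (simp add: vimage_def Int_def conj_commute)
  have "measure ?W {z \<in> space ?W. (\<lambda>t\<in>{..<n}. c t + z t) \<in> D}
    = measure (distr ?N ?W (\<lambda>z. z j)) {z \<in> space ?W. (\<lambda>t\<in>{..<n}. c t + z t) \<in> D}"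
    by (simp add: distr_noise_component)
  also have "\<dots> = measure ?N {z \<in> space ?N. (\<lambda>t\<in>{..<n}. c t + z j t) \<in> D}"
    using measurable_space[OF c] by (subst measure_distr[OF c E]) (auto intro!: arg_cong[where f="measure ?N"])
  finally show ?thesis ..
qed

lemma converse_block:
  assumes P: "0 \<le> P1" "0 \<le> P2" and n: "1 \<le> n" and code: "is_code P1 P2 n R f g"
    and T: "\<And>i. i \<in> T \<Longrightarrow> receiver_of i = j" and R: "\<And>i. 0 \<le> R $ i"
  shows "(1 - error_prob h1 h2 n R f g) * ((\<Sum>i\<in>T. R $ i) * ln 2)
    \<le> 1 / 2 * ln (1 + (\<Sum>i\<in>T. tx_power P1 P2 i)) + ln 2 / n"
proof -
  let ?N = "noise_measure n" and ?W = "noise_word_measure n" and ?M = "message_tuples n R"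
  let ?P = "\<Sum>i\<in>T. tx_power P1 P2 i"
  define A where "A = (\<lambda>i. messages n (R $ i))"
  define B where "B = Pi\<^sub>E T A"
  define mg where "mg a b = (\<lambda>i. if i \<in> T then b i else a i)" for a b :: "4 \<Rightarrow> nat"
  interpret N: prob_space ?N by (rule prob_space_noise_measure)
  have g: "g i \<in> measurable (Pi\<^sub>M {..<n} (\<lambda>_. borel)) (count_space (A i))" for i
    using code by (simp add: is_code_def A_def)
  have B: "finite B" "B \<noteq> {}" unfolding B_def by (auto simp: A_def PiE_eq_empty_iff intro!: finite_PiE)
  have P0: "0 \<le> ?P" using P by (intro sum_nonneg tx_power_nonneg)
  define x where "x m t = (\<Sum>i\<in>UNIV. gain h1 h2 i j * f i (m i) t)" for m t
  \<comment> \<open>Receiver \<open>j\<close> serves every user of \<open>T\<close>, so the decoders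
    of these users act on the same output word and can be read as a single decoder with these
    decision sets.\<close>
  define D where "D b = {y \<in> space (Pi\<^sub>M {..<n} (\<lambda>_. borel :: real measure)). \<forall>i\<in>T. g i y = b i}" for b
  define err where "err m = N.prob {z \<in> space ?N.
       \<exists>i. g i (received h1 h2 n (\<lambda>k. f k (m k)) z (receiver_of i)) \<noteq> m i}" for m
  define ok where "ok b m = measure ?W {z \<in> space ?W. (\<lambda>t\<in>{..<n}. x m t + z t) \<in> D b}" for b m
  have gi: "{y \<in> space (Pi\<^sub>M {..<n} (\<lambda>_. borel)). g i y = k} \<in> sets (Pi\<^sub>M {..<n} (\<lambda>_. borel))" for i k
  proof (cases "k \<in> A i")
    case True
    have "g i -` {k} \<inter> space (Pi\<^sub>M {..<n} (\<lambda>_. borel)) \<in> sets (Pi\<^sub>M {..<n} (\<lambda>_. borel))"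
      using True by (intro measurable_sets[OF g]) simp
    then show ?thesis by (simp add: vimage_def Int_def conj_commute)
  next
    case False
    then have "{y \<in> space (Pi\<^sub>M {..<n} (\<lambda>_. borel)). g i y = k} = {}"
      using measurable_space[OF g[of i]] by auto
    then show ?thesis by (simp only: sets.empty_sets)
  qed
  have D: "D b \<in> sets (Pi\<^sub>M {..<n} (\<lambda>_. borel))" for b
    unfolding D_def by (intro sets.sets_Collect_finite_All gi) auto
  have disj: "disjoint_family_on D B"
    unfolding disjoint_family_on_def
  proof (intro ballI impI)
    fix b b' assume bb: "b \<in> B" "b' \<in> B" "b \<noteq> b'"
    then obtain i where "i \<in> T" "b i \<noteq> b' i"
      unfolding B_def by (meson PiE_ext)
    then show "D b \<inter> D b' = {}" by (auto simp: D_def)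
  qed
  have err_le: "1 - err (mg a b) \<le> ok b (mg a b)" for a b
  proof -
    let ?m = "mg a b"
    have meas: "{z \<in> space ?N. (\<lambda>t\<in>{..<n}. x ?m t + z j t) \<in> D b} \<in> N.events"
    proof -
      have "(\<lambda>z. received h1 h2 n (\<lambda>k. f k (?m k)) z j) \<in> measurable ?N (Pi\<^sub>M {..<n} (\<lambda>_. borel))" by simp
      from measurable_sets[OF this D[of b]] show ?thesis
        by (simp add: received_def x_def vimage_def Int_def conj_commute)
    qed
    have e: "{z \<in> space ?N. \<not> (\<lambda>t\<in>{..<n}. x ?m t + z j t) \<in> D b} \<subseteq> {z \<in> space ?N.
       \<exists>i. g i (received h1 h2 n (\<lambda>k. f k (?m k)) z (receiver_of i)) \<noteq> ?m i}"
    proof (rule subsetI, rule ccontr)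
      fix z assume "z \<in> {z \<in> space ?N. \<not> (\<lambda>t\<in>{..<n}. x ?m t + z j t) \<in> D b}"
        and "z \<notin> {z \<in> space ?N. \<exists>i. g i (received h1 h2 n (\<lambda>k. f k (?m k)) z (receiver_of i)) \<noteq> ?m i}"
      then have no: "(\<lambda>t\<in>{..<n}. x ?m t + z j t) \<notin> D b"
        and all: "\<nexists>i. g i (received h1 h2 n (\<lambda>k. f k (?m k)) z (receiver_of i)) \<noteq> ?m i"
        by blast+
      have "(\<lambda>t\<in>{..<n}. x ?m t + z j t) = received h1 h2 n (\<lambda>k. f k (?m k)) z j"
        by (simp add: received_def x_def)
      then have "g i (\<lambda>t\<in>{..<n}. x ?m t + z j t) = b i" if "i \<in> T" for i
        using all T[OF that] that by (metis mg_def)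
      then have "(\<lambda>t\<in>{..<n}. x ?m t + z j t) \<in> D b"
        by (simp add: D_def space_PiM)
      with no show False by simp
    qed
    have "1 - N.prob {z \<in> space ?N. (\<lambda>t\<in>{..<n}. x ?m t + z j t) \<in> D b} =
      N.prob {z \<in> space ?N. \<not> (\<lambda>t\<in>{..<n}. x ?m t + z j t) \<in> D b}"
      using N.prob_neg[OF meas] by simp
    also have "\<dots> \<le> err ?m"
      unfolding err_def
    proof (rule N.finite_measure_mono[OF e])
      show "{z \<in> space ?N. \<exists>i. g i (received h1 h2 n (\<lambda>k. f k (?m k)) z (receiver_of i)) \<noteq> ?m i} \<in> N.events"
        by (rule error_event_measurable) (use g in \<open>simp add: A_def\<close>)
    qed
    finally show ?thesis
      unfolding ok_def measure_noise_component[OF D, symmetric, of _ _ j] by simp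
  qed
  have fixed: "ln (card B) * (\<Sum>b\<in>B. 1 - err (mg a b)) \<le> card B * (n / 2 * ln (1 + ?P) + ln 2)" for a
  proof -
    define e where "e = (\<lambda>i t. (\<Sum>x\<in>A i. f i x t) / card (A i))"
    define \<mu> where "\<mu> t = (\<Sum>i\<in>T. e i t) + (\<Sum>i\<in>-T. gain h1 h2 i j * f i (a i) t)" for t
    have "x (mg a b) t - \<mu> t = (\<Sum>i\<in>T. f i (b i) t - e i t)" for b t
    proof -
      have "x (mg a b) t = (\<Sum>i\<in>T. gain h1 h2 i j * f i (mg a b i) t) + (\<Sum>i\<in>-T. gain h1 h2 i j * f i (mg a b i) t)"
        unfolding x_def by (subst sum.union_disjoint[symmetric]) auto
      also have "(\<Sum>i\<in>T. gain h1 h2 i j * f i (mg a b i) t) = (\<Sum>i\<in>T. f i (b i) t)"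
        using T by (intro sum.cong) (auto simp: gain_def mg_def)
      also have "(\<Sum>i\<in>-T. gain h1 h2 i j * f i (mg a b i) t) = (\<Sum>i\<in>-T. gain h1 h2 i j * f i (a i) t)"
        by (intro sum.cong) (auto simp: mg_def)
      finally show ?thesis by (simp add: \<mu>_def sum_subtractf)
    qed
    then have power: "(\<Sum>b\<in>B. \<Sum>t<n. (x (mg a b) t - \<mu> t)\<^sup>2) \<le> card B * (n * ?P)"
      using centred_codeword_power[OF code n, of T] by (simp add: B_def A_def e_def)
    have "ln (card B) * (\<Sum>b\<in>B. 1 - err (mg a b)) \<le> ln (card B) * (\<Sum>b\<in>B. ok b (mg a b))"
      using B by (intro mult_left_mono sum_mono err_le) (auto simp: Suc_le_eq card_gt_0_iff)
    also have "\<dots> \<le> card B * (n / 2 * ln (1 + ?P) + ln 2)"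
      unfolding ok_def by (rule code_size_bound[OF B P0 D disj power])
    finally show ?thesis .
  qed
  let ?A' = "Pi\<^sub>E (- T) A"
  have cM: "real (card ?M) = real (card ?A') * card B"
    using sum_PiE_split[of "\<lambda>_. 1" A T] by (simp add: message_tuples_def A_def B_def)
  have "error_prob h1 h2 n R f g = (\<Sum>m\<in>?M. err m) / card ?M"
    unfolding err_def by (rule error_prob_eq) (use g in \<open>simp add: A_def\<close>)
  then have "(1 - error_prob h1 h2 n R f g) * card ?M = (\<Sum>m\<in>?M. 1 - err m)"
    by (simp add: sum_subtractf left_diff_distrib)
  also have "\<dots> = (\<Sum>a\<in>?A'. \<Sum>b\<in>B. 1 - err (mg a b))"
    unfolding message_tuples_def A_def B_def mg_def by (rule sum_PiE_split)
  finally have "ln (card B) * ((1 - error_prob h1 h2 n R f g) * card ?M) = (\<Sum>a\<in>?A'. ln (card B) * (\<Sum>b\<in>B. 1 - err (mg a b)))"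
    by (simp add: sum_distrib_left)
  also have "\<dots> \<le> (\<Sum>a\<in>?A'. card B * (n / 2 * ln (1 + ?P) + ln 2))"
    by (intro sum_mono fixed)
  also have "\<dots> = (n / 2 * ln (1 + ?P) + ln 2) * card ?M"
    by (simp add: cM)
  finally have main: "ln (card B) * (1 - error_prob h1 h2 n R f g) \<le> n / 2 * ln (1 + ?P) + ln 2"
    by (simp add: mult.assoc[symmetric])
  have "n * ((\<Sum>i\<in>T. R $ i) * ln 2) = ln (\<Prod>i\<in>T. 2 powr (n * R $ i))"
    by (subst ln_prod) (auto simp: ln_powr sum_distrib_left sum_distrib_right mult_ac)
  also have "\<dots> \<le> ln (\<Prod>i\<in>T. real (card (A i)))"
    by (intro ln_mono prod_mono prod_pos) (auto simp: A_def card_messages_ge)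
  also have "(\<Prod>i\<in>T. real (card (A i))) = card B"
    by (simp add: B_def card_PiE)
  finally have lnB: "n * ((\<Sum>i\<in>T. R $ i) * ln 2) \<le> ln (card B)" .
  \<comment> \<open>Nonnegativity of 1 - error is what allows ln (card B) to be replaced by the
    smaller n times the sum rate.\<close>
  have "error_prob h1 h2 n R f g \<le> 1"
    unfolding error_prob_def by (intro prob_space.prob_le_1) (rule prob_space_block_measure)
  then have "n * ((\<Sum>i\<in>T. R $ i) * ln 2) * (1 - error_prob h1 h2 n R f g) \<le> n / 2 * ln (1 + ?P) + ln 2"
    using mult_right_mono[OF lnB, of "1 - error_prob h1 h2 n R f g"] main by simp
  then show ?thesis
    using n by (simp add: field_simps)
qed

lemma achievable_imp_region:
  assumes P: "0 \<le> P1" "0 \<le> P2" and ach: "achievable P1 P2 h1 h2 R"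
    and T: "\<And>i. i \<in> T \<Longrightarrow> receiver_of i = j"
  shows "(\<Sum>i\<in>T. R $ i) \<le> 1 / 2 * log 2 (1 + (\<Sum>i\<in>T. tx_power P1 P2 i))"
proof -
  obtain f g where R: "\<And>i. 0 \<le> R $ i" and code: "\<And>n. n \<ge> 1 \<Longrightarrow> is_code P1 P2 n R (f n) (g n)"
    and lim: "(\<lambda>n. error_prob h1 h2 n R (f n) (g n)) \<longlonglongrightarrow> 0"
    using ach unfolding achievable_def by blast
  have "(\<lambda>n. (1 - error_prob h1 h2 n R (f n) (g n)) * ((\<Sum>i\<in>T. R $ i) * ln 2)) \<longlonglongrightarrow> (1 - 0) * ((\<Sum>i\<in>T. R $ i) * ln 2)"
    by (intro tendsto_intros lim)
  moreover have "(\<lambda>n. 1 / 2 * ln (1 + (\<Sum>i\<in>T. tx_power P1 P2 i)) + ln 2 / real n)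
      \<longlonglongrightarrow> 1 / 2 * ln (1 + (\<Sum>i\<in>T. tx_power P1 P2 i)) + 0"
    by (intro tendsto_intros lim_const_over_n)
  ultimately have "(1 - 0) * ((\<Sum>i\<in>T. R $ i) * ln 2) \<le> 1 / 2 * ln (1 + (\<Sum>i\<in>T. tx_power P1 P2 i)) + 0"
    by (rule LIMSEQ_le) (use converse_block[OF P _ code T R] in blast)
  then show ?thesis by (simp add: log_def field_simps)
qed

section \<open>Gaussian random codebooks\<close>

text \<open>A source is either the codeword of a user and message or the noise of a receiver; a
  coordinate is a source at a time. One index type for code letters and noise means that a single
  independent family carries the whole random coding argument.\<close>

type_synonym coordinate = "((4 \<times> nat) + 2) \<times> nat"

definition code_coordinates :: "nat \<Rightarrow> real ^ 4 \<Rightarrow> ((4 \<times> nat) \<times> nat) set" where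
  "code_coordinates n R = (SIGMA i:UNIV. messages n (R $ i)) \<times> {..<n}"

definition codebook_measure :: "nat \<Rightarrow> real ^ 4 \<Rightarrow> ((4 \<times> nat) \<times> nat \<Rightarrow> real) measure" where
  "codebook_measure n R = Pi\<^sub>M (code_coordinates n R) (\<lambda>_. std_normal_measure)"

definition joint_measure where
  "joint_measure n R = codebook_measure n R \<Otimes>\<^sub>M noise_measure n"

fun coordinate_var :: "coordinate \<Rightarrow> ((4 \<times> nat) \<times> nat \<Rightarrow> real) \<times> (2 \<Rightarrow> nat \<Rightarrow> real) \<Rightarrow> real" where
  "coordinate_var (Inl k, t) (w, z) = w (k, t)"
| "coordinate_var (Inr j, t) (w, z) = z j t"

definition sources :: "nat \<Rightarrow> real ^ 4 \<Rightarrow> ((4 \<times> nat) + 2) set" where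
  "sources n R = (SIGMA i:UNIV. messages n (R $ i)) <+> UNIV"

section \<open>The joint law of code letters and noise\<close>

lemma finite_code_coordinates [simp]: "finite (code_coordinates n R)"
  by (simp add: code_coordinates_def)

lemma prob_space_codebook_measure: "prob_space (codebook_measure n R)"
  unfolding codebook_measure_def by (intro prob_space_PiM prob_space_std_normal_measure)

lemma sets_codebook_measure [simp, measurable_cong]:
  "sets (codebook_measure n R) = sets (Pi\<^sub>M (code_coordinates n R) (\<lambda>_. borel))"
  unfolding codebook_measure_def by (intro sets_PiM_cong) auto

lemma prob_space_joint_measure: "prob_space (joint_measure n R)"
  unfolding joint_measure_def
  by (intro prob_space_pair prob_space_codebook_measure prob_space_noise_measure)

lemma measurable_coordinate_var:
  assumes "k \<in> sources n R \<times> {..<n}"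
  shows "coordinate_var k \<in> borel_measurable (joint_measure n R)"
proof -
  have c: "(\<lambda>w. w q) \<in> borel_measurable (codebook_measure n R)" if "q \<in> code_coordinates n R" for q
    using that measurable_component_singleton[of q "code_coordinates n R" "\<lambda>_. borel"] by (simp cong: measurable_cong_sets)
  show ?thesis
  proof (cases k)
    case (Pair k' t)
    show ?thesis
    proof (cases k')
      case (Inl q)
      then have "coordinate_var k = (\<lambda>w. w (q, t)) \<circ> fst" using Pair by (auto simp: fun_eq_iff)
      moreover have "(q, t) \<in> code_coordinates n R" using assms Inl Pair by (auto simp: sources_def code_coordinates_def)
      ultimately show ?thesis
        unfolding joint_measure_def by (simp only:) (rule measurable_comp[OF measurable_fst c])
    next
      case (Inr j)
      then have "coordinate_var k = (\<lambda>z. z j t) \<circ> snd" using Pair by (auto simp: fun_eq_iff)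
      moreover have "t < n" using assms Pair by auto
      ultimately show ?thesis
        unfolding joint_measure_def by (simp only:) (rule measurable_comp[OF measurable_snd measurable_noise_entry])
    qed
  qed
qed

lemma ball_sources:
  "(\<forall>k\<in>sources n R \<times> {..<n}. Q k) \<longleftrightarrow>
    (\<forall>q\<in>code_coordinates n R. Q (Inl (fst q), snd q)) \<and> (\<forall>j. \<forall>t<n. Q (Inr j, t))"
proof (intro iffI conjI ballI allI impI)
  fix k assume "(\<forall>q\<in>code_coordinates n R. Q (Inl (fst q), snd q)) \<and> (\<forall>j. \<forall>t<n. Q (Inr j, t))"
    and "k \<in> sources n R \<times> {..<n}"
  then show "Q k" by (cases k) (auto simp: sources_def code_coordinates_def)
next
  fix q assume "\<forall>k\<in>sources n R \<times> {..<n}. Q k" "q \<in> code_coordinates n R"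
  then show "Q (Inl (fst q), snd q)"
    by (elim ballE[of _ _ "(Inl (fst q), snd q)"]) (auto simp: sources_def code_coordinates_def)
next
  fix j t assume "\<forall>k\<in>sources n R \<times> {..<n}. Q k" "t < n"
  then show "Q (Inr j, t)"
    by (elim ballE[of _ _ "(Inr j, t)"]) (auto simp: sources_def)
qed

text \<open>Flattens the nested product of codebook, receivers and times into one product of
  standard normal laws. On boxes both sides are the same product of one-letter probabilities.
  Independence and the marginal laws of all coordinates are read off from this identity.\<close>

lemma distr_coordinate_vars:
  "distr (joint_measure n R) (Pi\<^sub>M (sources n R \<times> {..<n}) (\<lambda>_. borel)) (\<lambda>\<omega>. \<lambda>k\<in>sources n R \<times> {..<n}. coordinate_var k \<omega>)
    = Pi\<^sub>M (sources n R \<times> {..<n}) (\<lambda>_. std_normal_measure)"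
proof -
  let ?K = "sources n R \<times> {..<n}" and ?C = "code_coordinates n R" and ?J = "joint_measure n R"
  let ?B = "Pi\<^sub>M ?K (\<lambda>_. borel :: real measure)" and ?S = std_normal_measure
  interpret S: product_sigma_finite "\<lambda>_. std_normal_measure"
    using prob_space_std_normal_measure by (simp add: product_sigma_finite_def prob_space_imp_sigma_finite)
  interpret W: product_sigma_finite "\<lambda>_. noise_word_measure n"
    using prob_space_noise_word_measure by (simp add: product_sigma_finite_def prob_space_imp_sigma_finite)
  interpret N: prob_space "noise_measure n" by (rule prob_space_noise_measure)
  have m: "(\<lambda>\<omega>. \<lambda>k\<in>?K. coordinate_var k \<omega>) \<in> measurable ?J ?B"
    by (intro measurable_restrict measurable_coordinate_var)
  have finK: "finite ?K" by (simp add: sources_def)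
  show ?thesis
  proof (rule S.PiM_eqI)
    show "sets (distr ?J ?B (\<lambda>\<omega>. \<lambda>k\<in>?K. coordinate_var k \<omega>)) = sets (Pi\<^sub>M ?K (\<lambda>_. ?S))"
      by (simp cong: sets_PiM_cong)
    fix A :: "coordinate \<Rightarrow> real set" assume "\<And>k. k \<in> ?K \<Longrightarrow> A k \<in> sets ?S"
    then have A: "A k \<in> sets borel" if "k \<in> ?K" for k using that by simp
    let ?A1 = "Pi\<^sub>E ?C (\<lambda>(q, t). A (Inl q, t))"
    let ?A2 = "Pi\<^sub>E UNIV (\<lambda>j. Pi\<^sub>E {..<n} (\<lambda>t. A (Inr j, t)))"
    have AC: "(case q of (q, t) \<Rightarrow> A (Inl q, t)) \<in> sets borel" if "q \<in> ?C" for q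
      using that by (auto simp: code_coordinates_def sources_def intro!: A)
    have AN: "A (Inr j, t) \<in> sets borel" if "t < n" for j t
      using that by (intro A) (auto simp: sources_def)
    have A1: "?A1 \<in> sets (codebook_measure n R)"
      using AC by (auto intro!: sets_PiM_I_finite)
    have A2': "Pi\<^sub>E {..<n} (\<lambda>t. A (Inr j, t)) \<in> sets (Pi\<^sub>M {..<n} (\<lambda>_. borel))" for j
      by (rule sets_PiM_I_finite) (use AN in auto)
    have A2: "?A2 \<in> sets (noise_measure n)"
      using A2' by (auto intro!: sets_PiM_I_finite)
    have "emeasure (distr ?J ?B (\<lambda>\<omega>. \<lambda>k\<in>?K. coordinate_var k \<omega>)) (Pi\<^sub>E ?K A)
        = emeasure ?J ((\<lambda>\<omega>. \<lambda>k\<in>?K. coordinate_var k \<omega>) -` Pi\<^sub>E ?K A \<inter> space ?J)"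
      using A finK by (intro emeasure_distr m sets_PiM_I_finite) auto
    also have "(\<lambda>\<omega>. \<lambda>k\<in>?K. coordinate_var k \<omega>) -` Pi\<^sub>E ?K A \<inter> space ?J = ?A1 \<times> ?A2"
      (is "?L = _")
    proof (rule set_eqI)
      fix \<omega> :: "((4 \<times> nat) \<times> nat \<Rightarrow> real) \<times> (2 \<Rightarrow> nat \<Rightarrow> real)"
      obtain w z where \<omega>: "\<omega> = (w, z)" by (cases \<omega>)
      have "\<omega> \<in> ?L \<longleftrightarrow> (\<forall>k\<in>?K. coordinate_var k (w, z) \<in> A k) \<and> w \<in> extensional ?C \<and> (\<forall>j. z j \<in> extensional {..<n})"
        by (auto simp: \<omega> joint_measure_def space_pair_measure codebook_measure_def noise_measure_eq noise_word_measure_def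
            space_PiM PiE_iff)
      also have "\<dots> \<longleftrightarrow> \<omega> \<in> ?A1 \<times> ?A2"
        unfolding \<omega> ball_sources by (auto simp: PiE_iff case_prod_unfold)
      finally show "\<omega> \<in> ?L \<longleftrightarrow> \<omega> \<in> ?A1 \<times> ?A2" .
    qed
    also have "emeasure ?J (?A1 \<times> ?A2) = emeasure (codebook_measure n R) ?A1 * emeasure (noise_measure n) ?A2"
      unfolding joint_measure_def by (rule N.emeasure_pair_measure_Times[OF A1 A2])
    also have "emeasure (codebook_measure n R) ?A1 = (\<Prod>(q, t)\<in>?C. emeasure ?S (A (Inl q, t)))"
      unfolding codebook_measure_def using AC by (subst S.emeasure_PiM) (auto simp: case_prod_unfold)
    also have "emeasure (noise_measure n) ?A2 = (\<Prod>j\<in>UNIV. emeasure (noise_word_measure n) (Pi\<^sub>E {..<n} (\<lambda>t. A (Inr j, t))))"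
      unfolding noise_measure_eq using A2' by (subst W.emeasure_PiM) auto
    also have "\<dots> = (\<Prod>j\<in>UNIV. \<Prod>t<n. emeasure ?S (A (Inr j, t)))"
      unfolding noise_word_measure_def using AN by (intro prod.cong refl S.emeasure_PiM) auto
    also have "(\<Prod>(q, t)\<in>?C. emeasure ?S (A (Inl q, t))) * (\<Prod>j\<in>UNIV. \<Prod>t<n. emeasure ?S (A (Inr j, t))) = (\<Prod>k\<in>?K. emeasure ?S (A k))"
    proof -
      have "(\<Prod>k\<in>?K. emeasure ?S (A k)) = (\<Prod>s\<in>sources n R. \<Prod>t<n. emeasure ?S (A (s, t)))"
        by (simp add: prod.cartesian_product)
      also have "\<dots> = (\<Prod>q\<in>(SIGMA i:UNIV. messages n (R $ i)). \<Prod>t<n. emeasure ?S (A (Inl q, t))) *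
          (\<Prod>j\<in>UNIV. \<Prod>t<n. emeasure ?S (A (Inr j, t)))"
        unfolding sources_def by (subst prod.Plus) (auto simp: comp_def)
      finally show ?thesis
        by (simp add: code_coordinates_def prod.cartesian_product case_prod_unfold)
    qed
    finally show "emeasure (distr ?J ?B (\<lambda>\<omega>. \<lambda>k\<in>?K. coordinate_var k \<omega>)) (Pi\<^sub>E ?K A) = (\<Prod>k\<in>?K. emeasure ?S (A k))" .
  qed (fact finK)
qed

lemma distr_coordinate_var:
  assumes k: "k \<in> sources n R \<times> {..<n}"
  shows "distr (joint_measure n R) borel (coordinate_var k) = std_normal_measure"
proof -
  let ?K = "sources n R \<times> {..<n}" and ?J = "joint_measure n R"
  have m: "(\<lambda>\<omega>. \<lambda>k\<in>?K. coordinate_var k \<omega>) \<in> measurable ?J (Pi\<^sub>M ?K (\<lambda>_. borel))"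
    by (intro measurable_restrict measurable_coordinate_var)
  have "distr ?J borel (coordinate_var k) = distr (distr ?J (Pi\<^sub>M ?K (\<lambda>_. borel)) (\<lambda>\<omega>. \<lambda>k\<in>?K. coordinate_var k \<omega>)) borel (\<lambda>v. v k)"
    using k m by (subst distr_distr) (auto simp: comp_def)
  also have "\<dots> = distr (Pi\<^sub>M ?K (\<lambda>_. std_normal_measure)) std_normal_measure (\<lambda>v. v k)"
    unfolding distr_coordinate_vars by (rule distr_cong) auto
  also have "\<dots> = std_normal_measure"
    using k by (intro distr_PiM_component prob_space_std_normal_measure)
  finally show ?thesis .
qed

lemma distributed_coordinate_var:
  assumes k: "k \<in> sources n R \<times> {..<n}"
  shows "distributed (joint_measure n R) lborel (coordinate_var k) std_normal_density"
  using distr_coordinate_var[OF k] measurable_coordinate_var[OF k]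
  by (simp add: distributed_def std_normal_measure_def cong: distr_cong)

lemma indep_coordinate_vars:
  assumes n: "1 \<le> n"
  shows "prob_space.indep_vars (joint_measure n R) (\<lambda>_. borel) coordinate_var (sources n R \<times> {..<n})"
proof -
  interpret prob_space "joint_measure n R" by (rule prob_space_joint_measure)
  have "Inr 1 \<in> sources n R" by (auto simp: sources_def)
  moreover have "0 \<in> {..<n}" using n by simp
  ultimately have "sources n R \<times> {..<n} \<noteq> {}" by blast
  moreover have "Pi\<^sub>M (sources n R \<times> {..<n}) (\<lambda>k. distr (joint_measure n R) borel (coordinate_var k))
      = Pi\<^sub>M (sources n R \<times> {..<n}) (\<lambda>_. std_normal_measure)"
    by (intro PiM_cong refl distr_coordinate_var)
  ultimately show ?thesis
    using measurable_coordinate_var distr_coordinate_vars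
    by (subst indep_vars_iff_distr_eq_PiM') auto
qed

lemma exists_section_less:
  fixes c :: "'c \<Rightarrow> real"
  assumes C: "prob_space C" and N: "prob_space N" and A: "finite A" "\<And>a. a \<in> A \<Longrightarrow> 0 \<le> c a"
    and S: "\<And>a. a \<in> A \<Longrightarrow> S a \<in> sets (C \<Otimes>\<^sub>M N)"
    and less: "(\<Sum>a\<in>A. c a * measure (C \<Otimes>\<^sub>M N) (S a)) < b"
  shows "\<exists>w\<in>space C. (\<Sum>a\<in>A. c a * measure N (Pair w -` S a)) < b"
proof (rule ccontr)
  interpret C: prob_space C by fact
  interpret N: prob_space N by fact
  interpret P: pair_prob_space C N ..
  let ?e = "\<lambda>w. (\<Sum>a\<in>A. c a * measure N (Pair w -` S a))"
  assume "\<not> (\<exists>w\<in>space C. ?e w < b)"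
  then have ge: "b \<le> ?e w" if "w \<in> space C" for w using that by force
  have "ennreal b = (\<integral>\<^sup>+w. ennreal b \<partial>C)" by (simp add: C.emeasure_space_1)
  also have "\<dots> \<le> (\<integral>\<^sup>+w. ennreal (?e w) \<partial>C)"
    by (intro nn_integral_mono ennreal_leI ge)
  also have "\<dots> = (\<integral>\<^sup>+w. (\<Sum>a\<in>A. ennreal (c a) * emeasure N (Pair w -` S a)) \<partial>C)"
    using A by (intro nn_integral_cong) (simp add: N.emeasure_eq_measure ennreal_mult'[symmetric] sum_ennreal)
  also have "\<dots> = (\<Sum>a\<in>A. ennreal (c a) * (\<integral>\<^sup>+w. emeasure N (Pair w -` S a) \<partial>C))"
    using S by (subst nn_integral_sum) (auto intro!: sum.cong nn_integral_cmult N.measurable_emeasure_Pair borel_measurable_times_ennreal)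
  also have "\<dots> = (\<Sum>a\<in>A. ennreal (c a) * emeasure (C \<Otimes>\<^sub>M N) (S a))"
    using S by (intro sum.cong refl) (simp add: N.emeasure_pair_measure_alt)
  also have "\<dots> = ennreal (\<Sum>a\<in>A. c a * measure (C \<Otimes>\<^sub>M N) (S a))"
    using A by (simp add: P.emeasure_eq_measure ennreal_mult'[symmetric] sum_ennreal)
  also have "\<dots> < ennreal b"
    using less A by (intro ennreal_lessI le_less_trans[OF sum_nonneg less]) auto
  finally show False by simp
qed

section \<open>Joint decoding by information densities\<close>

text \<open>For jointly Gaussian signals, \<open>info_density n a s2 T x y\<close> is the information density (in nats) between the
  inputs of \<open>T\<close> and \<open>y\<close>, given the other inputs; \<open>s2\<close> is the variance of what \<open>T\<close> and the noise contribute to \<open>y\<close>.\<close>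

definition info_density ::
  "nat \<Rightarrow> (4 \<Rightarrow> real) \<Rightarrow> real \<Rightarrow> 4 set \<Rightarrow> (4 \<Rightarrow> nat \<Rightarrow> real) \<Rightarrow> (nat \<Rightarrow> real) \<Rightarrow> real" where
  "info_density n a s2 T x y = (\<Sum>t<n. 1/2 * ln s2 + (y t - (\<Sum>i\<in>-T. a i * x i t))\<^sup>2 / (2 * s2)
      - (y t - (\<Sum>i\<in>UNIV. a i * x i t))\<^sup>2 / 2)"

definition signal_variance :: "(4 \<Rightarrow> real) \<Rightarrow> (4 \<Rightarrow> real) \<Rightarrow> 4 set \<Rightarrow> real" where
  "signal_variance a \<sigma> T = 1 + (\<Sum>i\<in>T. (a i * \<sigma> i)\<^sup>2)"

text \<open>For the codewords actually sent, the information density has mean n/2 ln of the signal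
  variance; the threshold lies \<open>d\<close> nats per letter below it.\<close>

definition threshold :: "nat \<Rightarrow> (4 \<Rightarrow> real) \<Rightarrow> (4 \<Rightarrow> real) \<Rightarrow> real \<Rightarrow> 4 set \<Rightarrow> real" where
  "threshold n a \<sigma> d T = n * (1/2 * ln (signal_variance a \<sigma> T) - d)"

text \<open>The possible sets of users on which two different message tuples disagree. Users of rate
  zero are excluded because their power may vanish too, and the strict rate condition would then
  read 0 < 0.\<close>

definition active_sets :: "real ^ 4 \<Rightarrow> 4 set set" where
  "active_sets R = {T. T \<noteq> {} \<and> (\<forall>i\<in>T. 0 < R $ i)}"

definition compatible ::
  "nat \<Rightarrow> (4 \<Rightarrow> real) \<Rightarrow> (4 \<Rightarrow> real) \<Rightarrow> real \<Rightarrow> real ^ 4 \<Rightarrow> (4 \<Rightarrow> nat \<Rightarrow> real) \<Rightarrow> (nat \<Rightarrow> real) \<Rightarrow> bool" where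
  "compatible n a \<sigma> d R x y \<longleftrightarrow>
    (\<forall>T\<in>active_sets R. threshold n a \<sigma> d T < info_density n a (signal_variance a \<sigma> T) T x y)"

text \<open>Failure of unique decoding of all four messages at one receiver: a mistake about an
  interfering message counts as well.\<close>

definition decoding_fails ::
  "nat \<Rightarrow> (4 \<Rightarrow> real) \<Rightarrow> (4 \<Rightarrow> real) \<Rightarrow> real \<Rightarrow> real ^ 4 \<Rightarrow> (4 \<Rightarrow> nat \<Rightarrow> nat \<Rightarrow> real) \<Rightarrow> (4 \<Rightarrow> nat) \<Rightarrow> (nat \<Rightarrow> real) \<Rightarrow> bool" where
  "decoding_fails n a \<sigma> d R f m y \<longleftrightarrow>
    \<not> compatible n a \<sigma> d R (\<lambda>i. f i (m i)) y \<or>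
    (\<exists>m'\<in>message_tuples n R. m' \<noteq> m \<and> compatible n a \<sigma> d R (\<lambda>i. f i (m' i)) y)"

definition gaussian_code :: "(4 \<Rightarrow> real) \<Rightarrow> ((4 \<times> nat) \<times> nat \<Rightarrow> real) \<Rightarrow> 4 \<Rightarrow> nat \<Rightarrow> nat \<Rightarrow> real" where
  "gaussian_code \<sigma> w i k t = \<sigma> i * w ((i, k), t)"

lemma signal_variance_pos: "0 < signal_variance a \<sigma> T"
  unfolding signal_variance_def by (intro add_pos_nonneg sum_nonneg) auto

lemma finite_active_sets [simp]: "finite (active_sets R)"
  by simp

lemma measurable_info_density:
  assumes "\<And>i t. t < n \<Longrightarrow> (\<lambda>\<omega>. x \<omega> i t) \<in> borel_measurable M" "\<And>t. t < n \<Longrightarrow> (\<lambda>\<omega>. y \<omega> t) \<in> borel_measurable M"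
  shows "(\<lambda>\<omega>. info_density n a s2 T (x \<omega>) (y \<omega>)) \<in> borel_measurable M"
  unfolding info_density_def
  by (intro borel_measurable_sum borel_measurable_diff borel_measurable_add borel_measurable_divide borel_measurable_power
      borel_measurable_times borel_measurable_const assms) auto

lemma compatible_event:
  assumes "\<And>i t. t < n \<Longrightarrow> (\<lambda>\<omega>. x \<omega> i t) \<in> borel_measurable M" "\<And>t. t < n \<Longrightarrow> (\<lambda>\<omega>. y \<omega> t) \<in> borel_measurable M"
  shows "{\<omega> \<in> space M. compatible n a \<sigma> d R (x \<omega>) (y \<omega>)} \<in> sets M"
  unfolding compatible_def
  by (intro sets.sets_Collect_finite_All borel_measurable_less borel_measurable_const measurable_info_density assms) auto

lemma decoding_fails_event:
  assumes x: "\<And>m i t. m \<in> message_tuples n R \<Longrightarrow> t < n \<Longrightarrow> (\<lambda>\<omega>. f \<omega> i (m i) t) \<in> borel_measurable M"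
    and y: "\<And>t. t < n \<Longrightarrow> (\<lambda>\<omega>. y \<omega> t) \<in> borel_measurable M" and m: "m \<in> message_tuples n R"
  shows "{\<omega> \<in> space M. decoding_fails n a \<sigma> d R (f \<omega>) m (y \<omega>)} \<in> sets M"
proof -
  have *: "{\<omega> \<in> space M. compatible n a \<sigma> d R (\<lambda>i. f \<omega> i (m' i)) (y \<omega>)} \<in> sets M" if "m' \<in> message_tuples n R" for m'
    using compatible_event[of n "\<lambda>\<omega> i. f \<omega> i (m' i)" M y] x[OF that] y by auto
  show ?thesis
    unfolding decoding_fails_def
    by (intro sets.sets_Collect sets.sets_Collect_finite_Ex * m) (auto intro: *)
qed

lemma message_source:
  assumes "m \<in> message_tuples n R" shows "Inl (i, m i) \<in> sources n R"
  using message_tuples_component[OF assms, of i] by (auto simp: sources_def)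

lemma gaussian_code_coordinate: "gaussian_code \<sigma> (fst \<omega>) i k t = \<sigma> i * coordinate_var (Inl (i, k), t) \<omega>"
  by (cases \<omega>) (simp add: gaussian_code_def)

lemma received_coordinate:
  assumes "t < n"
  shows "received h1 h2 n (\<lambda>i. gaussian_code \<sigma> (fst \<omega>) i (m i)) (snd \<omega>) j t =
    (\<Sum>i\<in>UNIV. gain h1 h2 i j * \<sigma> i * coordinate_var (Inl (i, m i), t) \<omega>) + coordinate_var (Inr j, t) \<omega>"
  using assms by (cases \<omega>) (simp add: received_def gaussian_code_def mult.assoc)

lemma measurable_gaussian_code:
  assumes "m \<in> message_tuples n R" "t < n"
  shows "(\<lambda>\<omega>. gaussian_code \<sigma> (fst \<omega>) i (m i) t) \<in> borel_measurable (joint_measure n R)"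
  unfolding gaussian_code_coordinate using assms message_source
  by (intro borel_measurable_times borel_measurable_const measurable_coordinate_var) auto

lemma measurable_received_joint:
  assumes "m \<in> message_tuples n R" "t < n"
  shows "(\<lambda>\<omega>. received h1 h2 n (\<lambda>i. gaussian_code \<sigma> (fst \<omega>) i (m i)) (snd \<omega>) j t) \<in> borel_measurable (joint_measure n R)"
  unfolding received_coordinate[OF assms(2)] using assms message_source[OF assms(1)]
  by (intro borel_measurable_add borel_measurable_sum borel_measurable_times borel_measurable_const measurable_coordinate_var)
    (auto simp: sources_def)

section \<open>The random coding error at one receiver\<close>

context
  fixes n :: nat and R :: "real ^ 4" and h1 h2 d :: real and j :: 2 and \<sigma> :: "4 \<Rightarrow> real"
  assumes n: "1 \<le> n" and d: "0 < d"
begin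

abbreviation "gn \<equiv> \<lambda>i. gain h1 h2 i j"
abbreviation "code \<equiv> \<lambda>(\<omega> :: ((4 \<times> nat) \<times> nat \<Rightarrow> real) \<times> (2 \<Rightarrow> nat \<Rightarrow> real)) m i. gaussian_code \<sigma> (fst \<omega>) i (m i)"
abbreviation "rec \<equiv> \<lambda>m \<omega>. received h1 h2 n (code \<omega> m) (snd \<omega>) j"

interpretation J: prob_space "joint_measure n R" by (rule prob_space_joint_measure)

text \<open>Gains and amplitudes are absorbed into the coefficients, so that every coordinate itself
  is standard normal.\<close>

definition coef :: "(4 \<times> nat) + 2 \<Rightarrow> real" where
  "coef = case_sum (\<lambda>(i, _). gn i * \<sigma> i) (\<lambda>_. 1)"

definition users :: "(4 \<Rightarrow> nat) \<Rightarrow> 4 set \<Rightarrow> ((4 \<times> nat) + 2) set" where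
  "users m T = (\<lambda>i. Inl (i, m i)) ` T"

lemma sum_users: "(\<Sum>k\<in>users m T. F k) = (\<Sum>i\<in>T. F (Inl (i, m i)))" for F :: "_ \<Rightarrow> real"
  unfolding users_def by (simp add: sum.reindex inj_on_def)

lemma sum_users_noise: "(\<Sum>k\<in>insert (Inr j) (users m T). F k) = F (Inr j) + (\<Sum>i\<in>T. F (Inl (i, m i)))" for F :: "_ \<Rightarrow> real"
proof -
  have "finite (users m T)" "Inr j \<notin> users m T" by (auto simp: users_def)
  then show ?thesis by (simp add: sum_users)
qed

lemma signal_variance_coef: "signal_variance gn \<sigma> T = (\<Sum>k\<in>insert (Inr j) (users m T). (coef k)\<^sup>2)"
  by (simp add: sum_users_noise coef_def signal_variance_def)

lemma users_sources: "m \<in> message_tuples n R \<Longrightarrow> insert (Inr j) (users m T) \<subseteq> sources n R"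
  using message_source by (auto simp: users_def sources_def)

text \<open>With \<open>m\<close> sent and \<open>m'\<close> tested, the codewords outside
  \<open>T\<close> are assumed correctly and cancel. What is left is \<open>V\<close> of the
  likelihood-ratio bounds, and subtracting also the tested codewords of \<open>T\<close> gives V -
  U.\<close>

lemma residual:
  assumes "t < n" "\<And>i. i \<notin> T \<Longrightarrow> m' i = m i"
  shows "rec m \<omega> t - (\<Sum>i\<in>-T. gn i * code \<omega> m' i t)
    = (\<Sum>k\<in>insert (Inr j) (users m T). coef k * coordinate_var (k, t) \<omega>)"
    and "rec m \<omega> t - (\<Sum>i\<in>UNIV. gn i * code \<omega> m' i t)
    = (\<Sum>k\<in>insert (Inr j) (users m T). coef k * coordinate_var (k, t) \<omega>)
      - (\<Sum>k\<in>users m' T. coef k * coordinate_var (k, t) \<omega>)"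
proof -
  have split: "(\<Sum>i\<in>UNIV. F i) = (\<Sum>i\<in>T. F i) + (\<Sum>i\<in>-T. F i)" for F :: "4 \<Rightarrow> real"
    by (subst sum.union_disjoint[symmetric]) auto
  have "(\<Sum>i\<in>-T. gn i * code \<omega> m' i t) = (\<Sum>i\<in>-T. gn i * \<sigma> i * coordinate_var (Inl (i, m i), t) \<omega>)"
    using assms(2) by (intro sum.cong) (auto simp: gaussian_code_coordinate mult.assoc)
  then show 1: "rec m \<omega> t - (\<Sum>i\<in>-T. gn i * code \<omega> m' i t)
    = (\<Sum>k\<in>insert (Inr j) (users m T). coef k * coordinate_var (k, t) \<omega>)"
    unfolding received_coordinate[OF assms(1)] split by (simp add: sum_users_noise coef_def)
  show "rec m \<omega> t - (\<Sum>i\<in>UNIV. gn i * code \<omega> m' i t)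
    = (\<Sum>k\<in>insert (Inr j) (users m T). coef k * coordinate_var (k, t) \<omega>)
      - (\<Sum>k\<in>users m' T. coef k * coordinate_var (k, t) \<omega>)"
    unfolding 1[symmetric] split by (simp add: sum_users coef_def gaussian_code_coordinate mult.assoc)
qed

text \<open>Subtracting all true codewords leaves exactly the noise of receiver \<open>j\<close>,
  which plays the role of the distinguished source \<open>k0\<close> with coefficient 1.\<close>

lemma true_message_atypical:
  assumes m: "m \<in> message_tuples n R"
  shows "J.prob {\<omega> \<in> space (joint_measure n R). info_density n gn (signal_variance gn \<sigma> T) T (code \<omega> m) (rec m \<omega>) \<le> threshold n gn \<sigma> d T}
    \<le> 4 / (n * d\<^sup>2)"
proof -
  let ?B = "insert (Inr j) (users m T)"
  have sub: "?B \<times> {..<n} \<subseteq> sources n R \<times> {..<n}" using users_sources[OF m] by blast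
  have z: "rec m \<omega> t - (\<Sum>i\<in>UNIV. gn i * code \<omega> m i t) = coordinate_var (Inr j, t) \<omega>" if "t < n" for \<omega> t
    unfolding received_coordinate[OF that] by (simp add: gaussian_code_coordinate mult.assoc)
  have "J.prob {\<omega> \<in> space (joint_measure n R). (\<Sum>t<n. 1/2 * ln (\<Sum>k\<in>?B. (coef k)\<^sup>2)
      + (\<Sum>k\<in>?B. coef k * coordinate_var (k, t) \<omega>)\<^sup>2 / (2 * (\<Sum>k\<in>?B. (coef k)\<^sup>2)) - (coordinate_var (Inr j, t) \<omega>)\<^sup>2 / 2)
        \<le> n * (1/2 * ln (\<Sum>k\<in>?B. (coef k)\<^sup>2) - d)} \<le> 4 / (n * d\<^sup>2)"
  proof (rule J.right_codeword_bound)
    show "J.indep_vars (\<lambda>_. borel) coordinate_var (?B \<times> {..<n})"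
      by (rule J.indep_vars_subset[OF indep_coordinate_vars[OF n] sub])
    show "distributed (joint_measure n R) lborel (coordinate_var k) std_normal_density" if "k \<in> ?B \<times> {..<n}" for k
      using distributed_coordinate_var sub that by blast
  qed (use n d in \<open>auto simp: users_def coef_def\<close>)
  moreover have "info_density n gn (signal_variance gn \<sigma> T) T (code \<omega> m) (rec m \<omega>) = (\<Sum>t<n. 1/2 * ln (\<Sum>k\<in>?B. (coef k)\<^sup>2)
      + (\<Sum>k\<in>?B. coef k * coordinate_var (k, t) \<omega>)\<^sup>2 / (2 * (\<Sum>k\<in>?B. (coef k)\<^sup>2)) - (coordinate_var (Inr j, t) \<omega>)\<^sup>2 / 2)" for \<omega>
    unfolding info_density_def signal_variance_coef[of _ m]
  proof (intro sum.cong refl)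
    fix t assume "t \<in> {..<n}"
    then have t: "t < n" by simp
    show "1/2 * ln (\<Sum>k\<in>?B. (coef k)\<^sup>2)
      + (rec m \<omega> t - (\<Sum>i\<in>-T. gn i * code \<omega> m i t))\<^sup>2 / (2 * (\<Sum>k\<in>?B. (coef k)\<^sup>2)) - (rec m \<omega> t - (\<Sum>i\<in>UNIV. gn i * code \<omega> m i t))\<^sup>2 / 2
      = 1/2 * ln (\<Sum>k\<in>?B. (coef k)\<^sup>2)
      + (\<Sum>k\<in>?B. coef k * coordinate_var (k, t) \<omega>)\<^sup>2 / (2 * (\<Sum>k\<in>?B. (coef k)\<^sup>2)) - (coordinate_var (Inr j, t) \<omega>)\<^sup>2 / 2"
      unfolding residual(1)[OF t refl] z[OF t] ..
  qed
  ultimately show ?thesis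
    unfolding threshold_def signal_variance_coef[of _ m] by simp
qed

lemma wrong_message_typical:
  assumes m: "m \<in> message_tuples n R" "m' \<in> message_tuples n R"
    and T: "\<And>i. i \<notin> T \<Longrightarrow> m' i = m i" "\<And>i. i \<in> T \<Longrightarrow> m' i \<noteq> m i"
  shows "J.prob {\<omega> \<in> space (joint_measure n R). threshold n gn \<sigma> d T < info_density n gn (signal_variance gn \<sigma> T) T (code \<omega> m') (rec m \<omega>)}
    \<le> exp (- threshold n gn \<sigma> d T)"
proof -
  let ?B = "insert (Inr j) (users m T)" and ?B' = "users m' T"
  have sub: "(?B \<union> ?B') \<times> {..<n} \<subseteq> sources n R \<times> {..<n}"
    using users_sources[OF m(1)] users_sources[OF m(2)] by blast
  have "J.prob {\<omega> \<in> space (joint_measure n R). threshold n gn \<sigma> d T < (\<Sum>t<n. 1/2 * ln (\<Sum>k\<in>?B. (coef k)\<^sup>2)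
      + (\<Sum>k\<in>?B. coef k * coordinate_var (k, t) \<omega>)\<^sup>2 / (2 * (\<Sum>k\<in>?B. (coef k)\<^sup>2))
      - ((\<Sum>k\<in>?B. coef k * coordinate_var (k, t) \<omega>) - (\<Sum>k\<in>?B'. coef k * coordinate_var (k, t) \<omega>))\<^sup>2 / 2)}
      \<le> exp (- threshold n gn \<sigma> d T)"
  proof (rule J.wrong_codeword_bound)
    show "J.indep_vars (\<lambda>_. borel) coordinate_var ((?B \<union> ?B') \<times> {..<n})"
      by (rule J.indep_vars_subset[OF indep_coordinate_vars[OF n] sub])
    show "distributed (joint_measure n R) lborel (coordinate_var k) std_normal_density" if "k \<in> ?B \<times> {..<n}" for k
      using distributed_coordinate_var sub that by blast
    show "0 < (\<Sum>k\<in>?B. (coef k)\<^sup>2)"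
      unfolding signal_variance_coef[symmetric] by (rule signal_variance_pos)
    \<comment> \<open>The tested messages are wrong for every user in \<open>T\<close>, so their
      codewords share no source with the sent ones or with the noise. This is where the independence
      of \<open>V\<close> and \<open>U\<close> comes from.\<close>
    show "?B \<inter> ?B' = {}" using T(2) by (fastforce simp: users_def)
  qed (auto simp: users_def)
  moreover have "info_density n gn (signal_variance gn \<sigma> T) T (code \<omega> m') (rec m \<omega>) = (\<Sum>t<n. 1/2 * ln (\<Sum>k\<in>?B. (coef k)\<^sup>2)
      + (\<Sum>k\<in>?B. coef k * coordinate_var (k, t) \<omega>)\<^sup>2 / (2 * (\<Sum>k\<in>?B. (coef k)\<^sup>2))
      - ((\<Sum>k\<in>?B. coef k * coordinate_var (k, t) \<omega>) - (\<Sum>k\<in>?B'. coef k * coordinate_var (k, t) \<omega>))\<^sup>2 / 2)" for \<omega>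
    unfolding info_density_def signal_variance_coef[of _ m]
  proof (intro sum.cong refl)
    fix t assume "t \<in> {..<n}"
    then have t: "t < n" by simp
    show "1/2 * ln (\<Sum>k\<in>?B. (coef k)\<^sup>2)
      + (rec m \<omega> t - (\<Sum>i\<in>-T. gn i * code \<omega> m' i t))\<^sup>2 / (2 * (\<Sum>k\<in>?B. (coef k)\<^sup>2)) - (rec m \<omega> t - (\<Sum>i\<in>UNIV. gn i * code \<omega> m' i t))\<^sup>2 / 2
      = 1/2 * ln (\<Sum>k\<in>?B. (coef k)\<^sup>2)
      + (\<Sum>k\<in>?B. coef k * coordinate_var (k, t) \<omega>)\<^sup>2 / (2 * (\<Sum>k\<in>?B. (coef k)\<^sup>2))
      - ((\<Sum>k\<in>?B. coef k * coordinate_var (k, t) \<omega>) - (\<Sum>k\<in>?B'. coef k * coordinate_var (k, t) \<omega>))\<^sup>2 / 2"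
      by (subst residual(1)[where m'=m' and m=m and T=T, OF t T(1)], assumption, subst residual(2)[where m'=m' and m=m and T=T, OF t T(1)], assumption, rule refl)
  qed
  ultimately show ?thesis by (simp only:)
qed

text \<open>A union bound organised by the set \<open>T\<close> of users on which a competing tuple
  differs. For each \<open>T\<close> the sent tuple may miss its threshold, or one of at most as
  many competitors as there are messages for \<open>T\<close> may exceed it.\<close>

lemma decoding_fails_prob:
  assumes m: "m \<in> message_tuples n R" and R: "\<And>i. 0 \<le> R $ i"
  shows "J.prob {\<omega> \<in> space (joint_measure n R). decoding_fails n gn \<sigma> d R (gaussian_code \<sigma> (fst \<omega>)) m (rec m \<omega>)}
    \<le> (\<Sum>T\<in>active_sets R. 4 / (n * d\<^sup>2) + (\<Prod>i\<in>T. real (card (messages n (R $ i)))) * exp (- threshold n gn \<sigma> d T))"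
proof -
  let ?J = "joint_measure n R" and ?A = "\<lambda>i. messages n (R $ i)"
  define mg where "mg T b = (\<lambda>i. if i \<in> T then b i else m i)" for T and b :: "4 \<Rightarrow> nat"
  define wrong where "wrong T = {b \<in> Pi\<^sub>E T ?A. \<forall>i\<in>T. b i \<noteq> m i}" for T
  define E1 where "E1 T = {\<omega> \<in> space ?J. info_density n gn (signal_variance gn \<sigma> T) T (code \<omega> m) (rec m \<omega>) \<le> threshold n gn \<sigma> d T}" for T
  define E2 where "E2 T m' = {\<omega> \<in> space ?J. threshold n gn \<sigma> d T < info_density n gn (signal_variance gn \<sigma> T) T (code \<omega> m') (rec m \<omega>)}" for T m'
  have fin: "finite (Pi\<^sub>E T ?A)" for T by (intro finite_PiE) auto
  have finw: "finite (wrong T)" for T unfolding wrong_def using fin by simp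
  have mg: "mg T b \<in> message_tuples n R" if "b \<in> wrong T" for T b
    using that message_tuples_component[OF m] by (auto simp: wrong_def mg_def message_tuples_def PiE_iff)
  have im: "(\<lambda>\<omega>. info_density n gn s T (code \<omega> m') (rec m \<omega>)) \<in> borel_measurable ?J" if "m' \<in> message_tuples n R" for s T m'
    by (intro measurable_info_density measurable_gaussian_code measurable_received_joint m that)
  have E1: "E1 T \<in> sets ?J" for T
    unfolding E1_def by (intro borel_measurable_le borel_measurable_const im m)
  have E2: "E2 T m' \<in> sets ?J" if "m' \<in> message_tuples n R" for T m'
    unfolding E2_def by (intro borel_measurable_less borel_measurable_const im that)
  have E2U: "(\<Union>b\<in>wrong T. E2 T (mg T b)) \<in> sets ?J" for T
    by (intro sets.finite_UN finw E2 mg)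
  have sub: "{\<omega> \<in> space ?J. decoding_fails n gn \<sigma> d R (gaussian_code \<sigma> (fst \<omega>)) m (rec m \<omega>)}
      \<subseteq> (\<Union>T\<in>active_sets R. E1 T \<union> (\<Union>b\<in>wrong T. E2 T (mg T b)))"
  proof
    fix \<omega> assume "\<omega> \<in> {\<omega> \<in> space ?J. decoding_fails n gn \<sigma> d R (gaussian_code \<sigma> (fst \<omega>)) m (rec m \<omega>)}"
    then have sp: "\<omega> \<in> space ?J" and
      "\<not> compatible n gn \<sigma> d R (code \<omega> m) (rec m \<omega>) \<or>
        (\<exists>m'\<in>message_tuples n R. m' \<noteq> m \<and> compatible n gn \<sigma> d R (code \<omega> m') (rec m \<omega>))"
      by (auto simp: decoding_fails_def)
    from this(2) show "\<omega> \<in> (\<Union>T\<in>active_sets R. E1 T \<union> (\<Union>b\<in>wrong T. E2 T (mg T b)))"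
    proof
      assume "\<not> compatible n gn \<sigma> d R (code \<omega> m) (rec m \<omega>)"
      then show ?thesis using sp by (auto simp: compatible_def E1_def not_less)
    next
      assume "\<exists>m'\<in>message_tuples n R. m' \<noteq> m \<and> compatible n gn \<sigma> d R (code \<omega> m') (rec m \<omega>)"
      then obtain m' where m': "m' \<in> message_tuples n R" "m' \<noteq> m" "compatible n gn \<sigma> d R (code \<omega> m') (rec m \<omega>)"
        by blast
      \<comment> \<open>Compatibility tests all active sets, but for the competitor
        \<open>m'\<close> only the test for its exact set of errors is used: there the other
        codewords are right and those in \<open>T\<close> are fresh.\<close>
      define T where "T = {i. m' i \<noteq> m i}"
      have "0 < R $ i" if "i \<in> T" for i
      proof (rule ccontr)
        assume "\<not> 0 < R $ i"
        then have "R $ i = 0" using R[of i] by linarith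
        then show False
          using message_tuples_component[OF m, of i] message_tuples_component[OF m'(1), of i] that
          by (simp add: messages_rate_0 T_def)
      qed
      then have T: "T \<in> active_sets R" using m'(2) by (auto simp: active_sets_def T_def)
      have b: "restrict m' T \<in> wrong T"
        using message_tuples_component[OF m'(1)] by (auto simp: wrong_def T_def)
      have "mg T (restrict m' T) = m'" by (auto simp: mg_def T_def)
      then have "\<omega> \<in> E2 T (mg T (restrict m' T))"
        using m'(3) T sp by (auto simp: E2_def compatible_def)
      then show ?thesis using T b by blast
    qed
  qed
  have one: "J.prob (E1 T \<union> (\<Union>b\<in>wrong T. E2 T (mg T b)))
      \<le> 4 / (n * d\<^sup>2) + (\<Prod>i\<in>T. real (card (?A i))) * exp (- threshold n gn \<sigma> d T)" for T
  proof -
    have "J.prob (E1 T \<union> (\<Union>b\<in>wrong T. E2 T (mg T b))) \<le> J.prob (E1 T) + J.prob (\<Union>b\<in>wrong T. E2 T (mg T b))"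
      by (rule measure_Un_le[OF E1 E2U])
    also have "J.prob (E1 T) \<le> 4 / (n * d\<^sup>2)"
      unfolding E1_def by (rule true_message_atypical[OF m])
    also have "J.prob (\<Union>b\<in>wrong T. E2 T (mg T b)) \<le> (\<Sum>b\<in>wrong T. J.prob (E2 T (mg T b)))"
      by (intro measure_UNION_le finw E2 mg)
    also have "\<dots> \<le> (\<Sum>b\<in>wrong T. exp (- threshold n gn \<sigma> d T))"
    proof (rule sum_mono)
      fix b assume b: "b \<in> wrong T"
      show "J.prob (E2 T (mg T b)) \<le> exp (- threshold n gn \<sigma> d T)"
        unfolding E2_def
        by (rule wrong_message_typical[OF m mg[OF b]]) (use b in \<open>auto simp: mg_def wrong_def\<close>)
    qed
    also have "\<dots> \<le> card (Pi\<^sub>E T ?A) * exp (- threshold n gn \<sigma> d T)"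
      using card_mono[OF fin, of "wrong T" T] by (simp add: wrong_def)
    also have "real (card (Pi\<^sub>E T ?A)) = (\<Prod>i\<in>T. real (card (?A i)))"
      by (simp add: card_PiE)
    finally show ?thesis by simp
  qed
  have "J.prob {\<omega> \<in> space ?J. decoding_fails n gn \<sigma> d R (gaussian_code \<sigma> (fst \<omega>)) m (rec m \<omega>)}
      \<le> J.prob (\<Union>T\<in>active_sets R. E1 T \<union> (\<Union>b\<in>wrong T. E2 T (mg T b)))"
    by (rule J.finite_measure_mono[OF sub]) (intro sets.finite_UN sets.Un E1 E2U finite_active_sets)
  also have "\<dots> \<le> (\<Sum>T\<in>active_sets R. J.prob (E1 T \<union> (\<Union>b\<in>wrong T. E2 T (mg T b))))"
    by (rule measure_UNION_le) (intro sets.Un E1 E2U finite_active_sets)+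
  also have "\<dots> \<le> (\<Sum>T\<in>active_sets R. 4 / (n * d\<^sup>2) + (\<Prod>i\<in>T. real (card (?A i))) * exp (- threshold n gn \<sigma> d T))"
    by (intro sum_mono one)
  finally show ?thesis .
qed

text \<open>The power constraint averages over messages, so only the total energy of a codebook
  matters. It is a chi-square sum with one term per letter of the codebook; the bound keeps only the
  factor \<open>n\<close> of the number of letters.\<close>

lemma codebook_power_prob:
  fixes i :: 4
  defines "E \<equiv> {\<omega> \<in> space (joint_measure n R).
      (1 + d) * (n * card (messages n (R $ i))) \<le> (\<Sum>k\<in>messages n (R $ i). \<Sum>t<n. (fst \<omega> ((i, k), t))\<^sup>2)}"
  shows "E \<in> sets (joint_measure n R)" "J.prob E \<le> 2 / (d\<^sup>2 * n)"
proof -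
  let ?J = "joint_measure n R" and ?I = "messages n (R $ i) \<times> {..<n}"
  let ?X = "\<lambda>(k, t). coordinate_var (Inl (i, k), t)"
  have s: "(Inl (i, k), t) \<in> sources n R \<times> {..<n}" if "(k, t) \<in> ?I" for k t
    using that by (auto simp: sources_def)
  have eq: "(\<Sum>k\<in>messages n (R $ i). \<Sum>t<n. (fst \<omega> ((i, k), t))\<^sup>2) = (\<Sum>p\<in>?I. (?X p \<omega>)\<^sup>2)" for \<omega> :: "((4 \<times> nat) \<times> nat \<Rightarrow> real) \<times> (2 \<Rightarrow> nat \<Rightarrow> real)"
    by (cases \<omega>) (simp add: sum.cartesian_product case_prod_unfold)
  have meas: "(\<lambda>\<omega>. \<Sum>p\<in>?I. (?X p \<omega>)\<^sup>2) \<in> borel_measurable ?J"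
    using s by (intro borel_measurable_sum borel_measurable_power) (auto intro!: measurable_coordinate_var)
  show E: "E \<in> sets ?J"
    unfolding E_def eq by (intro borel_measurable_le borel_measurable_const meas)
  have c: "card ?I = n * card (messages n (R $ i))" by (simp add: card_cartesian_product)
  let ?C = "{\<omega> \<in> space ?J. d * card ?I \<le> \<bar>(\<Sum>p\<in>?I. (?X p \<omega>)\<^sup>2) - card ?I\<bar>}"
  have "J.prob E \<le> J.prob ?C"
  proof (rule J.finite_measure_mono)
    show "?C \<in> J.events"
      by (intro borel_measurable_le borel_measurable_abs borel_measurable_diff borel_measurable_const meas)
    show "E \<subseteq> ?C"
      unfolding E_def eq c by (auto simp: distrib_right)
  qed
  also have "\<dots> \<le> 2 / (d\<^sup>2 * card ?I)"
  proof (rule J.chi_square_concentration)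
    show "J.indep_vars (\<lambda>_. borel) ?X ?I"
      by (rule J.indep_vars_block_functions[OF indep_coordinate_vars[OF n], of _ "\<lambda>(k, t). {(Inl (i, k), t)}" "\<lambda>(k, t) f. f (Inl (i, k), t)"])
        (use s in \<open>auto simp: disjoint_family_on_def\<close>)
    show "distributed ?J lborel (?X p) std_normal_density" if "p \<in> ?I" for p
      using that s distributed_coordinate_var by (cases p) auto
    have "0 \<in> {..<n}" using n by simp
    then show "?I \<noteq> {}" using messages_nonempty by blast
  qed (use d in auto)
  also have "\<dots> \<le> 2 / (d\<^sup>2 * n)"
  proof (rule divide_left_mono)
    have "1 \<le> card (messages n (R $ i))" using card_messages_pos[of n "R $ i"] by linarith
    then have "n * 1 \<le> card ?I" unfolding c by (rule mult_le_mono2)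
    then show "d\<^sup>2 * n \<le> d\<^sup>2 * card ?I" by (intro mult_left_mono) (simp_all only: mult_1_right of_nat_le_iff zero_le_power2)
    show "0 < d\<^sup>2 * real (card ?I) * (d\<^sup>2 * real n)" using n d c by simp
  qed simp
  finally show "J.prob E \<le> 2 / (d\<^sup>2 * n)" .
qed

end

text \<open>A decoding failure for the pair (m, j) gets weight 1/|messages|, so that these terms
  form the average error, and a power violation gets weight 1. The term 8 / (d^2 n) is the
  contribution 2 / (d^2 n) of each of the four users.\<close>

lemma exists_codebook:
  fixes d b :: real and \<sigma> :: "4 \<Rightarrow> real"
  assumes n: "1 \<le> n" and d: "0 < d" and R: "\<And>i. 0 \<le> R $ i" and b: "b \<le> 1"
    and less: "(\<Sum>j\<in>UNIV. \<Sum>T\<in>active_sets R. 4 / (n * d\<^sup>2) + (\<Prod>i\<in>T. real (card (messages n (R $ i))))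
        * exp (- threshold n (\<lambda>i. gain h1 h2 i j) \<sigma> d T)) + 8 / (d\<^sup>2 * n) < b"
  shows "\<exists>f. (\<forall>i. (\<Sum>k\<in>messages n (R $ i). \<Sum>t<n. (f i k t)\<^sup>2) \<le> (\<sigma> i)\<^sup>2 * ((1 + d) * (n * card (messages n (R $ i))))) \<and>
    (\<Sum>m\<in>message_tuples n R. \<Sum>j\<in>UNIV. measure (noise_measure n) {z \<in> space (noise_measure n).
      decoding_fails n (\<lambda>i. gain h1 h2 i j) \<sigma> d R f m (received h1 h2 n (\<lambda>i. f i (m i)) z j)}) / card (message_tuples n R) < b"
proof -
  let ?M = "message_tuples n R" and ?J = "joint_measure n R" and ?C = "codebook_measure n R" and ?N = "noise_measure n"
  interpret J: prob_space ?J by (rule prob_space_joint_measure)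
  interpret N: prob_space ?N by (rule prob_space_noise_measure)
  let ?g = "\<lambda>j i. gain h1 h2 i j"
  define F where "F m j = {\<omega> \<in> space ?J. decoding_fails n (?g j) \<sigma> d R (gaussian_code \<sigma> (fst \<omega>)) m
      (received h1 h2 n (\<lambda>i. gaussian_code \<sigma> (fst \<omega>) i (m i)) (snd \<omega>) j)}" for m j
  define E where "E i = {\<omega> \<in> space ?J. (1 + d) * (n * card (messages n (R $ i))) \<le>
      (\<Sum>k\<in>messages n (R $ i). \<Sum>t<n. (fst \<omega> ((i, k), t) :: real)\<^sup>2)}" for i
  let ?c = "case_sum (\<lambda>(m, j). 1 / real (card ?M)) (\<lambda>_. 1)" and ?S = "case_sum (\<lambda>(m, j). F m j) E"
  let ?B = "\<lambda>j. \<Sum>T\<in>active_sets R. 4 / (n * d\<^sup>2) + (\<Prod>i\<in>T. real (card (messages n (R $ i)))) * exp (- threshold n (?g j) \<sigma> d T)"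
  have split: "(\<Sum>a\<in>(?M \<times> UNIV) <+> UNIV. ?c a * measure L (H (?S a)))
      = (\<Sum>m\<in>?M. \<Sum>j\<in>UNIV. measure L (H (F m j))) / card ?M + (\<Sum>i\<in>UNIV. measure L (H (E i)))"
    for L :: "'x measure" and H
    by (subst sum.Plus) (auto simp: sum.cartesian_product case_prod_unfold sum_divide_distrib)
  have "\<exists>w\<in>space ?C. (\<Sum>a\<in>(?M \<times> UNIV) <+> UNIV. ?c a * measure ?N (Pair w -` ?S a)) < b"
  proof (rule exists_section_less[OF prob_space_codebook_measure prob_space_noise_measure])
    show "?S a \<in> sets (?C \<Otimes>\<^sub>M ?N)" if "a \<in> (?M \<times> UNIV) <+> UNIV" for a
      unfolding joint_measure_def[symmetric] using that
    proof (rule PlusE)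
      fix p assume "p \<in> ?M \<times> (UNIV :: 2 set)" "a = Inl p"
      moreover have "F m j \<in> sets ?J" if "m \<in> ?M" for m j
        unfolding F_def by (intro decoding_fails_event measurable_gaussian_code measurable_received_joint that)
      ultimately show "?S a \<in> sets ?J" by (cases p) simp
    next
      fix i assume "a = Inr i"
      then show "?S a \<in> sets ?J" using codebook_power_prob(1)[OF n d] by (simp add: E_def)
    qed
    have "(\<Sum>m\<in>?M. \<Sum>j\<in>UNIV. J.prob (F m j)) \<le> (\<Sum>m\<in>?M. \<Sum>j\<in>UNIV. ?B j)"
      unfolding F_def by (intro sum_mono decoding_fails_prob[OF n d _ R])
    then have "(\<Sum>m\<in>?M. \<Sum>j\<in>UNIV. J.prob (F m j)) / card ?M \<le> (\<Sum>j\<in>UNIV. ?B j)"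
      by (simp add: divide_le_eq mult.commute)
    moreover have "(\<Sum>i\<in>UNIV. J.prob (E i)) \<le> (\<Sum>i\<in>(UNIV :: 4 set). 2 / (d\<^sup>2 * n))"
      unfolding E_def by (intro sum_mono codebook_power_prob(2)[OF n d])
    ultimately show "(\<Sum>a\<in>(?M \<times> UNIV) <+> UNIV. ?c a * measure (?C \<Otimes>\<^sub>M ?N) (?S a)) < b"
      using less split[of ?J "\<lambda>S. S"] by (simp add: joint_measure_def)
  qed (auto split: sum.splits)
  then obtain w where w: "w \<in> space ?C"
    and wb: "(\<Sum>m\<in>?M. \<Sum>j\<in>UNIV. N.prob (Pair w -` F m j)) / card ?M + (\<Sum>i\<in>UNIV. N.prob (Pair w -` E i)) < b"
    unfolding split[of ?N "\<lambda>S. Pair w -` S" for w] by blast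
  have sp: "(w, z) \<in> space ?J \<longleftrightarrow> z \<in> space ?N" for z
    using w by (simp add: joint_measure_def space_pair_measure)
  let ?f = "gaussian_code \<sigma> w"
  \<comment> \<open>The power event does not involve the noise, so a violation would make its
    section the whole space and contribute 1, contradicting a total below \<open>b\<close>, which is
    at most 1.\<close>
  have pw: "(\<Sum>k\<in>messages n (R $ i). \<Sum>t<n. (w ((i, k), t))\<^sup>2) < (1 + d) * (n * card (messages n (R $ i)))" for i
  proof (rule ccontr)
    assume "\<not> ?thesis"
    then have "Pair w -` E i = space ?N" by (auto simp: E_def sp)
    then have "1 = N.prob (Pair w -` E i)" by (simp add: N.prob_space)
    also have "\<dots> \<le> (\<Sum>i\<in>UNIV. N.prob (Pair w -` E i))" by (rule member_le_sum) auto
    finally have "1 \<le> (\<Sum>m\<in>?M. \<Sum>j\<in>UNIV. N.prob (Pair w -` F m j)) / card ?M + (\<Sum>i\<in>UNIV. N.prob (Pair w -` E i))"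
      by (simp add: sum_nonneg add_increasing)
    with wb b show False by simp
  qed
  show ?thesis
  proof (intro exI[of _ ?f] conjI allI)
    fix i
    have "(\<Sum>k\<in>messages n (R $ i). \<Sum>t<n. (?f i k t)\<^sup>2) = (\<sigma> i)\<^sup>2 * (\<Sum>k\<in>messages n (R $ i). \<Sum>t<n. (w ((i, k), t))\<^sup>2)"
      by (simp add: gaussian_code_def power_mult_distrib sum_distrib_left)
    also have "\<dots> \<le> (\<sigma> i)\<^sup>2 * ((1 + d) * (n * card (messages n (R $ i))))"
      using pw[of i] by (intro mult_left_mono) auto
    finally show "(\<Sum>k\<in>messages n (R $ i). \<Sum>t<n. (?f i k t)\<^sup>2) \<le> (\<sigma> i)\<^sup>2 * ((1 + d) * (n * card (messages n (R $ i))))" .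
  next
    have "{z \<in> space ?N. decoding_fails n (?g j) \<sigma> d R ?f m (received h1 h2 n (\<lambda>i. ?f i (m i)) z j)} = Pair w -` F m j" for m j
      by (auto simp: F_def sp)
    moreover have "0 \<le> (\<Sum>i\<in>UNIV. N.prob (Pair w -` E i))" by (simp add: sum_nonneg)
    ultimately show "(\<Sum>m\<in>?M. \<Sum>j\<in>UNIV. measure ?N {z \<in> space ?N.
      decoding_fails n (?g j) \<sigma> d R ?f m (received h1 h2 n (\<lambda>i. ?f i (m i)) z j)}) / card ?M < b"
      using wb by simp
  qed
qed

section \<open>Achievability and the capacity region\<close>

text \<open>Each receiver outputs the components of the only tuple for which decoding succeeds. An
  error of any user implies failure at its receiver, so a union over the two receivers bounds the
  error probability.\<close>

lemma exists_decoder: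
  fixes f :: "4 \<Rightarrow> nat \<Rightarrow> nat \<Rightarrow> real" and \<sigma> :: "4 \<Rightarrow> real" and d :: real
  shows "\<exists>g. (\<forall>i. g i \<in> measurable (Pi\<^sub>M {..<n} (\<lambda>_. borel)) (count_space (messages n (R $ i)))) \<and>
    error_prob h1 h2 n R f g \<le> (\<Sum>m\<in>message_tuples n R. \<Sum>j\<in>UNIV. measure (noise_measure n) {z \<in> space (noise_measure n).
      decoding_fails n (\<lambda>i. gain h1 h2 i j) \<sigma> d R f m (received h1 h2 n (\<lambda>i. f i (m i)) z j)}) / card (message_tuples n R)"
proof -
  let ?M = "message_tuples n R" and ?N = "noise_measure n" and ?Y = "Pi\<^sub>M {..<n} (\<lambda>_. borel :: real measure)"
  interpret N: prob_space ?N by (rule prob_space_noise_measure)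
  define c where "c j m y \<longleftrightarrow> compatible n (\<lambda>i. gain h1 h2 i j) \<sigma> d R (\<lambda>i. f i (m i)) y" for j m y
  define u where "u j m y \<longleftrightarrow> \<not> decoding_fails n (\<lambda>i. gain h1 h2 i j) \<sigma> d R f m y" for j m y
  \<comment> \<open>Where no tuple succeeds the output is constantly 1, which belongs to every
    message set, so the decoders always stay within range.\<close>
  define dec where "dec j y = (if \<exists>m\<in>?M. u j m y then THE m. m \<in> ?M \<and> u j m y else (\<lambda>_. 1))" for j y
  define g where "g i y = dec (receiver_of i) y i" for i y
  have uniq: "m = m'" if "m \<in> ?M" "m' \<in> ?M" "u j m y" "u j m' y" for j m m' y
    using that by (auto simp: u_def decoding_fails_def)
  have dec_eq: "dec j y = m" if "m \<in> ?M" "u j m y" for j m y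
    unfolding dec_def using that uniq by (auto intro!: the_equality)
  have one: "1 \<in> messages n r" for r
    using messages_nonempty[of n r] by (simp add: messages_def)
  have comp: "(\<lambda>y. y t) \<in> borel_measurable ?Y" if "t < n" for t
    using that measurable_component_singleton[of t "{..<n}" "\<lambda>_. borel"] by simp
  have U: "{y \<in> space ?Y. u j m y} \<in> sets ?Y" if "m \<in> ?M" for j m
    unfolding u_def by (intro sets.sets_Collect_neg decoding_fails_event comp that) auto
  have g: "g i \<in> measurable ?Y (count_space (messages n (R $ i)))" for i
    unfolding measurable_count_space_eq2[OF finite_messages]
  proof (intro conjI Pi_I ballI)
    fix y
    show "g i y \<in> messages n (R $ i)"
    proof (cases "\<exists>m\<in>?M. u (receiver_of i) m y")
      case True
      then show ?thesis using dec_eq message_tuples_component by (auto simp: g_def)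
    next
      case False
      then show ?thesis using one by (simp add: g_def dec_def)
    qed
  next
    fix k assume "k \<in> messages n (R $ i)"
    let ?j = "receiver_of i"
    \<comment> \<open>A value is output exactly where a tuple with this component succeeds; the
      value 1 is also output where no tuple succeeds. Both parts are built from finitely many
      measurable success sets.\<close>
    have "g i -` {k} \<inter> space ?Y = (\<Union>m\<in>{m \<in> ?M. m i = k}. {y \<in> space ?Y. u ?j m y}) \<union>
      (if k = 1 then {y \<in> space ?Y. \<forall>m\<in>?M. \<not> u ?j m y} else {})" (is "?L = ?R")
    proof (rule set_eqI)
      fix y
      show "y \<in> ?L \<longleftrightarrow> y \<in> ?R"
      proof (cases "\<exists>m\<in>?M. u ?j m y")
        case True
        then obtain m where m: "m \<in> ?M" "u ?j m y" by blast
        then have "g i y = m i" by (simp add: g_def dec_eq)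
        then show ?thesis using m uniq by auto
      next
        case False
        then have "g i y = 1" by (simp add: g_def dec_def)
        then show ?thesis using False by auto
      qed
    qed
    also have "\<dots> \<in> sets ?Y"
    proof (intro sets.Un sets.finite_UN)
      show "(if k = 1 then {y \<in> space ?Y. \<forall>m\<in>?M. \<not> u ?j m y} else {}) \<in> sets ?Y"
        by (simp, intro impI sets.sets_Collect_finite_All sets.sets_Collect_neg U finite_message_tuples)
    qed (use U in auto)
    finally show "g i -` {k} \<inter> space ?Y \<in> sets ?Y" .
  qed
  let ?F = "\<lambda>m j. {z \<in> space ?N. decoding_fails n (\<lambda>i. gain h1 h2 i j) \<sigma> d R f m (received h1 h2 n (\<lambda>i. f i (m i)) z j)}"
  have F: "?F m j \<in> sets ?N" if "m \<in> ?M" for m j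
  proof (intro decoding_fails_event that)
    show "(\<lambda>z. received h1 h2 n (\<lambda>i. f i (m i)) z j t) \<in> borel_measurable ?N" if "t < n" for t
      by (rule measurable_compose[OF measurable_received comp[OF that]])
  qed auto
  have "error_prob h1 h2 n R f g = (\<Sum>m\<in>?M. N.prob {z \<in> space ?N.
       \<exists>i. g i (received h1 h2 n (\<lambda>k. f k (m k)) z (receiver_of i)) \<noteq> m i}) / card ?M"
    by (rule error_prob_eq[OF g])
  also have "\<dots> \<le> (\<Sum>m\<in>?M. \<Sum>j\<in>UNIV. N.prob (?F m j)) / card ?M"
  proof (intro divide_right_mono sum_mono)
    fix m assume m: "m \<in> ?M"
    have "{z \<in> space ?N. \<exists>i. g i (received h1 h2 n (\<lambda>k. f k (m k)) z (receiver_of i)) \<noteq> m i} \<subseteq> (\<Union>j\<in>UNIV. ?F m j)"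
    proof
      fix z assume "z \<in> {z \<in> space ?N. \<exists>i. g i (received h1 h2 n (\<lambda>k. f k (m k)) z (receiver_of i)) \<noteq> m i}"
      then obtain i where z: "z \<in> space ?N" and i: "g i (received h1 h2 n (\<lambda>k. f k (m k)) z (receiver_of i)) \<noteq> m i" by blast
      then have "\<not> u (receiver_of i) m (received h1 h2 n (\<lambda>k. f k (m k)) z (receiver_of i))"
        using dec_eq[OF m] by (auto simp: g_def)
      then show "z \<in> (\<Union>j\<in>UNIV. ?F m j)" using z by (auto simp: u_def)
    qed
    then have "N.prob {z \<in> space ?N. \<exists>i. g i (received h1 h2 n (\<lambda>k. f k (m k)) z (receiver_of i)) \<noteq> m i}
        \<le> N.prob (\<Union>j\<in>UNIV. ?F m j)"
      by (rule N.finite_measure_mono) (intro sets.finite_UN F m finite_class.finite_UNIV)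
    also have "\<dots> \<le> (\<Sum>j\<in>UNIV. N.prob (?F m j))"
      by (intro measure_UNION_le F m finite_class.finite_UNIV)
    finally show "N.prob {z \<in> space ?N. \<exists>i. g i (received h1 h2 n (\<lambda>k. f k (m k)) z (receiver_of i)) \<noteq> m i}
        \<le> (\<Sum>j\<in>UNIV. N.prob (?F m j))" .
  qed simp
  finally show ?thesis using g by blast
qed

section \<open>From good codebooks to achievable rates\<close>

lemma is_codeI:
  assumes n: "1 \<le> n" and g: "\<And>i. g i \<in> measurable (Pi\<^sub>M {..<n} (\<lambda>_. borel)) (count_space (messages n (R $ i)))"
    and p: "\<And>i. (\<Sum>k\<in>messages n (R $ i). \<Sum>t<n. (f i k t)\<^sup>2) \<le> tx_power P1 P2 i * (n * card (messages n (R $ i)))"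
  shows "is_code P1 P2 n R f g"
proof -
  have "(1 / real n) * (\<Sum>t<n. measure_pmf.expectation (message_pmf n (R $ i)) (\<lambda>m. (f i m t)\<^sup>2)) \<le> tx_power P1 P2 i" for i
  proof -
    have "(\<Sum>t<n. measure_pmf.expectation (message_pmf n (R $ i)) (\<lambda>m. (f i m t)\<^sup>2))
        = (\<Sum>k\<in>messages n (R $ i). \<Sum>t<n. (f i k t)\<^sup>2) / card (messages n (R $ i))"
      by (subst sum.swap) (simp add: message_pmf_def integral_pmf_of_set sum_divide_distrib)
    also have "\<dots> \<le> tx_power P1 P2 i * n"
      using p[of i] card_messages_pos[of n "R $ i"] by (simp add: pos_divide_le_eq mult.assoc)
    finally show ?thesis
      using n by (simp add: field_simps)
  qed
  with g show ?thesis by (simp add: is_code_def)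
qed

text \<open>Achievability asks for a code at every block length from 1 on; the silent code fills the
  lengths at which the random coding bound is vacuous.\<close>

lemma exists_zero_code:
  assumes "1 \<le> n" "0 \<le> P1" "0 \<le> P2"
  shows "\<exists>f g. is_code P1 P2 n R f g"
proof (intro exI)
  have "1 \<in> messages n r" for r
    using messages_nonempty[of n r] by (simp add: messages_def)
  then show "is_code P1 P2 n R (\<lambda>_ _ _. 0) (\<lambda>_ _. 1)"
    using assms by (intro is_codeI) (auto intro!: mult_nonneg_nonneg tx_power_nonneg)
qed

text \<open>Rounding costs a factor 2 per user, at most 2^4 = 16 in all.\<close>

lemma prod_messages_le:
  fixes T :: "4 set"
  assumes R: "\<And>i. 0 \<le> R $ i"
  shows "(\<Prod>i\<in>T. real (card (messages n (R $ i)))) \<le> 16 * exp (n * ((\<Sum>i\<in>T. R $ i) * ln 2))"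
proof -
  have "(\<Prod>i\<in>T. real (card (messages n (R $ i)))) \<le> (\<Prod>i\<in>T. 2 * 2 powr (real n * R $ i))"
    by (intro prod_mono) (use card_messages_le R in auto)
  also have "\<dots> = 2 ^ card T * (\<Prod>i\<in>T. exp (real n * R $ i * ln 2))"
    by (simp add: prod.distrib powr_def)
  also have "(\<Prod>i\<in>T. exp (real n * R $ i * ln 2)) = exp (n * ((\<Sum>i\<in>T. R $ i) * ln 2))"
    by (simp add: exp_sum[symmetric] sum_distrib_left sum_distrib_right mult_ac)
  also have "(2 :: real) ^ card T \<le> 2 ^ 4"
    using card_mono[of UNIV T] by (intro power_increasing) auto
  finally show ?thesis by simp
qed

text \<open>Finitely many strict inequalities, with right-hand sides continuous at d = 0, survive a
  common small \<open>d\<close>. The divisor 1 + d is the power back-off. Of the 2 d subtracted, one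
  \<open>d\<close> pays for the threshold and the other remains as error exponent.\<close>

lemma exists_rate_margin:
  assumes P: "0 \<le> P1" "0 \<le> P2"
    and strict: "\<And>j T. T \<in> active_sets R \<Longrightarrow>
      (\<Sum>i\<in>T. R $ i) * ln 2 < 1 / 2 * ln (1 + (\<Sum>i\<in>T. (gain h1 h2 i j)\<^sup>2 * tx_power P1 P2 i))"
  shows "\<exists>d>0. \<forall>j. \<forall>T\<in>active_sets R. (\<Sum>i\<in>T. R $ i) * ln 2
      < 1 / 2 * ln (1 + (\<Sum>i\<in>T. (gain h1 h2 i j)\<^sup>2 * tx_power P1 P2 i) / (1 + d)) - 2 * d"
proof -
  have "\<forall>\<^sub>F d in at_right 0. \<forall>p\<in>(UNIV :: 2 set) \<times> active_sets R. (\<Sum>i\<in>snd p. R $ i) * ln 2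
      < 1 / 2 * ln (1 + (\<Sum>i\<in>snd p. (gain h1 h2 i (fst p))\<^sup>2 * tx_power P1 P2 i) / (1 + d)) - 2 * d"
  proof (intro eventually_ball_finite ballI)
    fix p :: "2 \<times> 4 set" assume p: "p \<in> UNIV \<times> active_sets R"
    define S where "S = (\<Sum>i\<in>snd p. (gain h1 h2 i (fst p))\<^sup>2 * tx_power P1 P2 i)"
    have S: "0 \<le> S" unfolding S_def by (intro sum_nonneg mult_nonneg_nonneg tx_power_nonneg P) auto
    have "((\<lambda>d. 1 / 2 * ln (1 + S / (1 + d)) - 2 * d) \<longlongrightarrow> 1 / 2 * ln (1 + S / (1 + 0)) - 2 * 0) (at_right 0)"
      using S by (intro tendsto_intros) auto
    then show "\<forall>\<^sub>F d in at_right 0. (\<Sum>i\<in>snd p. R $ i) * ln 2 < 1 / 2 * ln (1 + S / (1 + d)) - 2 * d"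
      by (rule order_tendstoD(1)) (use strict[of "snd p" "fst p"] p in \<open>auto simp: S_def\<close>)
  qed simp
  then obtain b where "0 < b" and b: "\<And>d. 0 < d \<Longrightarrow> d < b \<Longrightarrow> \<forall>p\<in>(UNIV :: 2 set) \<times> active_sets R. (\<Sum>i\<in>snd p. R $ i) * ln 2
      < 1 / 2 * ln (1 + (\<Sum>i\<in>snd p. (gain h1 h2 i (fst p))\<^sup>2 * tx_power P1 P2 i) / (1 + d)) - 2 * d"
    unfolding eventually_at_right_field by blast
  then show ?thesis
    using b[of "b / 2"] by (intro exI[of _ "b / 2"]) auto
qed

lemma achievable_if_strict:
  assumes P: "0 \<le> P1" "0 \<le> P2" and R: "\<And>i. 0 \<le> R $ i"
    and strict: "\<And>j T. T \<in> active_sets R \<Longrightarrow>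
      (\<Sum>i\<in>T. R $ i) * ln 2 < 1 / 2 * ln (1 + (\<Sum>i\<in>T. (gain h1 h2 i j)\<^sup>2 * tx_power P1 P2 i))"
  shows "achievable P1 P2 h1 h2 R"
proof -
  obtain d where d: "0 < d" and margin: "\<And>j T. T \<in> active_sets R \<Longrightarrow> (\<Sum>i\<in>T. R $ i) * ln 2
      < 1 / 2 * ln (1 + (\<Sum>i\<in>T. (gain h1 h2 i j)\<^sup>2 * tx_power P1 P2 i) / (1 + d)) - 2 * d"
    using exists_rate_margin[OF P strict] by blast
  define \<sigma> where "\<sigma> i = sqrt (tx_power P1 P2 i / (1 + d))" for i
  have \<sigma>2: "(\<sigma> i)\<^sup>2 = tx_power P1 P2 i / (1 + d)" for i
    using d tx_power_nonneg[OF P] by (simp add: \<sigma>_def)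
  \<comment> \<open>The random coding bound with the rate margin inserted; the last summand 1/n only
    serves to make the comparison required by \<open>exists_codebook\<close> strict.\<close>
  define b where "b n = (\<Sum>j\<in>(UNIV :: 2 set). \<Sum>T\<in>active_sets R. 4 / (n * d\<^sup>2) + 16 * exp (- d) ^ n)
      + 8 / (d\<^sup>2 * n) + 1 / n" for n :: nat
  have b0: "b \<longlonglongrightarrow> 0"
  proof -
    have "b \<longlonglongrightarrow> (\<Sum>j\<in>(UNIV :: 2 set). \<Sum>T\<in>active_sets R. 0 + 16 * 0) + 0 + 0"
    proof -
      have e: "(\<lambda>n. exp (- d) ^ n) \<longlonglongrightarrow> 0"
        using d by (intro LIMSEQ_realpow_zero) auto
      have c: "(\<lambda>n. 4 / (real n * d\<^sup>2)) \<longlonglongrightarrow> 0" "(\<lambda>n. 8 / (d\<^sup>2 * real n)) \<longlonglongrightarrow> 0"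
        using lim_const_over_n[of "4 / d\<^sup>2"] lim_const_over_n[of "8 / d\<^sup>2"] by (simp_all add: mult.commute)
      show ?thesis
        unfolding b_def by (intro tendsto_intros e c lim_const_over_n)
    qed
    then show ?thesis by simp
  qed
  have code: "\<exists>f g. is_code P1 P2 n R f g \<and> (b n \<le> 1 \<longrightarrow> error_prob h1 h2 n R f g \<le> b n)" if n: "1 \<le> n" for n
  proof (cases "b n \<le> 1")
    case True
    have "(\<Sum>j\<in>UNIV. \<Sum>T\<in>active_sets R. 4 / (n * d\<^sup>2) + (\<Prod>i\<in>T. real (card (messages n (R $ i))))
        * exp (- threshold n (\<lambda>i. gain h1 h2 i j) \<sigma> d T)) \<le> (\<Sum>j\<in>(UNIV :: 2 set). \<Sum>T\<in>active_sets R. 4 / (n * d\<^sup>2) + 16 * exp (- d) ^ n)"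
    proof (intro sum_mono add_left_mono)
      fix j :: 2 and T assume T: "T \<in> active_sets R"
      let ?thr = "threshold n (\<lambda>i. gain h1 h2 i j) \<sigma> d T"
      have sv: "signal_variance (\<lambda>i. gain h1 h2 i j) \<sigma> T = 1 + (\<Sum>i\<in>T. (gain h1 h2 i j)\<^sup>2 * tx_power P1 P2 i) / (1 + d)"
        by (simp add: signal_variance_def power_mult_distrib \<sigma>2 sum_divide_distrib)
      have "(\<Sum>i\<in>T. R $ i) * ln 2 + d \<le> 1 / 2 * ln (signal_variance (\<lambda>i. gain h1 h2 i j) \<sigma> T) - d"
        using margin[OF T, of j] by (simp add: sv)
      then have "n * ((\<Sum>i\<in>T. R $ i) * ln 2 + d) \<le> ?thr"
        unfolding threshold_def by (intro mult_left_mono) auto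
      then have thr: "n * ((\<Sum>i\<in>T. R $ i) * ln 2) + - ?thr \<le> n * (- d)"
        by (simp add: algebra_simps)
      have "(\<Prod>i\<in>T. real (card (messages n (R $ i)))) * exp (- ?thr)
          \<le> 16 * exp (n * ((\<Sum>i\<in>T. R $ i) * ln 2)) * exp (- ?thr)"
        by (intro mult_right_mono prod_messages_le R) auto
      also have "\<dots> = 16 * exp (n * ((\<Sum>i\<in>T. R $ i) * ln 2) + - ?thr)"
        by (simp only: exp_add mult.assoc)
      also have "\<dots> \<le> 16 * exp (n * (- d))"
        using thr by simp
      also have "exp (n * (- d)) = exp (- d) ^ n"
        by (rule exp_of_nat_mult)
      finally show "(\<Prod>i\<in>T. real (card (messages n (R $ i)))) * exp (- ?thr) \<le> 16 * exp (- d) ^ n" .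
    qed
    moreover have "0 < 1 / real n" using n by simp
    ultimately have less: "(\<Sum>j\<in>UNIV. \<Sum>T\<in>active_sets R. 4 / (n * d\<^sup>2) + (\<Prod>i\<in>T. real (card (messages n (R $ i))))
        * exp (- threshold n (\<lambda>i. gain h1 h2 i j) \<sigma> d T)) + 8 / (d\<^sup>2 * n) < b n"
      unfolding b_def by linarith
    obtain f where f: "\<And>i. (\<Sum>k\<in>messages n (R $ i). \<Sum>t<n. (f i k t)\<^sup>2) \<le> (\<sigma> i)\<^sup>2 * ((1 + d) * (n * card (messages n (R $ i))))"
      and err: "(\<Sum>m\<in>message_tuples n R. \<Sum>j\<in>UNIV. measure (noise_measure n) {z \<in> space (noise_measure n).
      decoding_fails n (\<lambda>i. gain h1 h2 i j) \<sigma> d R f m (received h1 h2 n (\<lambda>i. f i (m i)) z j)}) / card (message_tuples n R) < b n"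
      using exists_codebook[OF n d R True less] by blast
    obtain g where g: "\<And>i. g i \<in> measurable (Pi\<^sub>M {..<n} (\<lambda>_. borel)) (count_space (messages n (R $ i)))"
      and g_err: "error_prob h1 h2 n R f g \<le> b n"
      using exists_decoder[of n R h1 h2 f \<sigma> d] err by (blast intro: order_trans less_imp_le)
    have "(\<sigma> i)\<^sup>2 * ((1 + d) * (n * card (messages n (R $ i)))) = tx_power P1 P2 i * (n * card (messages n (R $ i)))" for i
      using d by (simp add: \<sigma>2)
    then have "is_code P1 P2 n R f g"
      using f g by (intro is_codeI n) (simp_all only:)
    with g_err show ?thesis by blast
  next
    case False
    then show ?thesis using exists_zero_code[OF n P] by blast
  qed
  then obtain f g where fg: "\<And>n. 1 \<le> n \<Longrightarrow> is_code P1 P2 n R (f n) (g n)"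
    and e: "\<And>n. 1 \<le> n \<Longrightarrow> b n \<le> 1 \<Longrightarrow> error_prob h1 h2 n R (f n) (g n) \<le> b n"
    by metis
  have "(\<lambda>n. error_prob h1 h2 n R (f n) (g n)) \<longlonglongrightarrow> 0"
  proof (rule tendsto_sandwich[OF _ _ tendsto_const b0])
    have "\<forall>\<^sub>F n in sequentially. b n < 1"
      using b0 by (rule order_tendstoD(2)) simp
    then show "\<forall>\<^sub>F n in sequentially. error_prob h1 h2 n R (f n) (g n) \<le> b n"
      using eventually_ge_at_top[of 1] by eventually_elim (auto intro: e)
  qed (simp add: error_prob_def)
  with fg R show ?thesis
    unfolding achievable_def by blast
qed


section \<open>The region of interference-free constraints\<close>

definition private_region :: "real \<Rightarrow> real \<Rightarrow> (real ^ 4) set" where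
  "private_region P1 P2 = {R. (\<forall>i. 0 \<le> R $ i) \<and> (\<forall>j. \<forall>T\<subseteq>{i. receiver_of i = j}.
    (\<Sum>i\<in>T. R $ i) \<le> 1 / 2 * log 2 (1 + (\<Sum>i\<in>T. tx_power P1 P2 i)))}"

lemma closed_private_region: "closed (private_region P1 P2)"
proof -
  have "private_region P1 P2 = (\<Inter>i. {R. 0 \<le> R $ i}) \<inter> (\<Inter>j. \<Inter>T\<in>{T. T \<subseteq> {i. receiver_of i = j}}.
      {R. (\<Sum>i\<in>T. R $ i) \<le> 1 / 2 * log 2 (1 + (\<Sum>i\<in>T. tx_power P1 P2 i))})"
    by (auto simp: private_region_def)
  also have "closed \<dots>"
    by (intro closed_Int closed_INT ballI closed_Collect_le continuous_intros)
  finally show ?thesis .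
qed

text \<open>Where the interference conditions enter: with \<open>A\<close> the users of \<open>T\<close> belonging to receiver \<open>j\<close> and \<open>B\<close> the others,
  \<open>(1 + P\<^sub>A) (1 + P\<^sub>B) \<le> 1 + P\<^sub>A + (1 + P1 + P2) P\<^sub>B\<close>.\<close>

lemma product_le_received_power:
  assumes P: "0 \<le> P1" "0 \<le> P2" and h: "1 + P1 + P2 \<le> h1\<^sup>2" "1 + P1 + P2 \<le> h2\<^sup>2"
  shows "(1 + (\<Sum>i\<in>T \<inter> {i. receiver_of i = j}. tx_power P1 P2 i)) * (1 + (\<Sum>i\<in>T - {i. receiver_of i = j}. tx_power P1 P2 i))
    \<le> 1 + (\<Sum>i\<in>T. (gain h1 h2 i j)\<^sup>2 * tx_power P1 P2 i)"
proof -
  let ?U = "{i. receiver_of i = j}" and ?p = "tx_power P1 P2"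
  have "(\<Sum>i\<in>T \<inter> ?U. ?p i) \<le> (\<Sum>i\<in>?U. ?p i)"
    by (intro sum_mono2) (auto intro: tx_power_nonneg P)
  also have "\<dots> = (\<Sum>i\<in>UNIV. if receiver_of i = j then ?p i else 0)"
    by (simp add: sum.inter_filter[symmetric])
  \<comment> \<open>Each receiver owns exactly one user of power \<open>P1\<close> and one of power
    \<open>P2\<close>.\<close>
  also have "\<dots> = P1 + P2"
    using exhaust_2[of j] by (auto simp: sum_4 receiver_of_def tx_power_def)
  finally have A: "(\<Sum>i\<in>T \<inter> ?U. ?p i) \<le> P1 + P2" .
  have B0: "0 \<le> (\<Sum>i\<in>T - ?U. ?p i)"
    by (intro sum_nonneg tx_power_nonneg P)
  have "(\<Sum>i\<in>T. (gain h1 h2 i j)\<^sup>2 * ?p i) = (\<Sum>i\<in>T \<inter> ?U. (gain h1 h2 i j)\<^sup>2 * ?p i) + (\<Sum>i\<in>T - ?U. (gain h1 h2 i j)\<^sup>2 * ?p i)"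
    by (subst sum.union_disjoint[symmetric]) (auto intro!: sum.cong)
  also have "(\<Sum>i\<in>T \<inter> ?U. (gain h1 h2 i j)\<^sup>2 * ?p i) = (\<Sum>i\<in>T \<inter> ?U. ?p i)"
    by (intro sum.cong) (auto simp: gain_def)
  finally have eq: "(\<Sum>i\<in>T. (gain h1 h2 i j)\<^sup>2 * ?p i) = (\<Sum>i\<in>T \<inter> ?U. ?p i) + (\<Sum>i\<in>T - ?U. (gain h1 h2 i j)\<^sup>2 * ?p i)" .
  have "(1 + P1 + P2) * (\<Sum>i\<in>T - ?U. ?p i) \<le> (\<Sum>i\<in>T - ?U. (gain h1 h2 i j)\<^sup>2 * ?p i)"
    unfolding sum_distrib_left
    by (intro sum_mono mult_right_mono tx_power_nonneg P) (use h in \<open>auto simp: gain_def\<close>)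
  moreover have "(\<Sum>i\<in>T \<inter> ?U. ?p i) * (\<Sum>i\<in>T - ?U. ?p i) \<le> (P1 + P2) * (\<Sum>i\<in>T - ?U. ?p i)"
    by (intro mult_right_mono A B0)
  ultimately show ?thesis
    unfolding eq by (simp add: algebra_simps)
qed

text \<open>Scaling by c < 1 strictly lowers any positive sum of rates. An active \<open>T\<close>
  splits into users of the two receivers; the sum of the two constraints is strict as soon as one
  part is nonempty, and the logarithms combine by \<open>product_le_received_power\<close>.\<close>

lemma scaled_achievable:
  assumes P: "0 \<le> P1" "0 \<le> P2" and h: "1 + P1 + P2 \<le> h1\<^sup>2" "1 + P1 + P2 \<le> h2\<^sup>2"
    and R: "R \<in> private_region P1 P2" and c: "0 < c" "c < 1"
  shows "achievable P1 P2 h1 h2 (c *\<^sub>R R)"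
proof (rule achievable_if_strict[OF P])
  show "0 \<le> (c *\<^sub>R R) $ i" for i using R c by (simp add: private_region_def)
  let ?p = "tx_power P1 P2"
  \<comment> \<open>The weak form also covers an empty part, where both sides are 0; the strict form
    needs a user of positive rate.\<close>
  have one_side: "(\<Sum>i\<in>A. (c *\<^sub>R R) $ i) * ln 2 \<le> 1 / 2 * ln (1 + (\<Sum>i\<in>A. ?p i))"
    "A \<noteq> {} \<Longrightarrow> (\<Sum>i\<in>A. (c *\<^sub>R R) $ i) * ln 2 < 1 / 2 * ln (1 + (\<Sum>i\<in>A. ?p i))"
    if A: "A \<subseteq> {i. receiver_of i = j}" and pos: "\<And>i. i \<in> A \<Longrightarrow> 0 < (c *\<^sub>R R) $ i" for A j
  proof -
    have bound: "(\<Sum>i\<in>A. R $ i) * ln 2 \<le> 1 / 2 * ln (1 + (\<Sum>i\<in>A. ?p i))"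
      using R A by (auto simp: private_region_def log_def field_simps)
    show strict: "(\<Sum>i\<in>A. (c *\<^sub>R R) $ i) * ln 2 < 1 / 2 * ln (1 + (\<Sum>i\<in>A. ?p i))" if "A \<noteq> {}"
    proof -
      have "0 < (\<Sum>i\<in>A. R $ i)"
        using that pos c by (intro sum_pos) (auto simp: zero_less_mult_iff)
      then have "c * (\<Sum>i\<in>A. R $ i) < (\<Sum>i\<in>A. R $ i)" using c by simp
      then have "(\<Sum>i\<in>A. (c *\<^sub>R R) $ i) < (\<Sum>i\<in>A. R $ i)" by (simp add: sum_distrib_left)
      then have "(\<Sum>i\<in>A. (c *\<^sub>R R) $ i) * ln 2 < (\<Sum>i\<in>A. R $ i) * ln 2" by simp
      with bound show ?thesis by linarith
    qed
    show "(\<Sum>i\<in>A. (c *\<^sub>R R) $ i) * ln 2 \<le> 1 / 2 * ln (1 + (\<Sum>i\<in>A. ?p i))"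
      using strict by (cases "A = {}") auto
  qed
  fix j T assume T: "T \<in> active_sets (c *\<^sub>R R)"
  let ?U = "{i. receiver_of i = j}"
  have pos: "0 < (c *\<^sub>R R) $ i" if "i \<in> T" for i using T that by (simp add: active_sets_def)
  obtain j' where j': "T - ?U \<subseteq> {i. receiver_of i = j'}"
  proof (cases "j = 1")
    case True
    then have "T - ?U \<subseteq> {i. receiver_of i = 2}" by (auto simp: receiver_of_def)
    then show thesis by (rule that)
  next
    case False
    then have "T - ?U \<subseteq> {i. receiver_of i = 1}" using exhaust_2[of j] by (auto simp: receiver_of_def)
    then show thesis by (rule that)
  qed
  note a = one_side[of "T \<inter> ?U" j] and b = one_side[OF j']
  have "(\<Sum>i\<in>T. (c *\<^sub>R R) $ i) = (\<Sum>i\<in>T \<inter> ?U. (c *\<^sub>R R) $ i) + (\<Sum>i\<in>T - ?U. (c *\<^sub>R R) $ i)"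
    by (subst sum.union_disjoint[symmetric]) (auto intro!: sum.cong)
  then have "(\<Sum>i\<in>T. (c *\<^sub>R R) $ i) * ln 2 < 1 / 2 * ln (1 + (\<Sum>i\<in>T \<inter> ?U. ?p i)) + 1 / 2 * ln (1 + (\<Sum>i\<in>T - ?U. ?p i))"
  proof -
    have "T \<inter> ?U \<noteq> {} \<or> T - ?U \<noteq> {}" using T by (auto simp: active_sets_def)
    then have "(\<Sum>i\<in>T \<inter> ?U. (c *\<^sub>R R) $ i) * ln 2 + (\<Sum>i\<in>T - ?U. (c *\<^sub>R R) $ i) * ln 2
        < 1 / 2 * ln (1 + (\<Sum>i\<in>T \<inter> ?U. ?p i)) + 1 / 2 * ln (1 + (\<Sum>i\<in>T - ?U. ?p i))"
      using a b pos by (elim disjE) (intro add_less_le_mono add_le_less_mono; auto)+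
    then show ?thesis
      unfolding \<open>(\<Sum>i\<in>T. (c *\<^sub>R R) $ i) = _\<close> distrib_right .
  qed
  also have "\<dots> = 1 / 2 * ln ((1 + (\<Sum>i\<in>T \<inter> ?U. ?p i)) * (1 + (\<Sum>i\<in>T - ?U. ?p i)))"
    by (subst ln_mult_pos) (auto intro!: add_pos_nonneg sum_nonneg tx_power_nonneg P)
  also have "\<dots> \<le> 1 / 2 * ln (1 + (\<Sum>i\<in>T. (gain h1 h2 i j)\<^sup>2 * ?p i))"
    by (intro mult_left_mono ln_mono product_le_received_power[OF P h] mult_pos_pos)
      (auto intro!: add_pos_nonneg sum_nonneg tx_power_nonneg P)
  finally show "(\<Sum>i\<in>T. (c *\<^sub>R R) $ i) * ln 2 < 1 / 2 * ln (1 + (\<Sum>i\<in>T. (gain h1 h2 i j)\<^sup>2 * ?p i))" .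
qed

lemma capacity_region_eq_private_region:
  assumes P: "0 \<le> P1" "0 \<le> P2" and h: "1 + P1 + P2 \<le> h1\<^sup>2" "1 + P1 + P2 \<le> h2\<^sup>2"
  shows "capacity_region P1 P2 h1 h2 = private_region P1 P2"
proof
  have "R \<in> private_region P1 P2" if "achievable P1 P2 h1 h2 R" for R
    using achievable_imp_region[OF P that] that by (auto simp: private_region_def achievable_def subset_eq)
  then show "capacity_region P1 P2 h1 h2 \<subseteq> private_region P1 P2"
    unfolding capacity_region_def by (intro closure_minimal closed_private_region) auto
  show "private_region P1 P2 \<subseteq> capacity_region P1 P2 h1 h2"
  proof
    fix R assume R: "R \<in> private_region P1 P2"
    \<comment> \<open>The offset 2 keeps the factor strictly between 0 and 1 already for k =
      0.\<close>
    let ?r = "\<lambda>k. (1 - 1 / real (k + 2)) *\<^sub>R R"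
    have "(\<lambda>k. 1 / real (k + 2)) \<longlonglongrightarrow> 0"
      using LIMSEQ_ignore_initial_segment[OF lim_1_over_n, of 2] by simp
    then have "?r \<longlonglongrightarrow> (1 - 0) *\<^sub>R R" by (intro tendsto_intros)
    moreover have "achievable P1 P2 h1 h2 (?r k)" for k
      by (rule scaled_achievable[OF P h R]) auto
    ultimately show "R \<in> capacity_region P1 P2 h1 h2"
      unfolding capacity_region_def closure_sequential by (intro exI[of _ ?r]) auto
  qed
qed

text \<open>Own users have gain 1 and the noise variance is 1, so the constraints coincide. This
  connects the description that is uniform in the receiver with the two separate regions of the
  theorem.\<close>

lemma mac_region_own_receiver:
  assumes S: "S = {i. receiver_of i = j}" and R: "\<And>i. 0 \<le> R $ i"
  shows "(\<lambda>i\<in>S. R $ i) \<in> mac_region P1 P2 h1 h2 S j 1 \<longleftrightarrow>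
    (\<forall>T\<subseteq>S. (\<Sum>i\<in>T. R $ i) \<le> 1 / 2 * log 2 (1 + (\<Sum>i\<in>T. tx_power P1 P2 i)))"
proof -
  have "(\<Sum>i\<in>T. (\<lambda>i\<in>S. R $ i) i) = (\<Sum>i\<in>T. R $ i)"
    "(\<Sum>i\<in>T. (gain h1 h2 i j)\<^sup>2 * tx_power P1 P2 i / 1) = (\<Sum>i\<in>T. tx_power P1 P2 i)" if "T \<subseteq> S" for T
    using that S by (auto intro!: sum.cong simp: gain_def)
  then show ?thesis
    using R unfolding mac_region_def by auto
qed

theorem theorem2:
  fixes P1 P2 h1 h2 :: real
  assumes "0 \<le> P1" and "0 \<le> P2"
    and "1 + P1 + P2 \<le> h1\<^sup>2" and "1 + P1 + P2 \<le> h2\<^sup>2"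
  shows "capacity_region P1 P2 h1 h2 =
    {R. (\<forall>i. 0 \<le> R $ i) \<and>
        (\<lambda>i\<in>{1, 2}. R $ i) \<in> mac_region P1 P2 h1 h2 {1, 2} 1 1 \<and>
        (\<lambda>i\<in>{3, 4}. R $ i) \<in> mac_region P1 P2 h1 h2 {3, 4} 2 1}"
proof -
  have own: "{1, 2} = {i. receiver_of i = 1}" "{3, 4} = {i. receiver_of i = 2}"
    by (auto simp: receiver_of_def set_eq_iff forall_4)
  have "capacity_region P1 P2 h1 h2 = private_region P1 P2"
    by (rule capacity_region_eq_private_region[OF assms])
  also have "\<dots> = {R. (\<forall>i. 0 \<le> R $ i) \<and>
        (\<lambda>i\<in>{1, 2}. R $ i) \<in> mac_region P1 P2 h1 h2 {1, 2} 1 1 \<and>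
        (\<lambda>i\<in>{3, 4}. R $ i) \<in> mac_region P1 P2 h1 h2 {3, 4} 2 1}"
    unfolding private_region_def forall_2
    by (intro Collect_cong conj_cong refl)
      (simp_all only: own mac_region_own_receiver[OF refl])
  finally show ?thesis .
qed

end
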